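(* Let $g\in [H^1(\Omega)]^3$, $\Phi\in [H^1(\Omega)]^{3\times2}$, $f\in[L^2(\Omega)]^3$, and let the penalty parameters $\gamma_0,\gamma_1$ be sufficiently large. Let $\tau>0$ be the time step of the discrete $H^2$-gradient flow and let the initial guess $y_h^0\in\mathbb V_h^k(g,\Phi)$ be an approximate isometry in the sense that $$D_h[y_h^0]=\sum_{T\in\mathcal T_h}\Big|\int_T(\nabla_hy_h^0)^T\nabla_hy_h^0-I\Big|\le\tau .$$ Set $$\varepsilon_0:=\Big(1+C_F^2\big(E_h[y_h^0]+C_F^*R(g,\Phi,f)\big)\Big)\tau,$$ where $R(g,\Phi,f)$ and the constants $C_F,C_F^*$ are as in the context. Then every iterate $y_h^n$, $n\ge1$, of the discrete $H^2$-gradient flow satisfies $$D_h[y_h^n]=\sum_{T\in\mathcal T_h}\Big|\int_T(\nabla_hy_h^n)^T\nabla_hy_h^n-I\Big|\le\varepsilon\qquad\forall\,\varepsilon\ge\varepsilon_0 .$$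
   Context: **Mesh and space.** $\Omega\subset\mathbb R^2$ is a bounded Lipschitz domain and $\partial_D\Omega\subset\partial\Omega$ is a nonempty relatively open subset. $k\ge2$ is a fixed integer; $\mathbb P_k$ (resp. $\mathbb Q_k$) denotes polynomials of total degree at most $k$ (resp. of degree at most $k$ in each variable). The reference element $\widehat T$ is the unit triangle (resp. unit square). $\{\mathcal T_h\}_{h>0}$ is a shape-regular, possibly graded, sequence of meshes representing $\Omega$ exactly, made of closed elements $T=F_T(\widehat T)$ with invertible $F_T\in[\mathbb P_k]^2$ (resp. $[\mathbb Q_k]^2$); shape regularity means $\|DF_T\|_{L^\infty(\widehat T)}\lesssim h_T$ and $\|DF_T^{-1}\|_{L^\infty(T)}\lesssim h_T^{-1}$ uniformly, $h_T$ being the size of $T$. Hanging nodes are allowed provided all elements within each domain of influence (support of a canonical basis function of $\mathbb V_h^k\cap H^1(\Omega)$) have comparable diameters uniformly in $h$. The symbol $h$ is a mesh density function locally equivalent to $h_T$ and to the edge length $h_e$; written as a parameter it is the largest element size. A subscript $h$ on differential operators means they are applied elementwise. $\mathbb V_h^k:=\{v_h\in L^2(\Omega): v_h\circ F_T\in\mathbb P_k\ (\text{resp. }\mathbb Q_k)\ \forall T\in\mathcal T_h\}$. $I$ is the $2\times2$ identity and $|\cdot|$ the Frobenius norm. **Jumps and averages.** $\mathcal E_h^0$ is the set of interior edges, $\mathcal E_h^b$ the set of edges contained in $\partial_D\Omega$, $\mathcal E_h=\mathcal E_h^0\cup\mathcal E_h^b$; $\Gamma_h$ is the union of all $e\in\mathcal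 E_h$. For $e\in\mathcal E_h^0$, $\mu=\mu_e$ is a fixed unit normal to $e$; on the boundary $\mu$ is the outward unit normal. $v^\pm(x)=\lim_{s\to0^+}v(x\pm s\mu_e)$. On $e\in\mathcal E_h^0$: $[v_h]=v_h^--v_h^+$, $[\nabla_hv_h]=\nabla_hv_h^--\nabla_hv_h^+$, $\{v\}=\frac12(v^++v^-)$; on $e\in\mathcal E_h^b$: $\{v\}=v^-$ (interior trace). $\mathbb V_h^k(g,\Phi)$ is the set $[\mathbb V_h^k]^3$ with the convention that on $e\in\mathcal E_h^b$ the boundary jumps are $[v_h]=v_h-g$ and $[\nabla_hv_h]=\nabla_hv_h-\Phi$; $\mathbb V_h^k(0,\boldsymbol0)$ is the case $g=0,\Phi=\boldsymbol0$. **Discrete norm and energy.** $(w_h,v_h)_{H_h^2(\Omega)}=(D_h^2w_h,D_h^2v_h)_{L^2(\Omega)}+(h^{-1}[\nabla_hw_h],[\nabla_hv_h])_{L^2(\Gamma_h)}+(h^{-3}[w_h],[v_h])_{L^2(\Gamma_h)}$ and $\|v_h\|_{H_h^2(\Omega)}^2=(v_h,v_h)_{H_h^2(\Omega)}$ (with the jump convention of the set to which $v_h$ belongs). With $\partial_\mu\nabla y=D^2y\,\mu$, $\partial_\mu\Delta y=\nabla(\Delta y)\,\mu$ (componentwise) and penalty parameters $\gamma_0,\gamma_1>0$, $$a_h(y,v)=(D_h^2y,D_h^2v)_{L^2(\Omega)}-(\{\partial_\mu\nabla_hy\},[\nabla_hv])_{L^2(\Gamma_h)}-(\{\partial_\mu\nabla_hv\},[\nabla_hy])_{L^2(\Gamma_h)}+(\{\partial_\mu\Delta_hy\},[v])_{L^2(\Gamma_h)}+(\{\partial_\mu\Delta_hv\},[y])_{L^2(\Gamma_h)}+\gamma_1(h^{-1}[\nabla_hy],[\nabla_hv])_{L^2(\Gamma_h)}+\gamma_0(h^{-3}[y],[v])_{L^2(\Gamma_h)},$$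 and for $y_h\in\mathbb V_h^k(g,\Phi)$, $E_h[y_h]=\frac12a_h(y_h,y_h)-(f,y_h)_{L^2(\Omega)}$. **Constants.** $R(g,\Phi,f)=\|g\|_{H^1(\Omega)}^2+\|\Phi\|_{H^1(\Omega)}^2+\|f\|_{L^2(\Omega)}^2$. $C_F$ is a constant, independent of $h$, in the Friedrichs-type inequality $\|v_h\|_{L^2(\Omega)}+\|\nabla_hv_h\|_{L^2(\Omega)}\le C_F(\|v_h\|_{H_h^2(\Omega)}+\|g\|_{H^1(\Omega)}+\|\Phi\|_{H^1(\Omega)})$, valid for all $v_h\in\mathbb V_h^k(g,\Phi)$ and all data $(g,\Phi)$ (including $g=0,\Phi=\boldsymbol0$). For $\gamma_0,\gamma_1$ sufficiently large, $a_h(v_h,v_h)\ge\alpha\|v_h\|_{H_h^2(\Omega)}^2$ on $\mathbb V_h^k(0,\boldsymbol0)$ with $\alpha>0$ independent of $h$, and $C_F^*$ is a constant independent of $h$ in the coercivity estimate $\|y_h\|_{H_h^2(\Omega)}^2\le C(E_h[y_h]+C_F^*R(g,\Phi,f))$ for all $y_h\in\mathbb V_h^k(g,\Phi)$ ($C>0$ independent of $h$); in particular $E_h[y_h]\ge-C_F^*R(g,\Phi,f)$. **Discrete $H^2$-gradient flow.** For $y_h\in\mathbb V_h^k(g,\Phi)$, $\mathcal F_h[y_h]=\{v_h\in\mathbb V_h^k(0,\boldsymbol0):\int_T(\nabla_hv_h)^T\nabla_hy_h+(\nabla_hy_h)^T\nabla_hv_h=0\ \forall T\in\mathcal T_h\}$.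 Given $y_h^n$, $n\ge0$, find $\delta y_h^{n+1}\in\mathcal F_h[y_h^n]$ (unique) such that $$\tau^{-1}(\delta y_h^{n+1},v_h)_{H_h^2(\Omega)}+a_h(\delta y_h^{n+1},v_h)=-a_h(y_h^n,v_h)+(f,v_h)_{L^2(\Omega)}\quad\forall v_h\in\mathcal F_h[y_h^n],$$ and set $y_h^{n+1}=y_h^n+\delta y_h^{n+1}$. *)

theory Defs
  imports "HOL-Analysis.Analysis"
begin

text \<open>
  Conventions.  Elements of \<open>L\<^sup>2\<close>, \<open>H\<^sup>1\<close> and of the broken polynomial spaces are represented by
  everywhere defined functions on the plane; only their values almost everywhere in
  \<open>\<Omega>\<close> matter.  A matrix field with values in \<open>m \<times> n\<close> matrices has type
  \<^typ>\<open>real^'n^'m\<close>, so its norm and inner product are the Frobenius ones.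
\<close>

type_synonym vec2 = "real^2"
type_synonym vec3 = "real^3"
type_synonym mat32 = "real^2^3"

section \<open>Domains and arc length\<close>

text \<open>Near each boundary point \<open>\<Omega>\<close> is, in rotated coordinates, the strict epigraph of a
  Lipschitz function.\<close>

definition bounded_lipschitz_domain :: "vec2 set \<Rightarrow> bool" where
  "bounded_lipschitz_domain \<Omega> \<longleftrightarrow>
     open \<Omega> \<and> connected \<Omega> \<and> \<Omega> \<noteq> {} \<and> bounded \<Omega> \<and>
     (\<forall>p\<in>frontier \<Omega>. \<exists>(Q :: vec2 \<Rightarrow> vec2) \<phi> L r. r > 0 \<and> orthogonal_transformation Q \<and>
        L-lipschitz_on UNIV (\<phi> :: real \<Rightarrow> real) \<and>
        (\<forall>x\<in>ball p r. x \<in> \<Omega> \<longleftrightarrow> Q x $ 2 > \<phi> (Q x $ 1)))"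

text \<open>One-dimensional Hausdorff measure (arc length on rectifiable curves).  The outer measure is
  countably additive on Borel sets, so \<^const>\<open>measure_of\<close> does yield it there.\<close>

definition hausdorff1_outer :: "vec2 set \<Rightarrow> ennreal" where
  "hausdorff1_outer A =
     (SUP \<delta>\<in>{0<..}. INF U\<in>{U :: nat \<Rightarrow> vec2 set.
          A \<subseteq> (\<Union>i. U i) \<and> (\<forall>i. bounded (U i) \<and> diameter (U i) \<le> \<delta>)}.
        \<Sum>i. ennreal (diameter (U i)))"

definition arclength :: "vec2 measure" where
  "arclength = measure_of UNIV (sets borel) hausdorff1_outer"

section \<open>Sobolev spaces\<close>

definition L2_space :: "vec2 set \<Rightarrow> (vec2 \<Rightarrow> 'a::euclidean_space) set" where
  "L2_space \<Omega> = {u. u \<in> borel_measurable (lebesgue_on \<Omega>) \<and>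
                    set_integrable lebesgue \<Omega> (\<lambda>x. (norm (u x))\<^sup>2)}"

definition L2_inner :: "vec2 set \<Rightarrow> (vec2 \<Rightarrow> 'a::euclidean_space) \<Rightarrow> (vec2 \<Rightarrow> 'a) \<Rightarrow> real" where
  "L2_inner \<Omega> u v = (LINT x:\<Omega>|lebesgue. u x \<bullet> v x)"

definition L2_norm :: "vec2 set \<Rightarrow> (vec2 \<Rightarrow> 'a::euclidean_space) \<Rightarrow> real" where
  "L2_norm \<Omega> u = sqrt (L2_inner \<Omega> u u)"

primrec C_n :: "nat \<Rightarrow> (vec2 \<Rightarrow> 'a::real_normed_vector) \<Rightarrow> bool" where
  "C_n 0 f = continuous_on UNIV f"
| "C_n (Suc n) f = (\<exists>f1 f2.
      (\<forall>x. (f has_derivative (\<lambda>d. d $ 1 *\<^sub>R f1 x + d $ 2 *\<^sub>R f2 x)) (at x)) \<and>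
      C_n n f1 \<and> C_n n f2)"

definition smooth :: "(vec2 \<Rightarrow> 'a::real_normed_vector) \<Rightarrow> bool" where
  "smooth f \<longleftrightarrow> (\<forall>n. C_n n f)"

definition test_functions :: "vec2 set \<Rightarrow> (vec2 \<Rightarrow> real) set" where
  "test_functions \<Omega> = {\<phi>. smooth \<phi> \<and> compact (closure {x. \<phi> x \<noteq> 0}) \<and>
                          closure {x. \<phi> x \<noteq> 0} \<subseteq> \<Omega>}"

definition has_weak_partial ::
  "vec2 set \<Rightarrow> 2 \<Rightarrow> (vec2 \<Rightarrow> 'a::euclidean_space) \<Rightarrow> (vec2 \<Rightarrow> 'a) \<Rightarrow> bool" where
  "has_weak_partial \<Omega> j u w \<longleftrightarrow> (\<forall>\<phi>\<in>test_functions \<Omega>.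
     (LINT x:\<Omega>|lebesgue. frechet_derivative \<phi> (at x) (axis j 1) *\<^sub>R u x) =
     - (LINT x:\<Omega>|lebesgue. \<phi> x *\<^sub>R w x))"

definition H1_space :: "vec2 set \<Rightarrow> (vec2 \<Rightarrow> 'a::euclidean_space) set" where
  "H1_space \<Omega> = {u \<in> L2_space \<Omega>. \<forall>j. \<exists>w\<in>L2_space \<Omega>. has_weak_partial \<Omega> j u w}"

definition weak_partial ::
  "vec2 set \<Rightarrow> 2 \<Rightarrow> (vec2 \<Rightarrow> 'a::euclidean_space) \<Rightarrow> vec2 \<Rightarrow> 'a" where
  "weak_partial \<Omega> j u = (SOME w. w \<in> L2_space \<Omega> \<and> has_weak_partial \<Omega> j u w)"

definition H1_norm :: "vec2 set \<Rightarrow> (vec2 \<Rightarrow> 'a::euclidean_space) \<Rightarrow> real" where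
  "H1_norm \<Omega> u = sqrt ((L2_norm \<Omega> u)\<^sup>2 + (\<Sum>j\<in>UNIV. (L2_norm \<Omega> (weak_partial \<Omega> j u))\<^sup>2))"

text \<open>\<open>t\<close> represents the trace of \<open>u\<close> on \<open>\<partial>\<Omega>\<close>: it is the \<open>L\<^sup>2(\<partial>\<Omega>)\<close> limit of the boundary values of
  smooth functions that converge to \<open>u\<close> in \<open>H\<^sup>1(\<Omega>)\<close>.  On a bounded Lipschitz domain every \<open>u\<close> in
  \<open>H\<^sup>1(\<Omega>)\<close> has a trace, unique almost everywhere on \<open>\<partial>\<Omega>\<close>.\<close>

definition is_trace :: "vec2 set \<Rightarrow> (vec2 \<Rightarrow> 'a::euclidean_space) \<Rightarrow> (vec2 \<Rightarrow> 'a) \<Rightarrow> bool" where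
  "is_trace \<Omega> u t \<longleftrightarrow>
     t \<in> borel_measurable (restrict_space borel (frontier \<Omega>)) \<and>
     (\<integral>\<^sup>+x\<in>frontier \<Omega>. ennreal ((norm (t x))\<^sup>2) \<partial>arclength) < \<infinity> \<and>
     (\<exists>\<phi>. (\<forall>n. smooth (\<phi> n)) \<and>
        (\<lambda>n::nat. H1_norm \<Omega> (\<lambda>x. \<phi> n x - u x)) \<longlonglongrightarrow> 0 \<and>
        (\<lambda>n. \<integral>\<^sup>+x\<in>frontier \<Omega>. ennreal ((norm (\<phi> n x - t x))\<^sup>2) \<partial>arclength) \<longlonglongrightarrow> 0)"

section \<open>Meshes\<close>

datatype ref_shape = Triangle | Square

fun ref_elem :: "ref_shape \<Rightarrow> vec2 set" where
  "ref_elem Triangle = {x. 0 \<le> x $ 1 \<and> 0 \<le> x $ 2 \<and> x $ 1 + x $ 2 \<le> 1}"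
| "ref_elem Square = {x. 0 \<le> x $ 1 \<and> x $ 1 \<le> 1 \<and> 0 \<le> x $ 2 \<and> x $ 2 \<le> 1}"

fun ref_vertices :: "ref_shape \<Rightarrow> vec2 set" where
  "ref_vertices Triangle = {vector [0,0], vector [1,0], vector [0,1]}"
| "ref_vertices Square = {vector [0,0], vector [1,0], vector [1,1], vector [0,1]}"

fun ref_sides :: "ref_shape \<Rightarrow> vec2 set set" where
  "ref_sides Triangle =
     {closed_segment (vector [0,0]) (vector [1,0]),
      closed_segment (vector [1,0]) (vector [0,1]),
      closed_segment (vector [0,1]) (vector [0,0])}"
| "ref_sides Square =
     {closed_segment (vector [0,0]) (vector [1,0]),
      closed_segment (vector [1,0]) (vector [1,1]),
      closed_segment (vector [1,1]) (vector [0,1]),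
      closed_segment (vector [0,1]) (vector [0,0])}"

text \<open>\<open>\<bbbP>\<^sub>k\<close> on the triangle, \<open>\<bbbQ>\<^sub>k\<close> on the square.\<close>

fun ref_poly :: "ref_shape \<Rightarrow> nat \<Rightarrow> (vec2 \<Rightarrow> real) set" where
  "ref_poly Triangle k =
     {p. \<exists>c. \<forall>x. p x = (\<Sum>i\<le>k. \<Sum>j\<le>k - i. c i j * (x $ 1) ^ i * (x $ 2) ^ j)}"
| "ref_poly Square k =
     {p. \<exists>c. \<forall>x. p x = (\<Sum>i\<le>k. \<Sum>j\<le>k. c i j * (x $ 1) ^ i * (x $ 2) ^ j)}"

text \<open>Lagrange nodes of degree \<open>k\<close>.\<close>

fun ref_nodes :: "ref_shape \<Rightarrow> nat \<Rightarrow> vec2 set" where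
  "ref_nodes Triangle k = {vector [real i / real k, real j / real k] | i j. i + j \<le> k}"
| "ref_nodes Square k = {vector [real i / real k, real j / real k] | i j. i \<le> k \<and> j \<le> k}"

text \<open>\<open>elems\<close> are the closed elements, \<open>emap M T\<close> is the map \<open>F\<^sub>T\<close>, \<open>normal M e\<close> the unit normal
  field \<open>\<mu>\<^sub>e\<close> along an edge \<open>e\<close>, and \<open>density\<close> the mesh density function \<open>h\<close>.\<close>

record mesh =
  elems :: "vec2 set set"
  emap :: "vec2 set \<Rightarrow> vec2 \<Rightarrow> vec2"
  normal :: "vec2 set \<Rightarrow> vec2 \<Rightarrow> vec2"
  density :: "vec2 \<Rightarrow> real"

text \<open>With hanging nodes, interior edges are the nondegenerate intersections of two elements.
  Edges are kept as closed arcs; inclusion of a boundary edge in the relatively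
  open set \<open>\<Gamma> = \<partial>\<^sub>D\<Omega>\<close> is understood for the arc without its endpoints.\<close>

definition int_edges :: "mesh \<Rightarrow> vec2 set set" where
  "int_edges M = {T \<inter> T' | T T'. T \<in> elems M \<and> T' \<in> elems M \<and> T \<noteq> T' \<and> infinite (T \<inter> T')}"

definition bd_edges :: "ref_shape \<Rightarrow> mesh \<Rightarrow> vec2 set \<Rightarrow> vec2 set set" where
  "bd_edges S M \<Gamma> = {emap M T ` s | T s. T \<in> elems M \<and> s \<in> ref_sides S \<and>
                                      emap M T ` rel_interior s \<subseteq> \<Gamma>}"

definition edges :: "ref_shape \<Rightarrow> mesh \<Rightarrow> vec2 set \<Rightarrow> vec2 set set" where
  "edges S M \<Gamma> = int_edges M \<union> bd_edges S M \<Gamma>"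

text \<open>\<open>m\<close> is the unit vector normal to the arc \<open>e\<close> at \<open>x\<close> that points out of the closed set \<open>A\<close>.\<close>

definition outward_unit_normal :: "vec2 set \<Rightarrow> vec2 set \<Rightarrow> vec2 \<Rightarrow> vec2 \<Rightarrow> bool" where
  "outward_unit_normal A e x m \<longleftrightarrow> norm m = 1 \<and>
     ((\<lambda>z. ((z - x) \<bullet> m) / norm (z - x)) \<longlongrightarrow> 0) (at x within e) \<and>
     (\<forall>\<^sub>F s in at_right 0. x - s *\<^sub>R m \<in> interior A \<and> x + s *\<^sub>R m \<notin> A)"

text \<open>A mesh representing \<open>\<Omega>\<close> exactly, possibly with hanging nodes: two different elements are
  disjoint, meet in one point, or meet in an arc that is part of one side of each.
  On an interior edge the orientation of the normal is fixed by choosing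
  which of the adjacent elements it points out of; endpoints of edges are exempt from the
  conditions on the normal.\<close>

definition mesh_of :: "ref_shape \<Rightarrow> nat \<Rightarrow> vec2 set \<Rightarrow> vec2 set \<Rightarrow> mesh \<Rightarrow> bool" where
  "mesh_of S k \<Omega> \<Gamma> M \<longleftrightarrow>
     finite (elems M) \<and> elems M \<noteq> {} \<and> \<Union>(elems M) = closure \<Omega> \<and>
     (\<forall>T\<in>elems M. emap M T ` ref_elem S = T \<and> inj_on (emap M T) (ref_elem S) \<and>
        (\<forall>i. (\<lambda>x. emap M T x $ i) \<in> ref_poly S k) \<and>
        (\<forall>s\<in>ref_sides S. emap M T ` s \<subseteq> frontier \<Omega> \<or> emap M T ` rel_interior s \<subseteq> \<Omega>)) \<and>
     (\<forall>T\<in>elems M. \<forall>T'\<in>elems M. T \<noteq> T' \<longrightarrow>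
        interior T \<inter> interior T' = {} \<and>
        (T \<inter> T' = {} \<or> (\<exists>p. T \<inter> T' = {p}) \<or>
         (\<exists>s\<in>ref_sides S. \<exists>s'\<in>ref_sides S. \<exists>a b a' b'. a \<noteq> b \<and> a' \<noteq> b' \<and>
            closed_segment a b \<subseteq> s \<and> closed_segment a' b' \<subseteq> s' \<and>
            T \<inter> T' = emap M T ` closed_segment a b \<and>
            T \<inter> T' = emap M T' ` closed_segment a' b'))) \<and>
     (\<forall>e\<in>int_edges M. \<exists>T\<in>elems M. e \<subseteq> T \<and>
        (\<exists>N. finite N \<and> (\<forall>x\<in>e - N. outward_unit_normal T e x (normal M e x)))) \<and>
     (\<forall>e\<in>bd_edges S M \<Gamma>.
        (\<exists>N. finite N \<and> (\<forall>x\<in>e - N. outward_unit_normal (closure \<Omega>) e x (normal M e x)))) \<and>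
     density M \<in> borel_measurable borel \<and> (\<forall>x. density M x > 0)"

text \<open>\<open>|DF\<^sub>T| \<lesssim> h\<^sub>T\<close> and \<open>|DF\<^sub>T\<^sup>-\<^sup>1| \<lesssim> 1/h\<^sub>T\<close>; the Jacobian of the inverse map at \<open>F\<^sub>T x\<close> is the inverse
  matrix of the Jacobian at \<open>x\<close>.\<close>

definition shape_regular :: "ref_shape \<Rightarrow> real \<Rightarrow> mesh \<Rightarrow> bool" where
  "shape_regular S C M \<longleftrightarrow> (\<forall>T\<in>elems M. \<forall>x\<in>ref_elem S.
     invertible (jacobian (emap M T) (at x)) \<and>
     norm (jacobian (emap M T) (at x)) \<le> C * diameter T \<and>
     norm (matrix_inv (jacobian (emap M T) (at x))) \<le> C / diameter T)"

definition density_equivalent :: "ref_shape \<Rightarrow> vec2 set \<Rightarrow> real \<Rightarrow> mesh \<Rightarrow> bool" where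
  "density_equivalent S \<Gamma> C M \<longleftrightarrow>
     (\<forall>T\<in>elems M. \<forall>x\<in>T. density M x \<le> C * diameter T \<and> diameter T \<le> C * density M x) \<and>
     (\<forall>e\<in>edges S M \<Gamma>. \<forall>x\<in>e. density M x \<le> C * measure arclength e \<and>
                              measure arclength e \<le> C * density M x)"

section \<open>Broken polynomial spaces\<close>

text \<open>The identity \<open>v \<circ> F\<^sub>T = p\<close> holds up to a null set in \<open>T\<close>: values on element boundaries are free.\<close>

definition Vh :: "ref_shape \<Rightarrow> nat \<Rightarrow> vec2 set \<Rightarrow> mesh \<Rightarrow> (vec2 \<Rightarrow> real) set" where
  "Vh S k \<Omega> M = {v \<in> L2_space \<Omega>. \<forall>T\<in>elems M. \<exists>p\<in>ref_poly S k.
                    \<forall>x\<in>interior (ref_elem S). v (emap M T x) = p x}"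

definition Vh3 :: "ref_shape \<Rightarrow> nat \<Rightarrow> vec2 set \<Rightarrow> mesh \<Rightarrow> (vec2 \<Rightarrow> vec3) set" where
  "Vh3 S k \<Omega> M = {v. \<forall>i. (\<lambda>x. v x $ i) \<in> Vh S k \<Omega> M}"

text \<open>Canonical (nodal) basis functions of the conforming subspace, attached to the proper nodes,
  that is, to the points that are nodes of all elements containing them.  The
  domain of influence of such a function is its support.\<close>

definition proper_nodes :: "ref_shape \<Rightarrow> nat \<Rightarrow> mesh \<Rightarrow> vec2 set" where
  "proper_nodes S k M = {P \<in> \<Union>(elems M). \<forall>T\<in>elems M. P \<in> T \<longrightarrow> P \<in> emap M T ` ref_nodes S k}"

definition canonical_basis :: "ref_shape \<Rightarrow> nat \<Rightarrow> vec2 set \<Rightarrow> mesh \<Rightarrow> (vec2 \<Rightarrow> real) set" where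
  "canonical_basis S k \<Omega> M = {\<phi> \<in> Vh S k \<Omega> M \<inter> H1_space \<Omega>. continuous_on (closure \<Omega>) \<phi> \<and>
     (\<exists>P\<in>proper_nodes S k M. \<phi> P = 1 \<and> (\<forall>P'\<in>proper_nodes S k M - {P}. \<phi> P' = 0))}"

definition domain_of_influence :: "vec2 set \<Rightarrow> (vec2 \<Rightarrow> real) \<Rightarrow> vec2 set" where
  "domain_of_influence \<Omega> \<phi> = closure {x \<in> \<Omega>. \<phi> x \<noteq> 0}"

definition comparable_elements :: "ref_shape \<Rightarrow> nat \<Rightarrow> vec2 set \<Rightarrow> real \<Rightarrow> mesh \<Rightarrow> bool" where
  "comparable_elements S k \<Omega> C M \<longleftrightarrow> (\<forall>\<phi>\<in>canonical_basis S k \<Omega> M. \<forall>T\<in>elems M. \<forall>T'\<in>elems M.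
     T \<subseteq> domain_of_influence \<Omega> \<phi> \<and> T' \<subseteq> domain_of_influence \<Omega> \<phi> \<longrightarrow>
     diameter T \<le> C * diameter T')"

text \<open>The family is indexed by a set \<open>H\<close> of positive numbers, the index being the largest element
  size; the constant \<open>C\<close> is uniform in the index.\<close>

definition mesh_family ::
  "ref_shape \<Rightarrow> nat \<Rightarrow> vec2 set \<Rightarrow> vec2 set \<Rightarrow> real set \<Rightarrow> (real \<Rightarrow> mesh) \<Rightarrow> bool" where
  "mesh_family S k \<Omega> \<Gamma> H \<T> \<longleftrightarrow> H \<subseteq> {0<..} \<and>
     (\<forall>h\<in>H. mesh_of S k \<Omega> \<Gamma> (\<T> h) \<and> Max (diameter ` elems (\<T> h)) = h) \<and>
     (\<exists>C. \<forall>h\<in>H. shape_regular S C (\<T> h) \<and> density_equivalent S \<Gamma> C (\<T> h) \<and>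
                 comparable_elements S k \<Omega> C (\<T> h))"

section \<open>Elementwise derivatives, jumps and averages\<close>

text \<open>Classical pointwise derivatives.  For a function in the broken space and a point in the
  interior of an element they are the elementwise derivatives; the remaining points form
  a null set.\<close>

definition grad :: "(vec2 \<Rightarrow> vec3) \<Rightarrow> vec2 \<Rightarrow> mat32" where
  "grad y x = jacobian y (at x)"

definition hess :: "(vec2 \<Rightarrow> vec3) \<Rightarrow> vec2 \<Rightarrow> real^2^2^3" where
  "hess y x = (\<chi> i. jacobian (\<lambda>z. grad y z $ i) (at x))"

definition laplacian :: "(vec2 \<Rightarrow> vec3) \<Rightarrow> vec2 \<Rightarrow> vec3" where
  "laplacian y x = (\<chi> i. trace (hess y x $ i))"

definition trace_minus :: "mesh \<Rightarrow> vec2 set \<Rightarrow> (vec2 \<Rightarrow> 'a::euclidean_space) \<Rightarrow> vec2 \<Rightarrow> 'a" where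
  "trace_minus M e v x = Lim (at_right 0) (\<lambda>s. v (x - s *\<^sub>R normal M e x))"

definition trace_plus :: "mesh \<Rightarrow> vec2 set \<Rightarrow> (vec2 \<Rightarrow> 'a::euclidean_space) \<Rightarrow> vec2 \<Rightarrow> 'a" where
  "trace_plus M e v x = Lim (at_right 0) (\<lambda>s. v (x + s *\<^sub>R normal M e x))"

text \<open>\<open>b\<close> is the prescribed boundary value, subtracted in the jump on boundary edges.\<close>

definition jump ::
  "mesh \<Rightarrow> (vec2 \<Rightarrow> 'a::euclidean_space) \<Rightarrow> (vec2 \<Rightarrow> 'a) \<Rightarrow> vec2 set \<Rightarrow> vec2 \<Rightarrow> 'a" where
  "jump M b v e x = (if e \<in> int_edges M then trace_minus M e v x - trace_plus M e v x
                     else trace_minus M e v x - b x)"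

definition average ::
  "mesh \<Rightarrow> (vec2 \<Rightarrow> 'a::euclidean_space) \<Rightarrow> vec2 set \<Rightarrow> vec2 \<Rightarrow> 'a" where
  "average M v e x = (if e \<in> int_edges M then (1/2) *\<^sub>R (trace_plus M e v x + trace_minus M e v x)
                      else trace_minus M e v x)"

definition avg_dn_grad :: "mesh \<Rightarrow> (vec2 \<Rightarrow> vec3) \<Rightarrow> vec2 set \<Rightarrow> vec2 \<Rightarrow> mat32" where
  "avg_dn_grad M y e x = average M (\<lambda>z. \<chi> i. hess y z $ i *v normal M e x) e x"

definition avg_dn_lap :: "mesh \<Rightarrow> (vec2 \<Rightarrow> vec3) \<Rightarrow> vec2 set \<Rightarrow> vec2 \<Rightarrow> vec3" where
  "avg_dn_lap M y e x = average M (\<lambda>z. grad (laplacian y) z *v normal M e x) e x"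

text \<open>The integral over \<open>\<Gamma>\<^sub>h\<close>; the integrand may depend on the edge through its normal, and
  different edges share only finitely many points.\<close>

definition skeleton_integral ::
  "ref_shape \<Rightarrow> mesh \<Rightarrow> vec2 set \<Rightarrow> (vec2 set \<Rightarrow> vec2 \<Rightarrow> real) \<Rightarrow> real" where
  "skeleton_integral S M \<Gamma> w = (\<Sum>e\<in>edges S M \<Gamma>. LINT x:e|arclength. w e x)"

section \<open>Discrete norm, bilinear form and energy\<close>

text \<open>An element \<open>y\<close> of \<open>\<bbbV>\<^sub>h\<^sup>k(g,\<Phi>)\<close> is an element of \<^const>\<open>Vh3\<close>
  together with the pair \<open>b\<close> of the boundary values (traces) of \<open>g\<close> and \<open>\<Phi>\<close>, which enter the
  boundary jumps; \<open>\<bbbV>\<^sub>h\<^sup>k(0,0)\<close> corresponds to the pair \<open>zero_bd\<close>.\<close>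

type_synonym bdata = "(vec2 \<Rightarrow> vec3) \<times> (vec2 \<Rightarrow> mat32)"

definition zero_bd :: bdata where
  "zero_bd = ((\<lambda>_. 0), (\<lambda>_. 0))"

definition H2h_inner ::
  "ref_shape \<Rightarrow> vec2 set \<Rightarrow> vec2 set \<Rightarrow> mesh \<Rightarrow>
   bdata \<Rightarrow> (vec2 \<Rightarrow> vec3) \<Rightarrow> bdata \<Rightarrow> (vec2 \<Rightarrow> vec3) \<Rightarrow> real" where
  "H2h_inner S \<Omega> \<Gamma> M bw w bv v =
     L2_inner \<Omega> (hess w) (hess v)
     + skeleton_integral S M \<Gamma> (\<lambda>e x. inverse (density M x) *
         (jump M (snd bw) (grad w) e x \<bullet> jump M (snd bv) (grad v) e x))
     + skeleton_integral S M \<Gamma> (\<lambda>e x. inverse (density M x ^ 3) *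
         (jump M (fst bw) w e x \<bullet> jump M (fst bv) v e x))"

definition H2h_norm ::
  "ref_shape \<Rightarrow> vec2 set \<Rightarrow> vec2 set \<Rightarrow> mesh \<Rightarrow> bdata \<Rightarrow> (vec2 \<Rightarrow> vec3) \<Rightarrow> real" where
  "H2h_norm S \<Omega> \<Gamma> M b v = sqrt (H2h_inner S \<Omega> \<Gamma> M b v b v)"

definition a_h ::
  "ref_shape \<Rightarrow> vec2 set \<Rightarrow> vec2 set \<Rightarrow> mesh \<Rightarrow> real \<Rightarrow> real \<Rightarrow>
   bdata \<Rightarrow> (vec2 \<Rightarrow> vec3) \<Rightarrow> bdata \<Rightarrow> (vec2 \<Rightarrow> vec3) \<Rightarrow> real" where
  "a_h S \<Omega> \<Gamma> M \<gamma>0 \<gamma>1 by y bv v =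
     L2_inner \<Omega> (hess y) (hess v)
     - skeleton_integral S M \<Gamma> (\<lambda>e x. avg_dn_grad M y e x \<bullet> jump M (snd bv) (grad v) e x)
     - skeleton_integral S M \<Gamma> (\<lambda>e x. avg_dn_grad M v e x \<bullet> jump M (snd by) (grad y) e x)
     + skeleton_integral S M \<Gamma> (\<lambda>e x. avg_dn_lap M y e x \<bullet> jump M (fst bv) v e x)
     + skeleton_integral S M \<Gamma> (\<lambda>e x. avg_dn_lap M v e x \<bullet> jump M (fst by) y e x)
     + \<gamma>1 * skeleton_integral S M \<Gamma> (\<lambda>e x. inverse (density M x) *
         (jump M (snd by) (grad y) e x \<bullet> jump M (snd bv) (grad v) e x))
     + \<gamma>0 * skeleton_integral S M \<Gamma> (\<lambda>e x. inverse (density M x ^ 3) *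
         (jump M (fst by) y e x \<bullet> jump M (fst bv) v e x))"

definition E_h ::
  "ref_shape \<Rightarrow> vec2 set \<Rightarrow> vec2 set \<Rightarrow> mesh \<Rightarrow> real \<Rightarrow> real \<Rightarrow>
   (vec2 \<Rightarrow> vec3) \<Rightarrow> bdata \<Rightarrow> (vec2 \<Rightarrow> vec3) \<Rightarrow> real" where
  "E_h S \<Omega> \<Gamma> M \<gamma>0 \<gamma>1 f b y = 1/2 * a_h S \<Omega> \<Gamma> M \<gamma>0 \<gamma>1 b y b y - L2_inner \<Omega> f y"

section \<open>Data and constants\<close>

definition admissible_data :: "vec2 set \<Rightarrow> (vec2 \<Rightarrow> vec3) \<Rightarrow> (vec2 \<Rightarrow> mat32) \<Rightarrow> bdata \<Rightarrow> bool" where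
  "admissible_data \<Omega> g \<Phi> b \<longleftrightarrow> g \<in> H1_space \<Omega> \<and> \<Phi> \<in> H1_space \<Omega> \<and>
     is_trace \<Omega> g (fst b) \<and> is_trace \<Omega> \<Phi> (snd b)"

definition R_data :: "vec2 set \<Rightarrow> (vec2 \<Rightarrow> vec3) \<Rightarrow> (vec2 \<Rightarrow> mat32) \<Rightarrow> (vec2 \<Rightarrow> vec3) \<Rightarrow> real" where
  "R_data \<Omega> g \<Phi> f = (H1_norm \<Omega> g)\<^sup>2 + (H1_norm \<Omega> \<Phi>)\<^sup>2 + (L2_norm \<Omega> f)\<^sup>2"

text \<open>\<open>CF\<close> is a Friedrichs constant, and \<open>CFs\<close> a constant (for given penalty parameters) in the
  coercivity estimate, for the whole mesh family and for all data.\<close>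

definition friedrichs_constant ::
  "ref_shape \<Rightarrow> nat \<Rightarrow> vec2 set \<Rightarrow> vec2 set \<Rightarrow> real set \<Rightarrow> (real \<Rightarrow> mesh) \<Rightarrow> real \<Rightarrow> bool" where
  "friedrichs_constant S k \<Omega> \<Gamma> H \<T> CF \<longleftrightarrow>
     (\<forall>h\<in>H. \<forall>g \<Phi> b. admissible_data \<Omega> g \<Phi> b \<longrightarrow> (\<forall>v\<in>Vh3 S k \<Omega> (\<T> h).
        L2_norm \<Omega> v + L2_norm \<Omega> (grad v)
          \<le> CF * (H2h_norm S \<Omega> \<Gamma> (\<T> h) b v + H1_norm \<Omega> g + H1_norm \<Omega> \<Phi>)))"

definition coercivity_constant ::
  "ref_shape \<Rightarrow> nat \<Rightarrow> vec2 set \<Rightarrow> vec2 set \<Rightarrow> real set \<Rightarrow> (real \<Rightarrow> mesh) \<Rightarrow>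
   real \<Rightarrow> real \<Rightarrow> real \<Rightarrow> bool" where
  "coercivity_constant S k \<Omega> \<Gamma> H \<T> \<gamma>0 \<gamma>1 CFs \<longleftrightarrow>
     (\<exists>C>0. \<forall>h\<in>H. \<forall>g \<Phi> b. \<forall>f\<in>L2_space \<Omega>. admissible_data \<Omega> g \<Phi> b \<longrightarrow>
        (\<forall>y\<in>Vh3 S k \<Omega> (\<T> h).
          (H2h_norm S \<Omega> \<Gamma> (\<T> h) b y)\<^sup>2
            \<le> C * (E_h S \<Omega> \<Gamma> (\<T> h) \<gamma>0 \<gamma>1 f b y + CFs * R_data \<Omega> g \<Phi> f)))"

section \<open>Isometry defect and discrete gradient flow\<close>

definition isometry_defect :: "mesh \<Rightarrow> (vec2 \<Rightarrow> vec3) \<Rightarrow> real" where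
  "isometry_defect M y = (\<Sum>T\<in>elems M.
     norm (LINT x:T|lebesgue. transpose (grad y x) ** grad y x - mat 1))"

text \<open>Subspace of \<open>\<bbbV>\<^sub>h\<^sup>k(0,0)\<close>.\<close>

definition F_h ::
  "ref_shape \<Rightarrow> nat \<Rightarrow> vec2 set \<Rightarrow> mesh \<Rightarrow> (vec2 \<Rightarrow> vec3) \<Rightarrow> (vec2 \<Rightarrow> vec3) set" where
  "F_h S k \<Omega> M y = {v \<in> Vh3 S k \<Omega> M. \<forall>T\<in>elems M.
     (LINT x:T|lebesgue. transpose (grad v x) ** grad y x + transpose (grad y x) ** grad v x) = 0}"

definition gradient_flow ::
  "ref_shape \<Rightarrow> nat \<Rightarrow> vec2 set \<Rightarrow> vec2 set \<Rightarrow> mesh \<Rightarrow> real \<Rightarrow> real \<Rightarrow> (vec2 \<Rightarrow> vec3) \<Rightarrow> bdata \<Rightarrow>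
   real \<Rightarrow> (nat \<Rightarrow> vec2 \<Rightarrow> vec3) \<Rightarrow> bool" where
  "gradient_flow S k \<Omega> \<Gamma> M \<gamma>0 \<gamma>1 f b \<tau> y \<longleftrightarrow>
     (\<forall>n. \<exists>\<delta>\<in>F_h S k \<Omega> M (y n).
        (\<forall>v\<in>F_h S k \<Omega> M (y n).
           inverse \<tau> * H2h_inner S \<Omega> \<Gamma> M zero_bd \<delta> zero_bd v
             + a_h S \<Omega> \<Gamma> M \<gamma>0 \<gamma>1 zero_bd \<delta> zero_bd v
           = - a_h S \<Omega> \<Gamma> M \<gamma>0 \<gamma>1 b (y n) zero_bd v + L2_inner \<Omega> f v) \<and>
        y (Suc n) = (\<lambda>x. y n x + \<delta> x))"

end

theory Submission
  imports Defs
begin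

text \<open>
  Testing the flow equation with \<open>v = \<delta>y\<close> and expanding \<open>E\<^sub>h[y + \<delta>y]\<close> gives
  \<open>E\<^sub>h[y + \<delta>y] = E\<^sub>h[y] - \<tau>\<^sup>-\<^sup>1 \<parallel>\<delta>y\<parallel>\<^sup>2 - a\<^sub>h(\<delta>y, \<delta>y) / 2\<close>, while the linearised constraint removes the
  mixed terms of the isometry defect, which therefore grows by at most \<open>\<parallel>\<nabla>\<^sub>h \<delta>y\<parallel>\<^sup>2 \<le> C\<^sub>F\<^sup>2 \<parallel>\<delta>y\<parallel>\<^sup>2\<close>;
  the sum over the steps telescopes, and the energy is bounded below by \<open>- C\<^sub>F\<^sup>* R\<close>.
  The homogeneous facts \<open>a\<^sub>h(v, v) \<ge> 0\<close> and \<open>\<parallel>\<nabla>\<^sub>h v\<parallel> \<le> C\<^sub>F \<parallel>v\<parallel>\<close> are the leading-order terms, as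
  \<open>s \<rightarrow> \<infinity>\<close>, of the estimates with data applied to \<open>y + s v\<close>.

  The substance is that \<open>a\<^sub>h\<close> and the \<open>H\<^sub>h\<^sup>2\<close> product really are bilinear, that is, that all
  integrals and traces exist.  Pulled back to the reference element, functions in \<open>\<bbbV>\<^sub>h\<^sup>k\<close> and all
  their derivatives are rational functions whose denominator is a power of the Jacobian determinant,
  so they extend continuously to the closed elements.  Off finitely many points of an edge the normal
  is transversal to it, by the inverse function theorem, so the one-sided limits
  are values of these extensions.
\<close>

section \<open>Rational functions\<close>

text \<open>Three conventions shape the work. A Bochner integral of a non-integrable function is 0
  and \<open>Lim\<close> is unspecified where no limit exists, so no term of \<open>a_h\<close> can
  be split before integrability and traces are secured. Functions in the broken space are free on
  element boundaries, so identities hold in element interiors only and reach \<Omega> and the edges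
  up to null sets. The normal is prescribed only by a limit along the edge and a choice of inner
  side, so even its measurability has to be derived, by comparing it with the transported normal of
  a reference side.

  Zero data are not inserted into the given estimates, because \<open>H1_norm\<close> of zero
  contains \<open>weak_partial\<close>, a chosen weak derivative, and its vanishing would call for
  uniqueness of weak derivatives. Along y + s v any fixed data term disappears in the limit.

  In \<epsilon>_0 the summand 1 accounts for the initial defect \<tau>; the factor \<tau> at the
  energy comes from the bound of the squared norm of a step by \<tau> times the energy drop.\<close>

lemma real_polynomial_function_component: "real_polynomial_function (\<lambda>x::real^'n. x $ i)"
  by (simp add: real_polynomial_function.intros(1) bounded_linear_vec_nth)

text \<open>The coefficient functions are produced together with the expansion of the total
  derivative, so that the sum and product rules can be run through the induction.\<close>

lemma real_polynomial_function_partials: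
  fixes p :: "real^'n \<Rightarrow> real"
  assumes "real_polynomial_function p"
  shows "\<exists>p'. (\<forall>j. real_polynomial_function (p' j)) \<and>
    (\<forall>x. (p has_derivative (\<lambda>h. \<Sum>j\<in>UNIV. h $ j * p' j x)) (at x))"
  using assms
proof induction
  case (linear f)
  interpret bounded_linear f by fact
  have f_eq: "f = (\<lambda>h. \<Sum>j\<in>UNIV. h $ j * f (axis j 1))"
  proof
    fix h
    have "f h = f (\<Sum>j\<in>UNIV. h $ j *s axis j 1)"
      by (simp add: basis_expansion)
    also have "\<dots> = (\<Sum>j\<in>UNIV. h $ j * f (axis j 1))"
      by (simp only: sum scale scalar_mult_eq_scaleR real_scaleR_def)
    finally show "f h = (\<Sum>j\<in>UNIV. h $ j * f (axis j 1))" .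
  qed
  have "(f has_derivative f) (at x)" for x
    by (rule bounded_linear_imp_has_derivative) fact
  then show ?case
    using f_eq
    by (intro exI[of _ "\<lambda>j _. f (axis j 1)"]) (auto intro: real_polynomial_function.intros(2))
next
  case (const c)
  show ?case
    by (intro exI[of _ "\<lambda>_ _. 0"]) (auto intro: real_polynomial_function.intros(2))
next
  case (add f g)
  then obtain f' g' where *:
    "\<And>j. real_polynomial_function (f' j)" "\<And>j. real_polynomial_function (g' j)"
    "\<And>x. (f has_derivative (\<lambda>h. \<Sum>j\<in>UNIV. h $ j * f' j x)) (at x)"
    "\<And>x. (g has_derivative (\<lambda>h. \<Sum>j\<in>UNIV. h $ j * g' j x)) (at x)"
    by blast
  have "((\<lambda>x. f x + g x) has_derivative (\<lambda>h. \<Sum>j\<in>UNIV. h $ j * (f' j x + g' j x))) (at x)" for x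
    by (rule has_derivative_eq_rhs[OF has_derivative_add[OF *(3,4)]])
       (simp add: fun_eq_iff distrib_left sum.distrib)
  then show ?case
    using * by (intro exI[of _ "\<lambda>j x. f' j x + g' j x"]) (auto intro!: real_polynomial_function.intros(3))
next
  case (mult f g)
  then obtain f' g' where *:
    "\<And>j. real_polynomial_function (f' j)" "\<And>j. real_polynomial_function (g' j)"
    "\<And>x. (f has_derivative (\<lambda>h. \<Sum>j\<in>UNIV. h $ j * f' j x)) (at x)"
    "\<And>x. (g has_derivative (\<lambda>h. \<Sum>j\<in>UNIV. h $ j * g' j x)) (at x)"
    by blast
  have "((\<lambda>x. f x * g x) has_derivative
          (\<lambda>h. \<Sum>j\<in>UNIV. h $ j * (f x * g' j x + f' j x * g x))) (at x)" for x
    by (rule has_derivative_eq_rhs[OF has_derivative_mult[OF *(3,4)]])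
       (simp add: fun_eq_iff distrib_left sum.distrib sum_distrib_left sum_distrib_right mult_ac)
  then show ?case
    using * mult.hyps
    by (intro exI[of _ "\<lambda>j x. f x * g' j x + f' j x * g x"])
       (auto intro!: real_polynomial_function.intros(3) real_polynomial_function.intros(4))
qed

text \<open>The algebra generated by the polynomials and 1/d. A single denominator suffices, since
  the derivative of 1/d is the derivative of -d times the square of 1/d. At zeros of d the generator
  takes the value 0, so analytic statements are restricted to points with d x \<noteq> 0.\<close>

inductive_set rational_functions :: "('a::real_normed_vector \<Rightarrow> real) \<Rightarrow> ('a \<Rightarrow> real) set"
  for d where
  poly: "real_polynomial_function p \<Longrightarrow> p \<in> rational_functions d"
| inverse: "(\<lambda>x. inverse (d x)) \<in> rational_functions d"
| add: "p \<in> rational_functions d \<Longrightarrow> q \<in> rational_functions d \<Longrightarrow>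
    (\<lambda>x. p x + q x) \<in> rational_functions d"
| mult: "p \<in> rational_functions d \<Longrightarrow> q \<in> rational_functions d \<Longrightarrow>
    (\<lambda>x. p x * q x) \<in> rational_functions d"

lemma rational_functions_sum:
  assumes "\<And>i. i \<in> I \<Longrightarrow> p i \<in> rational_functions d"
  shows "(\<lambda>x. \<Sum>i\<in>I. p i x) \<in> rational_functions d"
  using assms
proof (induction I rule: infinite_finite_induct)
  case (insert i I)
  then show ?case
    by (auto intro: rational_functions.add)
qed (auto intro: rational_functions.poly real_polynomial_function.intros(2))

lemma rational_functions_minus:
  "p \<in> rational_functions d \<Longrightarrow> (\<lambda>x. - p x) \<in> rational_functions d"
  using rational_functions.mult[of "\<lambda>_. -1" d p]
  by (auto intro: rational_functions.poly real_polynomial_function.intros(2))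

lemma rational_functions_partials:
  fixes d :: "real^'n \<Rightarrow> real"
  assumes d: "real_polynomial_function d" and q: "q \<in> rational_functions d"
  shows "\<exists>q'. (\<forall>j. q' j \<in> rational_functions d) \<and>
    (\<forall>x. d x \<noteq> 0 \<longrightarrow> (q has_derivative (\<lambda>h. \<Sum>j\<in>UNIV. h $ j * q' j x)) (at x))"
  using q
proof induction
  case (poly p)
  then show ?case
    using real_polynomial_function_partials[OF poly.hyps] rational_functions.poly by blast
next
  case inverse
  obtain d' where d': "\<And>j. real_polynomial_function (d' j)"
    "\<And>x. (d has_derivative (\<lambda>h. \<Sum>j\<in>UNIV. h $ j * d' j x)) (at x)"
    using real_polynomial_function_partials[OF d] by blast
  have "((\<lambda>x. inverse (d x)) has_derivative
      (\<lambda>h. \<Sum>j\<in>UNIV. h $ j * (- (inverse (d x) * (d' j x * inverse (d x)))))) (at x)"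
    if "d x \<noteq> 0" for x
    by (rule has_derivative_eq_rhs[OF Deriv.has_derivative_inverse[OF that d'(2)]])
       (simp add: fun_eq_iff sum_distrib_left sum_distrib_right sum_negf mult_ac)
  then show ?case
    using d'(1)
    by (intro exI[of _ "\<lambda>j x. - (inverse (d x) * (d' j x * inverse (d x)))"])
       (intro conjI allI impI rational_functions_minus rational_functions.mult
          rational_functions.inverse rational_functions.poly; simp)
next
  case (add f g)
  then obtain f' g' where *:
    "\<And>j. f' j \<in> rational_functions d" "\<And>j. g' j \<in> rational_functions d"
    "\<And>x. d x \<noteq> 0 \<Longrightarrow> (f has_derivative (\<lambda>h. \<Sum>j\<in>UNIV. h $ j * f' j x)) (at x)"
    "\<And>x. d x \<noteq> 0 \<Longrightarrow> (g has_derivative (\<lambda>h. \<Sum>j\<in>UNIV. h $ j * g' j x)) (at x)"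
    by blast
  have "((\<lambda>x. f x + g x) has_derivative (\<lambda>h. \<Sum>j\<in>UNIV. h $ j * (f' j x + g' j x))) (at x)"
    if "d x \<noteq> 0" for x
    by (rule has_derivative_eq_rhs[OF has_derivative_add[OF *(3,4)[OF that]]])
       (simp add: fun_eq_iff distrib_left sum.distrib)
  then show ?case
    using * by (intro exI[of _ "\<lambda>j x. f' j x + g' j x"]) (auto intro!: rational_functions.add)
next
  case (mult f g)
  then obtain f' g' where *:
    "\<And>j. f' j \<in> rational_functions d" "\<And>j. g' j \<in> rational_functions d"
    "\<And>x. d x \<noteq> 0 \<Longrightarrow> (f has_derivative (\<lambda>h. \<Sum>j\<in>UNIV. h $ j * f' j x)) (at x)"
    "\<And>x. d x \<noteq> 0 \<Longrightarrow> (g has_derivative (\<lambda>h. \<Sum>j\<in>UNIV. h $ j * g' j x)) (at x)"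
    by blast
  have "((\<lambda>x. f x * g x) has_derivative
          (\<lambda>h. \<Sum>j\<in>UNIV. h $ j * (f x * g' j x + f' j x * g x))) (at x)" if "d x \<noteq> 0" for x
    by (rule has_derivative_eq_rhs[OF has_derivative_mult[OF *(3,4)[OF that]]])
       (simp add: fun_eq_iff distrib_left sum.distrib sum_distrib_left sum_distrib_right mult_ac)
  then show ?case
    using * mult.hyps
    by (intro exI[of _ "\<lambda>j x. f x * g' j x + f' j x * g x"])
       (auto intro!: rational_functions.add rational_functions.mult)
qed

lemma continuous_on_rational_functions:
  fixes d :: "real^'n \<Rightarrow> real"
  assumes "real_polynomial_function d" "q \<in> rational_functions d" "\<And>x. x \<in> K \<Longrightarrow> d x \<noteq> 0"
  shows "continuous_on K q"
proof -
  obtain q' where "\<And>x. d x \<noteq> 0 \<Longrightarrow> (q has_derivative (\<lambda>h. \<Sum>j\<in>UNIV. h $ j * q' j x)) (at x)"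
    using rational_functions_partials[OF assms(1,2)] by blast
  then show ?thesis
    using assms(3) by (meson continuous_at_imp_continuous_on has_derivative_continuous)
qed

section \<open>Calculus of Jacobian matrices\<close>

lemma has_derivative_componentwise_vec:
  fixes y :: "'a::real_normed_vector \<Rightarrow> real^'m"
  assumes "\<And>i. ((\<lambda>z. y z $ i) has_derivative (\<lambda>h. y' h $ i)) (at z)"
  shows "(y has_derivative y') (at z)"
  unfolding has_derivative_componentwise_within[of y]
  using assms by (auto simp: Basis_vec_def inner_axis)

lemma jacobian_unique:
  fixes f :: "real^'n \<Rightarrow> real^'m"
  assumes "(f has_derivative ((*v) A)) (at x)"
  shows "jacobian f (at x) = A"
  by (simp add: jacobian_def matrix_of_matrix_vector_mul flip: frechet_derivative_at[OF assms])

lemma jacobian_add_scaleR: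
  fixes f g :: "real^'n \<Rightarrow> real^'m"
  assumes "f differentiable (at x)" "g differentiable (at x)"
  shows "jacobian (\<lambda>z. f z + c *\<^sub>R g z) (at x) = jacobian f (at x) + c *\<^sub>R jacobian g (at x)"
proof (rule jacobian_unique)
  have "((\<lambda>z. f z + c *\<^sub>R g z) has_derivative
      (\<lambda>h. jacobian f (at x) *v h + c *\<^sub>R (jacobian g (at x) *v h))) (at x)"
    using assms[unfolded jacobian_works] by (intro derivative_intros)
  then show "((\<lambda>z. f z + c *\<^sub>R g z) has_derivative
      (*v) (jacobian f (at x) + c *\<^sub>R jacobian g (at x))) (at x)"
    by (rule has_derivative_eq_rhs)
       (simp add: fun_eq_iff matrix_vector_mult_add_rdistrib scaleR_matrix_vector_assoc)
qed

text \<open>Differentiability plays no part in the argument: both functions have the same candidates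
  for a derivative, so the choice in \<open>frechet_derivative\<close> returns the same one.\<close>

lemma jacobian_cong_open:
  fixes f g :: "real^'n \<Rightarrow> real^'m"
  assumes "open U" "x \<in> U" "\<And>z. z \<in> U \<Longrightarrow> f z = g z"
  shows "jacobian f (at x) = jacobian g (at x)"
proof -
  have "(f has_derivative D) (at x) \<longleftrightarrow> (g has_derivative D) (at x)" for D
    using has_derivative_transform_within_open[of f D x UNIV U g]
      has_derivative_transform_within_open[of g D x UNIV U f] assms by auto
  then show ?thesis
    by (simp add: jacobian_def frechet_derivative_def)
qed

section \<open>Curved elements\<close>

text \<open>Only interior values are compared, because a broken function is arbitrary on element
  boundaries. On a compact element the extension still provides bounds and one-sided limits.\<close>

definition extends_continuously ::
  "'a::topological_space set \<Rightarrow> ('a \<Rightarrow> 'b::topological_space) \<Rightarrow> bool" where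
  "extends_continuously T u \<longleftrightarrow> (\<exists>\<psi>. continuous_on T \<psi> \<and> (\<forall>z\<in>interior T. u z = \<psi> z))"

lemma extends_continuously_vec:
  fixes u :: "'a::topological_space \<Rightarrow> ('b::topological_space)^'n"
  assumes "\<And>i. extends_continuously T (\<lambda>z. u z $ i)"
  shows "extends_continuously T u"
proof -
  have "\<forall>i. \<exists>\<psi>. continuous_on T \<psi> \<and> (\<forall>z\<in>interior T. u z $ i = \<psi> z)"
    using assms unfolding extends_continuously_def by blast
  from choice[OF this] obtain \<psi>
    where "\<And>i. continuous_on T (\<psi> i)" "\<And>i. \<forall>z\<in>interior T. u z $ i = \<psi> i z"
    by blast
  then show ?thesis
    unfolding extends_continuously_def
    by (intro exI[of _ "\<lambda>z. \<chi> i. \<psi> i z"]) (auto intro: continuous_on_vec_lambda simp: vec_eq_iff)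
qed

text \<open>One element detached from its mesh. Invertibility is required on the closed set
  \<open>K\<close>, so the Jacobian determinant stays away from zero up to the boundary, which is
  what makes the extensions to closed elements possible.\<close>

locale curved_element =
  fixes F :: "real^2 \<Rightarrow> real^2" and K :: "(real^2) set"
  assumes compact_K: "compact K" and convex_K: "convex K" and inj: "inj_on F K"
    and poly: "real_polynomial_function (\<lambda>x. F x $ i)"
    and invertible_jacobian: "x \<in> K \<Longrightarrow> invertible (jacobian F (at x))"
begin

definition G :: "real^2 \<Rightarrow> real^2" where "G = the_inv_into K F"

definition det_F :: "real^2 \<Rightarrow> real" where "det_F x = det (jacobian F (at x))"

text \<open>The adjugate divided by the determinant: in this form the entries visibly lie in
  \<open>rational_functions det_F\<close>.\<close>

definition inv_jacobian :: "real^2 \<Rightarrow> real^2^2" where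
  "inv_jacobian x = inverse (det_F x) *\<^sub>R
     (let J = jacobian F (at x) in vector [vector [J$2$2, - J$1$2], vector [- J$2$1, J$1$1]])"

lemma ex_partials:
  "\<exists>A. (\<forall>i j. real_polynomial_function (A i j)) \<and>
     (\<forall>x. (F has_derivative ((*v) (\<chi> i j. A i j x))) (at x))"
proof -
  have "\<forall>i. \<exists>A. (\<forall>j. real_polynomial_function (A j)) \<and>
      (\<forall>x. ((\<lambda>x. F x $ i) has_derivative (\<lambda>h. \<Sum>j\<in>UNIV. h $ j * A j x)) (at x))"
    using real_polynomial_function_partials[OF poly] by blast
  from choice[OF this] obtain A where A: "\<And>i j. real_polynomial_function (A i j)"
    "\<And>i x. ((\<lambda>x. F x $ i) has_derivative (\<lambda>h. \<Sum>j\<in>UNIV. h $ j * A i j x)) (at x)"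
    by blast
  have "(F has_derivative ((*v) (\<chi> i j. A i j x))) (at x)" for x
    by (rule has_derivative_componentwise_vec)
       (use A(2) in \<open>simp add: matrix_vector_mult_def mult.commute\<close>)
  with A(1) show ?thesis by blast
qed

lemma F_has_derivative: "(F has_derivative ((*v) (jacobian F (at x)))) (at x)"
  using ex_partials jacobian_works differentiable_def by blast

lemma jacobian_poly: "real_polynomial_function (\<lambda>x. jacobian F (at x) $ i $ j)"
proof -
  obtain A where A: "\<And>i j. real_polynomial_function (A i j)"
     "\<And>x. (F has_derivative ((*v) (\<chi> i j. A i j x))) (at x)"
    using ex_partials by blast
  show ?thesis
    using A(1)[of i j] by (simp add: jacobian_unique[OF A(2)])
qed

lemma det_F_poly: "real_polynomial_function det_F"
  unfolding det_F_def[abs_def] det_2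
  by (intro real_polynomial_function_diff real_polynomial_function.intros(4) jacobian_poly)

lemma det_F_nonzero: "x \<in> K \<Longrightarrow> det_F x \<noteq> 0"
  using invertible_jacobian by (simp add: det_F_def invertible_det_nz)

lemma inv_jacobian_rational: "(\<lambda>x. inv_jacobian x $ i $ j) \<in> rational_functions det_F"
proof -
  have "(\<lambda>x. inverse (det_F x) * (jacobian F (at x) $ a $ b)) \<in> rational_functions det_F" for a b
    by (intro rational_functions.mult rational_functions.inverse rational_functions.poly jacobian_poly)
  from this this[THEN rational_functions_minus] show ?thesis
    using exhaust_2[of i] exhaust_2[of j] by (auto simp: inv_jacobian_def Let_def)
qed

lemma inv_jacobian_left: "x \<in> K \<Longrightarrow> inv_jacobian x ** jacobian F (at x) = mat 1"
  using det_F_nonzero[of x]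
  by (simp add: inv_jacobian_def Let_def matrix_matrix_mult_def vec_eq_iff forall_2 sum_2 mat_def
      divide_simps) (simp add: det_F_def det_2 algebra_simps)

lemma inv_jacobian_right: "x \<in> K \<Longrightarrow> jacobian F (at x) ** inv_jacobian x = mat 1"
  using inv_jacobian_left matrix_left_right_inverse by blast

lemma G_F: "\<xi> \<in> K \<Longrightarrow> G (F \<xi>) = \<xi>"
  by (simp add: G_def the_inv_into_f_f inj)

lemma G_F_interior: "\<xi> \<in> interior K \<Longrightarrow> G (F \<xi>) = \<xi>"
  using G_F interior_subset by blast

lemma F_G: "x \<in> F ` K \<Longrightarrow> F (G x) = x"
  using G_F by auto

lemma continuous_on_F: "continuous_on A F"
  by (meson F_has_derivative continuous_at_imp_continuous_on has_derivative_continuous)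

lemma continuous_on_G: "continuous_on (F ` K) G"
  unfolding G_def by (rule continuous_on_inv_into[OF continuous_on_F compact_K inj])

text \<open>Invariance of domain for \<open>F\<close> on the interior of \<open>K\<close> gives one
  inclusion, and for \<open>G\<close> on the interior of the image the other.\<close>

lemma interior_image: "interior (F ` K) = F ` interior K"
proof
  have "inj_on F (interior K)"
    using inj interior_subset by (rule inj_on_subset)
  then have "open (F ` interior K)"
    by (intro invariance_of_domain continuous_on_F open_interior)
  then show "F ` interior K \<subseteq> interior (F ` K)"
    by (intro interior_maximal image_mono interior_subset)
  have F_G': "F (G x) = x" if "x \<in> interior (F ` K)" for x
    using that interior_subset by (blast intro: F_G)
  then have "inj_on G (interior (F ` K))"
    by (rule inj_on_inverseI)
  then have "open (G ` interior (F ` K))"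
    by (intro invariance_of_domain open_interior continuous_on_subset[OF continuous_on_G] interior_subset)
  moreover have "G ` interior (F ` K) \<subseteq> G ` (F ` K)"
    by (intro image_mono interior_subset)
  then have "G ` interior (F ` K) \<subseteq> K"
    by (simp add: image_image G_F cong: image_cong)
  ultimately have "G ` interior (F ` K) \<subseteq> interior K"
    by (rule interior_maximal[rotated])
  then show "interior (F ` K) \<subseteq> F ` interior K"
    using F_G' by (force simp: image_subset_iff)
qed

text \<open>The frontier of a convex set is null, and a differentiable map between spaces of equal
  dimension preserves null sets.\<close>

lemma negligible_boundary: "negligible (F ` K - interior (F ` K))"
proof (rule negligible_subset)
  have "F differentiable_on frontier K"
    by (meson F_has_derivative differentiable_at_imp_differentiable_on differentiable_def)
  then show "negligible (F ` frontier K)"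
    by (intro negligible_differentiable_image_negligible negligible_convex_frontier convex_K) auto
  show "F ` K - interior (F ` K) \<subseteq> F ` frontier K"
    using interior_image closure_subset[of K] by (auto simp: frontier_def)
qed

lemma G_has_derivative:
  assumes "\<xi> \<in> interior K"
  shows "(G has_derivative ((*v) (inv_jacobian \<xi>))) (at (F \<xi>))"
proof (rule has_derivative_inverse[where f = F and f' = "(*v) (jacobian F (at \<xi>))", OF compact_K])
  show "\<xi> \<in> K" using assms interior_subset by blast
  then show "((*v) (inv_jacobian \<xi>)) \<circ> ((*v) (jacobian F (at \<xi>))) = id"
    by (auto simp: fun_eq_iff matrix_vector_mul_assoc inv_jacobian_left)
qed (use assms interior_image G_F F_has_derivative continuous_on_F
      in \<open>auto simp: matrix_vector_mul_bounded_linear\<close>)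

section \<open>Functions that become rational on the reference element\<close>

text \<open>An invariant that survives differentiation: broken polynomials have it with polynomial
  \<open>q\<close>, and each derivative introduces only further factors
  1/\<open>det_F\<close>.\<close>

definition pulled :: "(real^2 \<Rightarrow> real) \<Rightarrow> bool" where
  "pulled u \<longleftrightarrow> (\<exists>q\<in>rational_functions det_F. \<forall>\<xi>\<in>interior K. u (F \<xi>) = q \<xi>)"

lemma pulled_extends: "pulled u \<Longrightarrow> extends_continuously (F ` K) u"
proof -
  assume "pulled u"
  then obtain q where q: "q \<in> rational_functions det_F" "\<And>\<xi>. \<xi> \<in> interior K \<Longrightarrow> u (F \<xi>) = q \<xi>"
    unfolding pulled_def by blast
  have "continuous_on (F ` K) (q \<circ> G)"
    using continuous_on_rational_functions[OF det_F_poly q(1) det_F_nonzero]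
    by (intro continuous_on_compose continuous_on_G) (auto simp: image_image G_F cong: image_cong)
  then show ?thesis
    using q(2) unfolding extends_continuously_def interior_image
    by (intro exI[of _ "q \<circ> G"]) (auto simp: G_F_interior)
qed

lemma pulled_partials:
  assumes "pulled u"
  shows "\<exists>u'. (\<forall>l. pulled (u' l)) \<and>
    (\<forall>z\<in>interior (F ` K). (u has_derivative (\<lambda>h. \<Sum>l\<in>UNIV. h $ l * u' l z)) (at z))"
proof -
  obtain q where q: "q \<in> rational_functions det_F" "\<And>\<xi>. \<xi> \<in> interior K \<Longrightarrow> u (F \<xi>) = q \<xi>"
    using assms unfolding pulled_def by blast
  obtain q' where q': "\<And>j. q' j \<in> rational_functions det_F"
    "\<And>x. det_F x \<noteq> 0 \<Longrightarrow> (q has_derivative (\<lambda>h. \<Sum>j\<in>UNIV. h $ j * q' j x)) (at x)"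
    using rational_functions_partials[OF det_F_poly q(1)] by blast
  \<comment> \<open>Chain rule for u = q \<circ> G: the l-th partial derivative of u, written on the
    reference element, where it is again rational.\<close>
  define r where "r l \<xi> = (\<Sum>j\<in>UNIV. inv_jacobian \<xi> $ j $ l * q' j \<xi>)" for l \<xi>
  have r: "r l \<in> rational_functions det_F" for l
    unfolding r_def[abs_def]
    by (intro rational_functions_sum rational_functions.mult inv_jacobian_rational q')
  have deriv: "(u has_derivative (\<lambda>h. \<Sum>l\<in>UNIV. h $ l * r l (G z))) (at z)"
    if z: "z \<in> interior (F ` K)" for z
  proof -
    obtain \<xi> where \<xi>: "\<xi> \<in> interior K" "z = F \<xi>"
      using z interior_image by auto
    then have [simp]: "G z = \<xi>" "\<xi> \<in> K"
      using G_F interior_subset by auto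
    have "(q has_derivative (\<lambda>h. \<Sum>j\<in>UNIV. h $ j * q' j \<xi>)) (at (G z))"
      using q'(2) det_F_nonzero by simp
    from has_derivative_compose[where f = G, OF _ this]
    have "((\<lambda>x. q (G x)) has_derivative
        (\<lambda>h. \<Sum>j\<in>UNIV. (inv_jacobian \<xi> *v h) $ j * q' j \<xi>)) (at z)"
      using G_has_derivative[OF \<xi>(1)] \<xi>(2) by blast
    moreover have "(\<Sum>j\<in>UNIV. (inv_jacobian \<xi> *v h) $ j * q' j \<xi>) =
        (\<Sum>l\<in>UNIV. h $ l * r l \<xi>)" for h
      by (simp add: r_def matrix_vector_mult_def sum_2 algebra_simps)
    ultimately have "((\<lambda>x. q (G x)) has_derivative (\<lambda>h. \<Sum>l\<in>UNIV. h $ l * r l (G z))) (at z)"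
      by simp
    then show ?thesis
      by (rule has_derivative_transform_within_open[OF _ open_interior z])
         (auto simp: interior_image q(2) G_F_interior)
  qed
  have "pulled (\<lambda>z. r l (G z))" for l
    unfolding pulled_def using r[of l] by (intro bexI[of _ "r l"]) (auto simp: G_F_interior)
  with deriv show ?thesis by (intro exI[of _ "\<lambda>l z. r l (G z)"]) auto
qed

lemma pulled_jacobian:
  fixes y :: "real^2 \<Rightarrow> real^'m"
  assumes "\<And>i. pulled (\<lambda>z. y z $ i)"
  shows "pulled (\<lambda>z. jacobian y (at z) $ i $ j)"
    and "z \<in> interior (F ` K) \<Longrightarrow> y differentiable (at z)"
proof -
  have "\<forall>i. \<exists>u'. (\<forall>l. pulled (u' l)) \<and> (\<forall>z\<in>interior (F ` K).
      ((\<lambda>z. y z $ i) has_derivative (\<lambda>h. \<Sum>l\<in>UNIV. h $ l * u' l z)) (at z))"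
    using assms pulled_partials by blast
  from choice[OF this] obtain u' where u': "\<And>i l. pulled (u' i l)" "\<And>i z. z \<in> interior (F ` K) \<Longrightarrow>
      ((\<lambda>z. y z $ i) has_derivative (\<lambda>h. \<Sum>l\<in>UNIV. h $ l * u' i l z)) (at z)"
    by blast
  have deriv: "(y has_derivative ((*v) (\<chi> i l. u' i l z))) (at z)" if "z \<in> interior (F ` K)" for z
    by (rule has_derivative_componentwise_vec)
       (use u'(2)[OF that] in \<open>simp add: matrix_vector_mult_def mult.commute\<close>)
  then show "z \<in> interior (F ` K) \<Longrightarrow> y differentiable (at z)"
    using differentiable_def by blast
  have "jacobian y (at (F \<xi>)) $ i $ j = u' i j (F \<xi>)" if "\<xi> \<in> interior K" for \<xi>
    using jacobian_unique[OF deriv] that interior_image by simp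
  then show "pulled (\<lambda>z. jacobian y (at z) $ i $ j)"
    using u'(1)[of i j] unfolding pulled_def by (metis (no_types, lifting))
qed

lemma pulled_add: "pulled u \<Longrightarrow> pulled v \<Longrightarrow> pulled (\<lambda>z. u z + v z)"
  unfolding pulled_def by (metis (no_types, lifting) rational_functions.add)

end

section \<open>Broken polynomial spaces\<close>

lemma ref_elem_eq:
  "ref_elem Square = cbox (vector [0,0]) (vector [1,1])"
  "ref_elem Triangle = cbox (vector [0,0]) (vector [1,1]) \<inter> {x. (vector [1,1] :: real^2) \<bullet> x \<le> 1}"
  by (auto simp: cbox_interval less_eq_vec_def forall_2 inner_vec_def sum_2)

lemma compact_ref_elem: "compact (ref_elem S)"
  by (cases S) (auto simp only: ref_elem_eq compact_cbox closed_halfspace_le intro: compact_Int_closed)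

lemma convex_ref_elem: "convex (ref_elem S)"
  by (cases S) (auto simp only: ref_elem_eq convex_box convex_halfspace_le intro: convex_Int)

lemma ref_poly_polynomial: "p \<in> ref_poly S k \<Longrightarrow> real_polynomial_function p"
proof -
  have mono: "real_polynomial_function (\<lambda>x::real^2. c * (x $ 1) ^ i * (x $ 2) ^ j)" for c i j
    by (intro real_polynomial_function.intros(2,4) real_polynomial_function_power
        real_polynomial_function_component)
  assume "p \<in> ref_poly S k"
  \<comment> \<open>The bound \<open>m i\<close> on the second exponent treats both shapes at once:
    \<open>k - i\<close> for the triangle and \<open>k\<close> for the square.\<close>
  moreover have "real_polynomial_function p"
    if "\<forall>x. p x = (\<Sum>i\<le>k. \<Sum>j\<le>m i. c i j * (x $ 1) ^ i * (x $ 2) ^ j)" for c and m :: "nat \<Rightarrow> nat"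
  proof -
    have "p = (\<lambda>x. \<Sum>i\<le>k. \<Sum>j\<le>m i. c i j * (x $ 1) ^ i * (x $ 2) ^ j)"
      using that by (intro ext) (rule spec)
    then show ?thesis
      by (simp only:) (intro real_polynomial_function_sum mono finite_atMost)
  qed
  from this[of _ "\<lambda>i. k - i"] this[of _ "\<lambda>_. k"] calculation show ?thesis
    by (cases S) auto
qed

lemma mesh_of_element:
  assumes "mesh_of S k \<Omega> \<Gamma> M" "T \<in> elems M"
  shows "emap M T ` ref_elem S = T" "inj_on (emap M T) (ref_elem S)"
    "(\<lambda>x. emap M T x $ i) \<in> ref_poly S k"
  using assms unfolding mesh_of_def by simp_all

lemma mesh_curved_element:
  assumes "mesh_of S k \<Omega> \<Gamma> M" "shape_regular S C M" "T \<in> elems M"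
  shows "curved_element (emap M T) (ref_elem S)"
proof
  fix x i
  show "compact (ref_elem S)" "convex (ref_elem S)" "inj_on (emap M T) (ref_elem S)"
    "real_polynomial_function (\<lambda>x. emap M T x $ i)"
    using compact_ref_elem convex_ref_elem mesh_of_element(2)[OF assms(1,3)]
      ref_poly_polynomial[OF mesh_of_element(3)[OF assms(1,3)]] by auto
  show "x \<in> ref_elem S \<Longrightarrow> invertible (jacobian (emap M T) (at x))"
    using assms(2,3) by (simp add: shape_regular_def)
qed

section \<open>A fixed mesh and its domain\<close>

locale regular_mesh =
  fixes S :: ref_shape and k :: nat and \<Omega> \<Gamma> :: "(real^2) set" and M :: mesh and C :: real
  assumes domain: "bounded_lipschitz_domain \<Omega>"
    and mesh: "mesh_of S k \<Omega> \<Gamma> M"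
    and regular: "shape_regular S C M"
    and density: "density_equivalent S \<Gamma> C M"
    and boundary_part: "\<Gamma> \<subseteq> frontier \<Omega>"
begin

lemma finite_elems: "finite (elems M)"
  and Union_elems: "\<Union>(elems M) = closure \<Omega>"
  and density_measurable: "density M \<in> borel_measurable borel"
  and density_pos: "density M x > 0"
  using mesh unfolding mesh_of_def by simp_all

lemma interior_disjoint:
  "T \<in> elems M \<Longrightarrow> T' \<in> elems M \<Longrightarrow> T \<noteq> T' \<Longrightarrow> interior T \<inter> interior T' = {}"
  using mesh unfolding mesh_of_def by simp

lemma open_domain: "open \<Omega>" and bounded_domain: "bounded \<Omega>"
  using domain unfolding bounded_lipschitz_domain_def by auto

text \<open>This excludes slits. The strict epigraph description places the domain on one side of
  its boundary: just below a boundary point lies an open set that misses \<Omega>, hence also its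
  closure. The consequence is that element interiors lie in \<Omega> itself, so that integrals over
  elements can be compared with integrals over \<Omega>.\<close>

lemma interior_closure_domain: "interior (closure \<Omega>) = \<Omega>"
proof
  show "\<Omega> \<subseteq> interior (closure \<Omega>)"
    by (intro interior_maximal closure_subset open_domain)
  show "interior (closure \<Omega>) \<subseteq> \<Omega>"
  proof (rule ccontr)
    assume "\<not> interior (closure \<Omega>) \<subseteq> \<Omega>"
    then obtain p where p: "p \<in> interior (closure \<Omega>)" "p \<notin> \<Omega>"
      by blast
    then have "p \<in> frontier \<Omega>"
      using interior_subset[of "closure \<Omega>"] interior_subset[of \<Omega>] by (auto simp: frontier_def)
    then obtain Q \<phi> L r where Q: "orthogonal_transformation (Q :: vec2 \<Rightarrow> vec2)" and r: "r > 0"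
      and \<phi>: "L-lipschitz_on UNIV (\<phi> :: real \<Rightarrow> real)"
      and iff: "\<And>x. x \<in> ball p r \<Longrightarrow> x \<in> \<Omega> \<longleftrightarrow> Q x $ 2 > \<phi> (Q x $ 1)"
      using domain unfolding bounded_lipschitz_domain_def by blast
    have lin: "linear Q"
      using Q by (rule orthogonal_transformation_linear)
    then have cont_Q: "continuous_on UNIV Q"
      by (simp add: linear_continuous_on linear_linear)
    have cont_\<phi>: "continuous_on A \<phi>" for A
      by (rule continuous_on_subset[OF lipschitz_on_continuous_on[OF \<phi>]]) simp
    \<comment> \<open>The part of the ball strictly below the graph.\<close>
    define W where "W = ball p r \<inter> {x. Q x $ 2 < \<phi> (Q x $ 1)}"
    have "open W"
      unfolding W_def
      by (intro open_Int open_ball open_Collect_less continuous_intros cont_Q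
          continuous_on_compose2[OF cont_\<phi>[of UNIV]]) auto
    moreover have "W \<inter> \<Omega> = {}"
      using iff by (fastforce simp: W_def)
    ultimately have "W \<inter> closure \<Omega> = {}"
      using open_Int_closure_eq_empty by blast
    obtain v where v: "Q v = axis 2 1"
      using orthogonal_transformation_surj[OF Q] by (metis surjD)
    have "((\<lambda>s. p - s *\<^sub>R v) \<longlongrightarrow> p - 0 *\<^sub>R v) (at_right 0)"
      by (intro tendsto_intros)
    then have "\<forall>\<^sub>F s in at_right 0. p - s *\<^sub>R v \<in> interior (closure \<Omega>) \<inter> ball p r"
      using p r by (intro topological_tendstoD) auto
    then have "\<forall>\<^sub>F s in at_right 0. p - s *\<^sub>R v \<in> interior (closure \<Omega>) \<inter> ball p r \<and> 0 < s"
      using eventually_at_right_less[of 0] by (rule eventually_conj)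
    then obtain s where s: "p - s *\<^sub>R v \<in> interior (closure \<Omega>)" "p - s *\<^sub>R v \<in> ball p r" "s > 0"
      using eventually_happens trivial_limit_at_right_real by blast
    \<comment> \<open>The point p is on or below the graph. Moving along -v lowers only the second
      rotated coordinate, so every small positive s leads strictly below it.\<close>
    have "Q p $ 2 \<le> \<phi> (Q p $ 1)"
      using iff[of p] p r by auto
    then have "p - s *\<^sub>R v \<in> W"
      using s by (simp add: W_def linear_diff[OF lin] linear_scale[OF lin] v axis_def)
    with s \<open>W \<inter> closure \<Omega> = {}\<close> show False
      using interior_subset by blast
  qed
qed

lemma interior_element_subset: "T \<in> elems M \<Longrightarrow> interior T \<subseteq> \<Omega>"
  using Union_elems interior_mono[of T "closure \<Omega>"] interior_closure_domain by auto

lemma element: "T \<in> elems M \<Longrightarrow> curved_element (emap M T) (ref_elem S)"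
  using mesh_curved_element[OF mesh regular] .

lemma image_ref_elem: "T \<in> elems M \<Longrightarrow> emap M T ` ref_elem S = T"
  using mesh_of_element(1)[OF mesh] .

lemma compact_element: "T \<in> elems M \<Longrightarrow> compact T"
  using compact_continuous_image[OF curved_element.continuous_on_F[OF element] compact_ref_elem, of T S]
  by (simp add: image_ref_elem)

lemma negligible_element_boundary: "T \<in> elems M \<Longrightarrow> negligible (T - interior T)"
  using curved_element.negligible_boundary[OF element] by (simp add: image_ref_elem)

lemma Vh3_component_pulled:
  assumes "v \<in> Vh3 S k \<Omega> M" "T \<in> elems M"
  shows "curved_element.pulled (emap M T) (ref_elem S) (\<lambda>z. v z $ i)"
proof -
  interpret curved_element "emap M T" "ref_elem S"
    using assms(2) by (rule element)
  have "(\<lambda>z. v z $ i) \<in> Vh S k \<Omega> M"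
    using assms(1) by (auto simp: Vh3_def)
  then obtain p where "p \<in> ref_poly S k" "\<forall>x\<in>interior (ref_elem S). v (emap M T x) $ i = p x"
    using assms(2) by (auto simp: Vh_def)
  then show ?thesis
    unfolding pulled_def using rational_functions.poly[OF ref_poly_polynomial]
    by (intro bexI[of _ p]) auto
qed

text \<open>Three rounds of closure of \<open>pulled\<close> under partial derivatives reach
  \<open>grad (laplacian v)\<close>, the highest derivative in \<open>a_h\<close>.\<close>

lemma Vh3_regularity:
  assumes "v \<in> Vh3 S k \<Omega> M" "T \<in> elems M"
  shows "extends_continuously T v" "extends_continuously T (grad v)"
    "extends_continuously T (hess v)" "extends_continuously T (laplacian v)"
    "extends_continuously T (grad (laplacian v))"
    and "z \<in> interior T \<Longrightarrow> v differentiable (at z)"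
    and "z \<in> interior T \<Longrightarrow> (\<lambda>z. grad v z $ i) differentiable (at z)"
    and "z \<in> interior T \<Longrightarrow> laplacian v differentiable (at z)"
proof -
  interpret curved_element "emap M T" "ref_elem S"
    using assms(2) by (rule element)
  note T = image_ref_elem[OF assms(2)]
  have v: "pulled (\<lambda>z. v z $ i)" for i
    using assms by (rule Vh3_component_pulled)
  have grad: "pulled (\<lambda>z. grad v z $ i $ j)" for i j
    unfolding grad_def by (rule pulled_jacobian(1)[OF v])
  have hess: "pulled (\<lambda>z. hess v z $ i $ j $ l)" for i j l
    unfolding hess_def using pulled_jacobian(1)[of "\<lambda>z. grad v z $ i", OF grad] by simp
  have lap: "pulled (\<lambda>z. laplacian v z $ i)" for i
    unfolding laplacian_def using pulled_add[OF hess hess] by (simp add: trace_def sum_2)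
  have grad_lap: "pulled (\<lambda>z. grad (laplacian v) z $ i $ j)" for i j
    unfolding grad_def by (rule pulled_jacobian(1)[OF lap])
  show "extends_continuously T v"
    by (intro extends_continuously_vec pulled_extends[unfolded T] v)
  show "extends_continuously T (grad v)"
    by (intro extends_continuously_vec pulled_extends[unfolded T] grad)
  show "extends_continuously T (hess v)"
    by (intro extends_continuously_vec pulled_extends[unfolded T] hess)
  show "extends_continuously T (laplacian v)"
    by (intro extends_continuously_vec pulled_extends[unfolded T] lap)
  show "extends_continuously T (grad (laplacian v))"
    by (intro extends_continuously_vec pulled_extends[unfolded T] grad_lap)
  show "z \<in> interior T \<Longrightarrow> v differentiable (at z)"
    "z \<in> interior T \<Longrightarrow> (\<lambda>z. grad v z $ i) differentiable (at z)"
    "z \<in> interior T \<Longrightarrow> laplacian v differentiable (at z)"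
    using pulled_jacobian(2)[unfolded T, of v, OF v]
      pulled_jacobian(2)[unfolded T, of "\<lambda>z. grad v z $ i", OF grad]
      pulled_jacobian(2)[unfolded T, of "laplacian v", OF lap] by blast+
qed

text \<open>Second and third derivatives differentiate functions that are themselves classical
  derivatives. Linearity is therefore first established on the whole open set
  \<open>interior T\<close> and then differentiated there with
  \<open>jacobian_cong_open\<close>.\<close>

lemma
  assumes vw: "v \<in> Vh3 S k \<Omega> M" "w \<in> Vh3 S k \<Omega> M" and T: "T \<in> elems M" and z: "z \<in> interior T"
  shows grad_add_scaleR: "grad (\<lambda>x. v x + c *\<^sub>R w x) z = grad v z + c *\<^sub>R grad w z"
    and hess_add_scaleR: "hess (\<lambda>x. v x + c *\<^sub>R w x) z = hess v z + c *\<^sub>R hess w z"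
    and grad_laplacian_add_scaleR: "grad (laplacian (\<lambda>x. v x + c *\<^sub>R w x)) z =
      grad (laplacian v) z + c *\<^sub>R grad (laplacian w) z"
proof -
  note reg = Vh3_regularity[OF vw(1) T] Vh3_regularity[OF vw(2) T]
  have grad: "grad (\<lambda>x. v x + c *\<^sub>R w x) z = grad v z + c *\<^sub>R grad w z" if "z \<in> interior T" for z
    unfolding grad_def using reg that by (intro jacobian_add_scaleR) auto
  then show "grad (\<lambda>x. v x + c *\<^sub>R w x) z = grad v z + c *\<^sub>R grad w z"
    using z .
  have hess: "hess (\<lambda>x. v x + c *\<^sub>R w x) z = hess v z + c *\<^sub>R hess w z" if "z \<in> interior T" for z
  proof -
    have "jacobian (\<lambda>z. grad (\<lambda>x. v x + c *\<^sub>R w x) z $ i) (at z) =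
        jacobian (\<lambda>z. grad v z $ i + c *\<^sub>R grad w z $ i) (at z)" for i
      by (rule jacobian_cong_open[OF open_interior that]) (simp add: grad)
    also have "\<dots> i = jacobian (\<lambda>z. grad v z $ i) (at z) + c *\<^sub>R jacobian (\<lambda>z. grad w z $ i) (at z)" for i
      using reg that by (intro jacobian_add_scaleR) auto
    finally show ?thesis
      by (simp add: hess_def vec_eq_iff)
  qed
  then show "hess (\<lambda>x. v x + c *\<^sub>R w x) z = hess v z + c *\<^sub>R hess w z"
    using z .
  have "laplacian (\<lambda>x. v x + c *\<^sub>R w x) z = laplacian v z + c *\<^sub>R laplacian w z"
    if "z \<in> interior T" for z
    using hess[OF that] by (simp add: laplacian_def vec_eq_iff trace_def sum_2 algebra_simps)
  then have "grad (laplacian (\<lambda>x. v x + c *\<^sub>R w x)) z =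
      jacobian (\<lambda>z. laplacian v z + c *\<^sub>R laplacian w z) (at z)"
    unfolding grad_def by (intro jacobian_cong_open[OF open_interior z]) auto
  also have "\<dots> = grad (laplacian v) z + c *\<^sub>R grad (laplacian w) z"
    unfolding grad_def using reg z by (intro jacobian_add_scaleR) auto
  finally show "grad (laplacian (\<lambda>x. v x + c *\<^sub>R w x)) z =
      grad (laplacian v) z + c *\<^sub>R grad (laplacian w) z" .
qed

end

section \<open>Square integrable functions\<close>

text \<open>\<open>L2_space\<close> over an arbitrary measure, so that area and arc length share one
  theory.\<close>

definition square_integrable :: "'a measure \<Rightarrow> ('a \<Rightarrow> 'b::euclidean_space) \<Rightarrow> bool" where
  "square_integrable N u \<longleftrightarrow> u \<in> borel_measurable N \<and> integrable N (\<lambda>x. (norm (u x))\<^sup>2)"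

lemma square_integrable_measurable: "square_integrable N u \<Longrightarrow> u \<in> borel_measurable N"
  by (simp add: square_integrable_def)

text \<open>Stated for any product-like \<open>f\<close>, since it serves both inner products and
  the matrix products in the isometry constraint.\<close>

lemma square_integrable_dominated:
  fixes f :: "'a \<Rightarrow> 'd::{banach,second_countable_topology}"
  assumes u: "square_integrable N u" and v: "square_integrable N v"
    and f: "f \<in> borel_measurable N" and le: "\<And>x. norm (f x) \<le> norm (u x) * norm (v x)"
  shows "integrable N f"
proof (rule Bochner_Integration.integrable_bound[OF _ f])
  show "integrable N (\<lambda>x. (norm (u x))\<^sup>2 + (norm (v x))\<^sup>2)"
    using u v by (auto simp: square_integrable_def)
  show "AE x in N. norm (f x) \<le> norm ((norm (u x))\<^sup>2 + (norm (v x))\<^sup>2)"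
  proof (rule AE_I2)
    fix x
    have "norm (u x) * norm (v x) \<le> (norm (u x))\<^sup>2 + (norm (v x))\<^sup>2"
      using sum_squares_bound[of "norm (u x)" "norm (v x)"]
        mult_nonneg_nonneg[of "norm (u x)" "norm (v x)"] norm_ge_zero[of "u x"] norm_ge_zero[of "v x"]
      by linarith
    then show "norm (f x) \<le> norm ((norm (u x))\<^sup>2 + (norm (v x))\<^sup>2)"
      using le[of x] by simp
  qed
qed

lemma integrable_inner:
  assumes "square_integrable N u" "square_integrable N v"
  shows "integrable N (\<lambda>x. u x \<bullet> v x)"
  by (rule square_integrable_dominated[OF assms])
     (auto intro: Cauchy_Schwarz_ineq2 borel_measurable_inner assms[THEN square_integrable_measurable])

lemma integrable_weighted_inner:
  fixes w :: "'a \<Rightarrow> real"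
  assumes "square_integrable N u" "square_integrable N v"
    and "w \<in> borel_measurable N" "AE x in N. \<bar>w x\<bar> \<le> B"
  shows "integrable N (\<lambda>x. w x * (u x \<bullet> v x))"
proof (rule Bochner_Integration.integrable_bound)
  show "integrable N (\<lambda>x. B * (u x \<bullet> v x))"
    by (intro integrable_mult_right integrable_inner assms)
  show "(\<lambda>x. w x * (u x \<bullet> v x)) \<in> borel_measurable N"
    by (intro borel_measurable_times borel_measurable_inner assms(3)
        assms(1,2)[THEN square_integrable_measurable])
  show "AE x in N. norm (w x * (u x \<bullet> v x)) \<le> norm (B * (u x \<bullet> v x))"
    using assms(4) by eventually_elim (auto simp: abs_mult intro!: mult_right_mono)
qed

lemma square_integrable_add_scaleR:
  assumes u: "square_integrable N u" and v: "square_integrable N v"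
  shows "square_integrable N (\<lambda>x. u x + c *\<^sub>R v x)"
proof -
  have eq: "(norm (u x + c *\<^sub>R v x))\<^sup>2 = u x \<bullet> u x + 2 * c * (u x \<bullet> v x) + c\<^sup>2 * (v x \<bullet> v x)" for x
    by (simp only: power2_norm_eq_inner)
       (simp add: inner_simps inner_commute algebra_simps power2_eq_square)
  show ?thesis
    using square_integrable_measurable[OF u] square_integrable_measurable[OF v]
    unfolding square_integrable_def eq
    by (auto intro!: Bochner_Integration.integrable_add integrable_mult_right integrable_inner u v)
qed

lemma square_integrable_bounded:
  assumes "finite_measure N" "u \<in> borel_measurable N" "AE x in N. norm (u x) \<le> B"
  shows "square_integrable N u"
  unfolding square_integrable_def
proof
  show "integrable N (\<lambda>x. (norm (u x))\<^sup>2)"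
  proof (rule finite_measure.integrable_const_bound[OF assms(1), where B = "B\<^sup>2"])
    show "AE x in N. norm ((norm (u x))\<^sup>2) \<le> B\<^sup>2"
      using assms(3) by eventually_elim (auto intro: power_mono)
  qed (use assms(2) in measurable)
qed fact

text \<open>The source of every expansion below. The two factors may differ, which covers averages
  paired with jumps. Measurability of \<open>U\<close> and \<open>V\<close> is a separate hypothesis
  because equality almost everywhere does not transfer it unless the measure is complete.\<close>

lemma integral_weighted_inner_expand:
  fixes w :: "'a \<Rightarrow> real"
  assumes si: "square_integrable N u" "square_integrable N u'" "square_integrable N v" "square_integrable N v'"
    and meas: "U \<in> borel_measurable N" "V \<in> borel_measurable N"
    and w: "w \<in> borel_measurable N" "AE x in N. \<bar>w x\<bar> \<le> B"
    and U: "AE x in N. U x = u x + c *\<^sub>R u' x" and V: "AE x in N. V x = v x + c *\<^sub>R v' x"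
  shows "(\<integral>x. w x * (U x \<bullet> V x) \<partial>N) = (\<integral>x. w x * (u x \<bullet> v x) \<partial>N) +
     c * ((\<integral>x. w x * (u x \<bullet> v' x) \<partial>N) + (\<integral>x. w x * (u' x \<bullet> v x) \<partial>N)) +
     c\<^sup>2 * (\<integral>x. w x * (u' x \<bullet> v' x) \<partial>N)"
proof -
  have int: "integrable N (\<lambda>x. w x * (u x \<bullet> v x))" "integrable N (\<lambda>x. w x * (u x \<bullet> v' x))"
     "integrable N (\<lambda>x. w x * (u' x \<bullet> v x))" "integrable N (\<lambda>x. w x * (u' x \<bullet> v' x))"
    using integrable_weighted_inner w si by blast+
  have "(\<integral>x. w x * (U x \<bullet> V x) \<partial>N) = (\<integral>x. w x * (u x \<bullet> v x) +
     c * (w x * (u x \<bullet> v' x) + w x * (u' x \<bullet> v x)) + c\<^sup>2 * (w x * (u' x \<bullet> v' x)) \<partial>N)"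
  proof (rule integral_cong_AE)
    show "AE x in N. w x * (U x \<bullet> V x) = w x * (u x \<bullet> v x) +
     c * (w x * (u x \<bullet> v' x) + w x * (u' x \<bullet> v x)) + c\<^sup>2 * (w x * (u' x \<bullet> v' x))"
      using U V
      by eventually_elim (simp add: inner_simps algebra_simps power2_eq_square)
  qed (use meas w si square_integrable_measurable in measurable)
  also have "\<dots> = (\<integral>x. w x * (u x \<bullet> v x) \<partial>N) +
     c * ((\<integral>x. w x * (u x \<bullet> v' x) \<partial>N) + (\<integral>x. w x * (u' x \<bullet> v x) \<partial>N)) +
     c\<^sup>2 * (\<integral>x. w x * (u' x \<bullet> v' x) \<partial>N)"
    using int by simp
  finally show ?thesis .
qed

lemma set_integrable_lebesgue_on:
  fixes f :: "'a::euclidean_space \<Rightarrow> 'b::{banach, second_countable_topology}"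
  assumes "A \<in> sets lebesgue"
  shows "set_integrable lebesgue A f \<longleftrightarrow> integrable (lebesgue_on A) f"
    and "(LINT x:A|lebesgue. f x) = integral\<^sup>L (lebesgue_on A) f"
  using assms
  by (simp_all add: set_integrable_def set_lebesgue_integral_def integrable_restrict_space
      integral_restrict_space)

lemma L2_space_iff:
  "A \<in> sets lebesgue \<Longrightarrow> u \<in> L2_space A \<longleftrightarrow> square_integrable (lebesgue_on A) u"
  by (simp add: L2_space_def square_integrable_def set_integrable_lebesgue_on)

lemma L2_inner_eq: "A \<in> sets lebesgue \<Longrightarrow> L2_inner A u v = (\<integral>x. u x \<bullet> v x \<partial>lebesgue_on A)"
  by (simp add: L2_inner_def set_integrable_lebesgue_on)

section \<open>Square integrability of elementwise continuous functions\<close>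

context regular_mesh
begin

definition broken_continuous :: "(vec2 \<Rightarrow> 'a::topological_space) \<Rightarrow> bool" where
  "broken_continuous u \<longleftrightarrow> (\<forall>T\<in>elems M. extends_continuously T u)"

lemma negligible_skeleton: "negligible (\<Union>T\<in>elems M. T - interior T)"
  by (intro negligible_Union finite_imageI finite_elems) (auto intro: negligible_element_boundary)

lemma AE_interior_element:
  "AE x in lebesgue. \<forall>T\<in>elems M. x \<in> T \<longrightarrow> x \<in> interior T"
  using negligible_skeleton unfolding negligible_iff_null_sets
  by (rule AE_I') auto

text \<open>Up to a null set the function is a finite sum of continuous pieces cut off to element
  interiors. Completeness of Lebesgue measure passes measurability from that sum to
  \<open>u\<close>, and compactness of the elements gives a bound. The set \<open>A\<close> will be
  \<Omega> or a single element.\<close>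

lemma square_integrable_broken:
  fixes u :: "vec2 \<Rightarrow> 'a::euclidean_space"
  assumes u: "broken_continuous u" and A: "A \<in> lmeasurable" "A \<subseteq> closure \<Omega>"
  shows "square_integrable (lebesgue_on A) u"
proof -
  have "\<forall>T\<in>elems M. \<exists>\<psi>. continuous_on T \<psi> \<and> (\<forall>z\<in>interior T. u z = \<psi> z)"
    using u by (simp add: broken_continuous_def extends_continuously_def)
  from bchoice[OF this] obtain \<psi>
    where \<psi>: "\<And>T. T \<in> elems M \<Longrightarrow> continuous_on T (\<psi> T)"
      "\<And>T z. T \<in> elems M \<Longrightarrow> z \<in> interior T \<Longrightarrow> u z = \<psi> T z"
    by blast
  have "\<forall>T\<in>elems M. \<exists>B. \<forall>z\<in>T. norm (\<psi> T z) \<le> B"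
    using compact_imp_bounded[OF compact_continuous_image[OF \<psi>(1) compact_element]]
    by (force simp: bounded_iff)
  from bchoice[OF this] obtain B where B: "\<And>T z. T \<in> elems M \<Longrightarrow> z \<in> T \<Longrightarrow> norm (\<psi> T z) \<le> B T"
    by blast
  \<comment> \<open>Interiors of distinct elements are disjoint, so at most one summand is nonzero
    at any point.\<close>
  define U where "U x = (\<Sum>T\<in>elems M. indicator (interior T) x *\<^sub>R \<psi> T x)" for x
  have U_eq: "U x = u x" if "T \<in> elems M" "x \<in> interior T" for x T
  proof -
    have "U x = (\<Sum>T'\<in>elems M. if T' = T then \<psi> T x else 0)"
      unfolding U_def using that interior_disjoint[OF _ that(1)]
      by (intro sum.cong) (auto simp: indicator_def)
    then show ?thesis
      using that \<psi>(2) finite_elems by simp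
  qed
  have "U \<in> borel_measurable borel"
    unfolding U_def[abs_def]
    by (intro borel_measurable_sum borel_measurable_continuous_on_indicator)
       (auto intro: continuous_on_subset[OF \<psi>(1) interior_subset])
  then have U: "U \<in> borel_measurable lebesgue"
    by (simp add: measurable_completion)
  \<comment> \<open>Cutting off outside the closed domain makes the comparison with \<open>U\<close>
    valid almost everywhere in the whole plane.\<close>
  define V where "V x = indicator (closure \<Omega>) x *\<^sub>R u x" for x
  have U_V: "AE x in lebesgue. U x = V x"
    using AE_interior_element
  proof eventually_elim
    case (elim x)
    show ?case
    proof (cases "x \<in> closure \<Omega>")
      case True
      then obtain T where "T \<in> elems M" "x \<in> T"
        using Union_elems by blast
      then show ?thesis
        using True elim U_eq[of T x] by (simp add: V_def)
    next
      case False
      then have "x \<notin> interior T" if "T \<in> elems M" for T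
        using that Union_elems interior_subset by blast
      then show ?thesis
        using False by (simp add: U_def V_def)
    qed
  qed
  have "V \<in> borel_measurable lebesgue"
    by (rule borel_measurable_AE[OF U U_V])
  then have "u \<in> borel_measurable (lebesgue_on (closure \<Omega>))"
    by (subst borel_measurable_restrict_space_iff) (auto simp: V_def[abs_def])
  then have meas: "u \<in> borel_measurable (lebesgue_on A)"
    using A(2) measurable_restrict_mono by blast
  show ?thesis
  proof (rule square_integrable_bounded[OF finite_measure_lebesgue_on[OF A(1)] meas])
    have "AE x in lebesgue. x \<in> A \<longrightarrow> norm (u x) \<le> (\<Sum>T\<in>elems M. \<bar>B T\<bar>)"
      using AE_interior_element
    proof eventually_elim
      case (elim x)
      show ?case
      proof
        assume "x \<in> A"
        then obtain T where T: "T \<in> elems M" "x \<in> T"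
          using A(2) Union_elems by blast
        then have "norm (u x) \<le> \<bar>B T\<bar>"
          using elim \<psi>(2)[of T x] B[of T x] by fastforce
        also have "\<dots> \<le> (\<Sum>T\<in>elems M. \<bar>B T\<bar>)"
          using T finite_elems by (intro member_le_sum) auto
        finally show "norm (u x) \<le> (\<Sum>T\<in>elems M. \<bar>B T\<bar>)" .
      qed
    qed
    then show "AE x in lebesgue_on A. norm (u x) \<le> (\<Sum>T\<in>elems M. \<bar>B T\<bar>)"
      using A(1) by (subst AE_restrict_space_iff) auto
  qed
qed

end

section \<open>Edges and normals\<close>

lemma ref_side_segment:
  assumes "s \<in> ref_sides S"
  obtains a b where "s = closed_segment a b" "a \<noteq> b"
  using assms by (cases S) (auto simp: vec_eq_iff forall_2)

lemma ref_side_subset: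
  assumes "s \<in> ref_sides S"
  shows "s \<subseteq> ref_elem S"
proof -
  obtain a b where s: "s = closed_segment a b" "a \<in> ref_elem S" "b \<in> ref_elem S"
    using assms by (cases S) auto
  show ?thesis
    unfolding s(1) by (rule closed_segment_subset[OF s(2,3) convex_ref_elem])
qed

lemma interior_ref_elem:
  "0 < x $ 1 \<Longrightarrow> 0 < x $ 2 \<Longrightarrow> x $ 1 + x $ 2 < 1 \<Longrightarrow> x \<in> interior (ref_elem Triangle)"
  "0 < x $ 1 \<Longrightarrow> x $ 1 < 1 \<Longrightarrow> 0 < x $ 2 \<Longrightarrow> x $ 2 < 1 \<Longrightarrow> x \<in> interior (ref_elem Square)"
proof -
  have "{x::real^2. 0 < x $ 1 \<and> 0 < x $ 2 \<and> x $ 1 + x $ 2 < 1} \<subseteq> interior (ref_elem Triangle)"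
    by (intro interior_maximal open_Collect_conj open_Collect_less continuous_intros) auto
  then show "0 < x $ 1 \<Longrightarrow> 0 < x $ 2 \<Longrightarrow> x $ 1 + x $ 2 < 1 \<Longrightarrow> x \<in> interior (ref_elem Triangle)"
    by blast
  have "{x::real^2. 0 < x $ 1 \<and> x $ 1 < 1 \<and> 0 < x $ 2 \<and> x $ 2 < 1} \<subseteq> interior (ref_elem Square)"
    by (intro interior_maximal open_Collect_conj open_Collect_less continuous_intros) auto
  then show "0 < x $ 1 \<Longrightarrow> x $ 1 < 1 \<Longrightarrow> 0 < x $ 2 \<Longrightarrow> x $ 2 < 1 \<Longrightarrow> x \<in> interior (ref_elem Square)"
    by blast
qed

section \<open>Normals of the reference sides\<close>

text \<open>A local form of \<nu> being an outward normal at \<xi>. Only the inner side is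
  described: it serves to certify that a curve enters the interior.\<close>

definition local_half_plane :: "(real^2) set \<Rightarrow> real^2 \<Rightarrow> real^2 \<Rightarrow> bool" where
  "local_half_plane K \<xi> \<nu> \<longleftrightarrow> (\<forall>\<^sub>F \<eta> in nhds \<xi>. (\<eta> - \<xi>) \<bullet> \<nu> < 0 \<longrightarrow> \<eta> \<in> interior K)"

lemma eventually_nhds_component:
  fixes \<xi> :: "real^2"
  shows "0 < \<xi> $ i \<Longrightarrow> \<forall>\<^sub>F \<eta> in nhds \<xi>. 0 < \<eta> $ i"
    and "\<xi> $ i < 1 \<Longrightarrow> \<forall>\<^sub>F \<eta> in nhds \<xi>. \<eta> $ i < 1"
    and "\<xi> $ 1 + \<xi> $ 2 < 1 \<Longrightarrow> \<forall>\<^sub>F \<eta> in nhds \<xi>. \<eta> $ 1 + \<eta> $ 2 < 1"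
  by (rule order_tendstoD[rotated], assumption, intro tendsto_intros filterlim_ident)+

lemma ref_side_normal:
  assumes s: "s \<in> ref_sides S"
  shows "\<exists>\<nu>. \<nu> \<noteq> 0 \<and> (\<forall>a\<in>s. \<forall>b\<in>s. (b - a) \<bullet> \<nu> = 0) \<and>
     (\<forall>\<xi>\<in>s - ref_vertices S. local_half_plane (ref_elem S) \<xi> \<nu>)"
proof -
  have normalI: ?thesis if nz: "\<nu> \<noteq> 0" and seg: "s = closed_segment p q" and orth: "(q - p) \<bullet> \<nu> = 0"
    and vert: "p \<in> ref_vertices S" "q \<in> ref_vertices S"
    and half: "\<And>u. 0 < u \<Longrightarrow> u < 1 \<Longrightarrow> local_half_plane (ref_elem S) ((1 - u) *\<^sub>R p + u *\<^sub>R q) \<nu>"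
    for \<nu> p q
  proof (intro exI[of _ \<nu>] conjI ballI nz)
    have *: "x \<bullet> \<nu> = p \<bullet> \<nu>" if "x \<in> s" for x
    proof -
      obtain u where "x = (1 - u) *\<^sub>R p + u *\<^sub>R q"
        using \<open>x \<in> s\<close> by (auto simp: seg closed_segment_def)
      then have "x \<bullet> \<nu> = (1 - u) * (p \<bullet> \<nu>) + u * (q \<bullet> \<nu>)"
        by (simp only: inner_add_left inner_scaleR_left)
      then show ?thesis
        using orth by (simp add: inner_diff_left algebra_simps)
    qed
    fix a b assume "a \<in> s" "b \<in> s"
    then show "(b - a) \<bullet> \<nu> = 0"
      using *[of a] *[of b] by (simp add: inner_diff_left)
  next
    fix \<xi> assume \<xi>: "\<xi> \<in> s - ref_vertices S"
    then obtain u where u: "0 \<le> u" "u \<le> 1" "\<xi> = (1 - u) *\<^sub>R p + u *\<^sub>R q"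
      by (auto simp: seg closed_segment_def)
    moreover have "u \<noteq> 0" "u \<noteq> 1"
      using \<xi> u(3) vert by auto
    ultimately show "local_half_plane (ref_elem S) \<xi> \<nu>"
      using half[of u] by auto
  qed
  note simps = inner_vec_def sum_2 vec_eq_iff forall_2
  note ev = eventually_nhds_component
  \<comment> \<open>\<open>P1\<close> and \<open>P2\<close> collect the constraints of the reference
    element that are strict at \<xi> and hence persist nearby; the constraint active on the side
    comes from the half plane.\<close>
  have half_plane: "local_half_plane (ref_elem S) \<xi> \<nu>"
    if "P1 \<xi>" "P2 \<xi>" "P1 \<xi> \<Longrightarrow> \<forall>\<^sub>F \<eta> in nhds \<xi>. P1 \<eta>" "P2 \<xi> \<Longrightarrow> \<forall>\<^sub>F \<eta> in nhds \<xi>. P2 \<eta>"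
      "\<And>\<eta>. P1 \<eta> \<Longrightarrow> P2 \<eta> \<Longrightarrow> (\<eta> - \<xi>) \<bullet> \<nu> < 0 \<Longrightarrow> \<eta> \<in> interior (ref_elem S)" for P1 P2 \<xi> \<nu>
    unfolding local_half_plane_def using that(3)[OF that(1)] that(4)[OF that(2)]
    by eventually_elim (use that(5) in blast)
  have strip: "\<forall>\<^sub>F \<eta> in nhds \<xi>. 0 < \<eta> $ i \<and> \<eta> $ i < 1" if "0 < \<xi> $ i \<and> \<xi> $ i < 1" for \<xi> :: "real^2" and i
    using that ev(1,2) by (intro eventually_conj) auto
  show ?thesis
  proof (cases S)
    case Triangle
    then consider "s = closed_segment (vector [0,0]) (vector [1,0])"
      | "s = closed_segment (vector [1,0]) (vector [0,1])"
      | "s = closed_segment (vector [0,1]) (vector [0,0])"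
      using s by auto
    then show ?thesis
    proof cases
      case 1
      show ?thesis
        by (rule normalI[of "vector [0,-1]", OF _ 1])
           (auto simp: Triangle simps simp del: ref_elem.simps intro!: half_plane[unfolded Triangle, OF _ _ ev(1)[of _ 1] ev(3)] interior_ref_elem)
    next
      case 2
      show ?thesis
        by (rule normalI[of "vector [1,1]", OF _ 2])
           (auto simp: Triangle simps simp del: ref_elem.simps intro!: half_plane[unfolded Triangle, OF _ _ ev(1)[of _ 1] ev(1)[of _ 2]] interior_ref_elem)
    next
      case 3
      show ?thesis
        by (rule normalI[of "vector [-1,0]", OF _ 3])
           (auto simp: Triangle simps simp del: ref_elem.simps intro!: half_plane[unfolded Triangle, OF _ _ ev(1)[of _ 2] ev(3)] interior_ref_elem)
    qed
  next
    case Square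
    then consider "s = closed_segment (vector [0,0]) (vector [1,0])"
      | "s = closed_segment (vector [1,0]) (vector [1,1])"
      | "s = closed_segment (vector [1,1]) (vector [0,1])"
      | "s = closed_segment (vector [0,1]) (vector [0,0])"
      using s by auto
    then show ?thesis
    proof cases
      case 1
      show ?thesis
        by (rule normalI[of "vector [0,-1]", OF _ 1])
           (auto simp: Square simps simp del: ref_elem.simps intro!: interior_ref_elem
              half_plane[unfolded Square, OF _ _ strip[of _ 1] ev(2)[of _ 2]])
    next
      case 2
      show ?thesis
        by (rule normalI[of "vector [1,0]", OF _ 2])
           (auto simp: Square simps simp del: ref_elem.simps intro!: interior_ref_elem
              half_plane[unfolded Square, OF _ _ strip[of _ 2] ev(1)[of _ 1]])
    next
      case 3
      show ?thesis
        by (rule normalI[of "vector [0,1]", OF _ 3])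
           (auto simp: Square simps simp del: ref_elem.simps intro!: interior_ref_elem
              half_plane[unfolded Square, OF _ _ strip[of _ 1] ev(1)[of _ 2]])
    next
      case 4
      show ?thesis
        by (rule normalI[of "vector [-1,0]", OF _ 4])
           (auto simp: Square simps simp del: ref_elem.simps intro!: interior_ref_elem
              half_plane[unfolded Square, OF _ _ strip[of _ 2] ev(2)[of _ 1]])
    qed
  qed
qed

text \<open>In the plane, two vectors orthogonal to the same nonzero vector are parallel, because
  their cross product vanishes; the sign of the inner product then selects the orientation.\<close>

lemma parallel_unit_plane:
  fixes m w \<tau> :: "real^2"
  assumes \<tau>: "\<tau> \<noteq> 0" "\<tau> \<bullet> m = 0" "\<tau> \<bullet> w = 0" and m: "norm m = 1" and w: "w \<noteq> 0"
  shows "m \<bullet> w > 0 \<and> m = (1 / norm w) *\<^sub>R w \<or> m \<bullet> w < 0 \<and> m = - ((1 / norm w) *\<^sub>R w)"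
proof -
  have "\<tau>$1 * m$1 + \<tau>$2 * m$2 = 0" "\<tau>$1 * w$1 + \<tau>$2 * w$2 = 0"
    using \<tau> by (simp_all add: inner_vec_def sum_2)
  then have "\<tau>$1 * (m$1 * w$2 - m$2 * w$1) = 0" "\<tau>$2 * (m$1 * w$2 - m$2 * w$1) = 0"
    by algebra+
  then have cross: "m$1 * w$2 = m$2 * w$1"
    using \<tau>(1) by (auto simp: vec_eq_iff forall_2)
  have "(w \<bullet> w) *\<^sub>R m = (m \<bullet> w) *\<^sub>R w"
    using cross by (simp add: vec_eq_iff forall_2 inner_vec_def sum_2) algebra
  then have eq: "(norm w)\<^sup>2 *\<^sub>R m = (m \<bullet> w) *\<^sub>R w"
    by (simp add: power2_norm_eq_inner)
  then have "norm ((norm w)\<^sup>2 *\<^sub>R m) = norm ((m \<bullet> w) *\<^sub>R w)"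
    by simp
  then have "(norm w)\<^sup>2 = \<bar>m \<bullet> w\<bar> * norm w"
    using m by simp
  then have abs: "\<bar>m \<bullet> w\<bar> = norm w"
    using w by (simp add: power2_eq_square)
  have m_eq: "m = ((m \<bullet> w) / (norm w)\<^sup>2) *\<^sub>R w"
    using arg_cong[OF eq, of "\<lambda>x. (1 / (norm w)\<^sup>2) *\<^sub>R x"] w by simp
  show ?thesis
  proof (cases "m \<bullet> w > 0")
    case True
    then have "m \<bullet> w = norm w"
      using abs by simp
    with m_eq True show ?thesis
      by (simp add: power2_eq_square)
  next
    case False
    then have "m \<bullet> w = - norm w"
      using abs by simp
    with m_eq w show ?thesis
      by (simp add: power2_eq_square)
  qed
qed

section \<open>Tangents and transversal rays at the boundary of a curved element\<close>

context curved_element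
begin

text \<open>\<open>G\<close> inverts \<open>F\<close> only on the image of \<open>K\<close>, which
  is no neighbourhood of a boundary point. As \<open>F\<close> is polynomial on the whole plane, the
  inverse function theorem supplies an inverse across the boundary.\<close>

lemma local_inverse:
  assumes \<xi>: "\<xi> \<in> K"
  obtains V g where "open V" "F \<xi> \<in> V" "\<And>y. y \<in> V \<Longrightarrow> F (g y) = y" "g (F \<xi>) = \<xi>"
    "(g has_derivative ((*v) (inv_jacobian \<xi>))) (at (F \<xi>))"
proof -
  define F' where "F' x = Blinfun ((*v) (jacobian F (at x)))" for x
  have F': "blinfun_apply (F' x) = (*v) (jacobian F (at x))" for x
    unfolding F'_def by (rule bounded_linear_Blinfun_apply) (rule matrix_vector_mul_bounded_linear)
  have "continuous_on UNIV F'"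
  proof (rule continuous_on_blinfun_componentwise)
    fix i :: "real^2"
    have "continuous_on UNIV (\<lambda>x. jacobian F (at x) $ a $ b)" for a b
      using continuous_real_polymonial_function[OF jacobian_poly] continuous_at_imp_continuous_on by blast
    then show "continuous_on UNIV (\<lambda>x. blinfun_apply (F' x) i)"
      by (simp add: F' matrix_vector_mult_def)
         (intro continuous_on_vec_lambda continuous_on_sum continuous_on_mult continuous_on_const)
  qed
  define B where "B = Blinfun ((*v) (inv_jacobian \<xi>))"
  have B: "blinfun_apply B = (*v) (inv_jacobian \<xi>)"
    unfolding B_def by (rule bounded_linear_Blinfun_apply) (rule matrix_vector_mul_bounded_linear)
  have "B o\<^sub>L F' \<xi> = id_blinfun"
    by (rule blinfun_eqI) (simp add: B F' matrix_vector_mul_assoc inv_jacobian_left[OF \<xi>])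
  have deriv: "(F has_derivative blinfun_apply (F' x)) (at x)" for x
    unfolding F' by (rule F_has_derivative)
  obtain U V g g' where U: "open U" "U \<subseteq> UNIV" "\<xi> \<in> U" and V: "open V" "F \<xi> \<in> V"
    and homeo: "homeomorphism U V F g"
    and g': "\<And>y. y \<in> V \<Longrightarrow> (g has_derivative (g' y)) (at y)"
    "\<And>y. y \<in> V \<Longrightarrow> g' y = inv (blinfun_apply (F' (g y)))"
    "\<And>y. y \<in> V \<Longrightarrow> bij (blinfun_apply (F' (g y)))"
    by (rule inverse_function_theorem[OF open_UNIV deriv \<open>continuous_on UNIV F'\<close> UNIV_I
          \<open>B o\<^sub>L F' \<xi> = id_blinfun\<close>]) (rule that)
  have g: "g (F \<xi>) = \<xi>" "\<And>y. y \<in> V \<Longrightarrow> F (g y) = y"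
    using U(3) homeo by (auto simp: homeomorphism_def)
  have "inv ((*v) (jacobian F (at \<xi>))) = (*v) (inv_jacobian \<xi>)"
    by (rule inv_unique_comp)
       (auto simp: fun_eq_iff matrix_vector_mul_assoc inv_jacobian_left inv_jacobian_right \<xi>)
  then have "(g has_derivative ((*v) (inv_jacobian \<xi>))) (at (F \<xi>))"
    using g'(1,2)[OF V(2)] g(1) by (simp add: F')
  with that V g show thesis by blast
qed

text \<open>Pulled back by the local inverse, the ray leaves \<xi> with velocity
  \<open>inv_jacobian \<xi> *v m\<close>, which points strictly into the half plane and thus into
  the interior of \<open>K\<close>.\<close>

lemma eventually_interior_image:
  assumes \<xi>: "\<xi> \<in> K" and half: "local_half_plane K \<xi> \<nu>" and m: "(inv_jacobian \<xi> *v m) \<bullet> \<nu> < 0"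
  shows "\<forall>\<^sub>F s in at_right 0. F \<xi> + s *\<^sub>R m \<in> interior (F ` K)"
proof -
  obtain V g where V: "open V" "F \<xi> \<in> V" "\<And>y. y \<in> V \<Longrightarrow> F (g y) = y" and g: "g (F \<xi>) = \<xi>"
    and deriv: "(g has_derivative ((*v) (inv_jacobian \<xi>))) (at (F \<xi>))"
    using local_inverse[OF \<xi>] by blast
  have line: "((\<lambda>s::real. F \<xi> + s *\<^sub>R m) has_derivative (\<lambda>s. s *\<^sub>R m)) (at 0)"
    by (auto intro!: derivative_eq_intros)
  have "((\<lambda>s. g (F \<xi> + s *\<^sub>R m)) has_derivative (\<lambda>s. inv_jacobian \<xi> *v (s *\<^sub>R m))) (at 0)"
    by (rule has_derivative_compose[OF line]) (simp add: deriv)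
  then have "((\<lambda>s. (g (F \<xi> + s *\<^sub>R m) - \<xi>) \<bullet> \<nu>) has_derivative
      (\<lambda>s. (inv_jacobian \<xi> *v (s *\<^sub>R m)) \<bullet> \<nu>)) (at 0)"
    by (auto intro!: derivative_eq_intros)
  moreover have "(\<lambda>s. (inv_jacobian \<xi> *v (s *\<^sub>R m)) \<bullet> \<nu>) = (*) ((inv_jacobian \<xi> *v m) \<bullet> \<nu>)"
    by (simp add: fun_eq_iff scaleR_matrix_vector_assoc[symmetric] matrix_vector_mult_scaleR)
  ultimately have "DERIV (\<lambda>s. (g (F \<xi> + s *\<^sub>R m) - \<xi>) \<bullet> \<nu>) 0 :> (inv_jacobian \<xi> *v m) \<bullet> \<nu>"
    by (simp add: has_field_derivative_def)
  from DERIV_neg_dec_right[OF this m] obtain d where d: "d > 0"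
    "\<And>h. h > 0 \<Longrightarrow> h < d \<Longrightarrow> (g (F \<xi> + h *\<^sub>R m) - \<xi>) \<bullet> \<nu> < 0"
    by (auto simp: g)
  have neg: "\<forall>\<^sub>F s in at_right 0. (g (F \<xi> + s *\<^sub>R m) - \<xi>) \<bullet> \<nu> < 0"
    using d by (auto simp: eventually_at_right_field)
  have lim: "((\<lambda>s. F \<xi> + s *\<^sub>R m) \<longlongrightarrow> F \<xi>) (at_right 0)"
    by (rule tendsto_eq_intros | simp)+
  then have in_V: "\<forall>\<^sub>F s in at_right 0. F \<xi> + s *\<^sub>R m \<in> V"
    using V by (intro topological_tendstoD)
  have "((\<lambda>s. g (F \<xi> + s *\<^sub>R m)) \<longlongrightarrow> g (F \<xi>)) (at_right 0)"
    using has_derivative_continuous[OF deriv] lim by (rule isCont_tendsto_compose)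
  then have "\<forall>\<^sub>F s in at_right 0. (g (F \<xi> + s *\<^sub>R m) - \<xi>) \<bullet> \<nu> < 0 \<longrightarrow>
      g (F \<xi> + s *\<^sub>R m) \<in> interior K"
    using half unfolding local_half_plane_def g by (rule eventually_compose_filterlim[rotated])
  with neg in_V show ?thesis
    by eventually_elim (use V(3) interior_image in force)
qed

text \<open>Orthogonality to the edge is given as a limit along \<open>e\<close>; evaluating it
  along the image of the segment turns it into orthogonality to the tangent vector. The condition
  \<xi> \<noteq> b leaves room to move forward on the segment.\<close>

lemma edge_tangent:
  assumes seg: "closed_segment a b \<subseteq> K" "F ` closed_segment a b \<subseteq> e"
    and \<xi>: "\<xi> \<in> closed_segment a b" "\<xi> \<noteq> b"
    and normal: "((\<lambda>z. ((z - F \<xi>) \<bullet> m) / norm (z - F \<xi>)) \<longlongrightarrow> 0) (at (F \<xi>) within e)"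
  shows "(jacobian F (at \<xi>) *v (b - a)) \<bullet> m = 0"
proof (cases "a = b")
  case False
  obtain u where u: "0 \<le> u" "u < 1" "\<xi> = (1 - u) *\<^sub>R a + u *\<^sub>R b"
    using \<xi> by (force simp: closed_segment_def le_less)
  define c where "c t = F (\<xi> + t *\<^sub>R (b - a))" for t
  define \<tau> where "\<tau> = jacobian F (at \<xi>) *v (b - a)"
  have line: "((\<lambda>t::real. \<xi> + t *\<^sub>R (b - a)) has_derivative (\<lambda>t. t *\<^sub>R (b - a))) (at 0)"
    by (auto intro!: derivative_eq_intros)
  have "(c has_derivative (\<lambda>t. jacobian F (at \<xi>) *v (t *\<^sub>R (b - a)))) (at 0)"
    unfolding c_def by (rule has_derivative_compose[OF line]) (simp add: F_has_derivative)
  then have deriv: "(c has_vector_derivative \<tau>) (at 0)"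
    by (simp add: has_vector_derivative_def \<tau>_def matrix_vector_mult_scaleR)
  have quot: "((\<lambda>t. (c t - F \<xi>) /\<^sub>R t) \<longlongrightarrow> \<tau>) (at_right 0)"
  proof (rule LIM_zero_cancel)
    have "(c has_derivative (\<lambda>t. t *\<^sub>R \<tau>)) (at 0 within {0<..})"
      using deriv unfolding has_vector_derivative_def by (rule has_derivative_at_withinI)
    then have "((\<lambda>t. (1 / norm (t - 0)) *\<^sub>R (c t - (c 0 + (t - 0) *\<^sub>R \<tau>))) \<longlongrightarrow> 0) (at_right 0)"
      unfolding has_derivative_within by blast
    moreover have "\<forall>\<^sub>F t in at_right 0. (1 / norm (t - 0)) *\<^sub>R (c t - (c 0 + (t - 0) *\<^sub>R \<tau>)) =
        (c t - F \<xi>) /\<^sub>R t - \<tau>"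
      using eventually_at_right_less[of 0]
    proof eventually_elim
      case (elim t)
      then have "(1 / norm (t - 0)) *\<^sub>R (c t - (c 0 + (t - 0) *\<^sub>R \<tau>)) =
          inverse t *\<^sub>R ((c t - c 0) - t *\<^sub>R \<tau>)"
        by (simp add: inverse_eq_divide algebra_simps)
      also have "\<dots> = (c t - F \<xi>) /\<^sub>R t - \<tau>"
        using elim by (simp only: scaleR_diff_right scaleR_scaleR) (simp add: c_def)
      finally show ?case .
    qed
    ultimately show "((\<lambda>t. (c t - F \<xi>) /\<^sub>R t - \<tau>) \<longlongrightarrow> 0) (at_right 0)"
      by (rule Lim_transform_eventually)
  qed
  have in_seg: "\<forall>\<^sub>F t in at_right 0. \<xi> + t *\<^sub>R (b - a) \<in> closed_segment a b - {\<xi>}"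
  proof (rule eventually_at_right_field[THEN iffD2], intro exI[of _ "1 - u"] conjI allI impI)
    fix t assume "0 < t" "t < 1 - u"
    then show "\<xi> + t *\<^sub>R (b - a) \<in> closed_segment a b - {\<xi>}"
      using u False unfolding closed_segment_def
      by (auto intro!: exI[of _ "u + t"] simp: algebra_simps)
  qed (use u in auto)
  have "filterlim c (at (F \<xi>) within e) (at_right 0)"
    unfolding filterlim_at
  proof
    show "\<forall>\<^sub>F t in at_right 0. c t \<in> e \<and> c t \<noteq> F \<xi>"
      using in_seg
    proof eventually_elim
      case (elim t)
      then show ?case
        using seg \<xi>(1) inj_onD[OF inj, of "\<xi> + t *\<^sub>R (b - a)" \<xi>] by (auto simp: c_def)
    qed
    have "isCont c 0"
      using deriv by (rule has_vector_derivative_continuous)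
    then show "(c \<longlongrightarrow> F \<xi>) (at_right 0)"
      by (auto simp: isCont_def c_def intro: tendsto_within_subset)
  qed
  then have "((\<lambda>t. ((c t - F \<xi>) \<bullet> m) / norm (c t - F \<xi>)) \<longlongrightarrow> 0) (at_right 0)"
    by (rule filterlim_compose[OF normal])
  \<comment> \<open>Multiplication by the norm of the difference quotient replaces the normalised
    chord by the difference quotient itself.\<close>
  then have "((\<lambda>t. ((c t - F \<xi>) \<bullet> m) / norm (c t - F \<xi>) * norm ((c t - F \<xi>) /\<^sub>R t)) \<longlongrightarrow>
      0 * norm \<tau>) (at_right 0)"
    by (intro tendsto_mult tendsto_norm quot)
  moreover have "\<forall>\<^sub>F t in at_right 0. ((c t - F \<xi>) \<bullet> m) / norm (c t - F \<xi>) * norm ((c t - F \<xi>) /\<^sub>R t)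
      = ((c t - F \<xi>) /\<^sub>R t) \<bullet> m"
    using eventually_at_right_less[of 0]
    by eventually_elim (auto simp: divide_simps)
  ultimately have "((\<lambda>t. ((c t - F \<xi>) /\<^sub>R t) \<bullet> m) \<longlongrightarrow> 0) (at_right 0)"
    by (simp add: tendsto_cong)
  moreover have "((\<lambda>t. ((c t - F \<xi>) /\<^sub>R t) \<bullet> m) \<longlongrightarrow> \<tau> \<bullet> m) (at_right 0)"
    by (intro tendsto_inner quot tendsto_const)
  ultimately show ?thesis
    unfolding \<tau>_def by (intro tendsto_unique[OF trivial_limit_at_right_real])
qed simp

text \<open>Normals are transported by the inverse transpose of the Jacobian; the result is
  orthogonal to the image of the side, in general not of unit length.\<close>

definition conormal :: "real^2 \<Rightarrow> real^2 \<Rightarrow> real^2" where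
  "conormal \<nu> \<xi> = transpose (inv_jacobian \<xi>) *v \<nu>"

lemma conormal_inner: "x \<bullet> conormal \<nu> \<xi> = (inv_jacobian \<xi> *v x) \<bullet> \<nu>"
  by (metis conormal_def dot_lmul_matrix inner_commute transpose_matrix_vector)

lemma conormal_nonzero: "\<xi> \<in> K \<Longrightarrow> \<nu> \<noteq> 0 \<Longrightarrow> conormal \<nu> \<xi> \<noteq> 0"
  using conormal_inner[of "jacobian F (at \<xi>) *v \<nu>" \<nu> \<xi>]
  by (auto simp: matrix_vector_mul_assoc inv_jacobian_left)

lemma continuous_on_conormal: "continuous_on K (conormal \<nu>)"
proof -
  have "continuous_on K (\<lambda>x. inv_jacobian x $ i $ j)" for i j
    using continuous_on_rational_functions[OF det_F_poly inv_jacobian_rational det_F_nonzero] .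
  then show ?thesis
    unfolding conormal_def[abs_def] matrix_vector_mult_def transpose_def
    by simp (intro continuous_on_vec_lambda continuous_on_sum continuous_on_mult continuous_on_const)
qed

text \<open>A unit vector orthogonal to the tangent can only be \<open>w\<close> or
  \<open>- w\<close>. The sign of its product with the conormal tells which of the two opposite rays
  enters the reference element after pull-back.\<close>

lemma normal_dichotomy:
  assumes seg: "closed_segment a b \<subseteq> K" "F ` closed_segment a b \<subseteq> e" "a \<noteq> b"
    and \<nu>: "\<nu> \<noteq> 0" "(b - a) \<bullet> \<nu> = 0"
    and \<xi>: "\<xi> \<in> closed_segment a b" "\<xi> \<noteq> b" and half: "local_half_plane K \<xi> \<nu>"
    and m: "norm m = 1" "((\<lambda>z. ((z - F \<xi>) \<bullet> m) / norm (z - F \<xi>)) \<longlongrightarrow> 0) (at (F \<xi>) within e)"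
  defines "w \<equiv> (1 / norm (conormal \<nu> \<xi>)) *\<^sub>R conormal \<nu> \<xi>"
  shows "m = w \<and> (\<forall>\<^sub>F s in at_right 0. F \<xi> - s *\<^sub>R m \<in> interior (F ` K)) \<or>
     m = - w \<and> (\<forall>\<^sub>F s in at_right 0. F \<xi> + s *\<^sub>R m \<in> interior (F ` K))"
proof -
  have \<xi>K: "\<xi> \<in> K"
    using seg(1) \<xi>(1) by blast
  define \<tau> where "\<tau> = jacobian F (at \<xi>) *v (b - a)"
  have inv_\<tau>: "inv_jacobian \<xi> *v \<tau> = b - a"
    by (simp add: \<tau>_def matrix_vector_mul_assoc inv_jacobian_left \<xi>K)
  have "\<tau> \<noteq> 0"
    using inv_\<tau> \<open>a \<noteq> b\<close> by auto
  moreover have "\<tau> \<bullet> m = 0"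
    unfolding \<tau>_def by (rule edge_tangent[OF seg(1,2) \<xi> m(2)])
  moreover have "\<tau> \<bullet> conormal \<nu> \<xi> = 0"
    by (simp add: conormal_inner inv_\<tau> \<nu>)
  ultimately consider "m \<bullet> conormal \<nu> \<xi> > 0" "m = w" | "m \<bullet> conormal \<nu> \<xi> < 0" "m = - w"
    using parallel_unit_plane[of \<tau> m "conormal \<nu> \<xi>"] m(1) conormal_nonzero[OF \<xi>K \<nu>(1)]
    unfolding w_def by blast
  then show ?thesis
  proof cases
    case 1
    then have "(inv_jacobian \<xi> *v (- m)) \<bullet> \<nu> < 0"
      by (simp flip: conormal_inner)
    from eventually_interior_image[OF \<xi>K half this] 1 show ?thesis
      by simp
  next
    case 2
    then have "(inv_jacobian \<xi> *v m) \<bullet> \<nu> < 0"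
      by (simp flip: conormal_inner)
    from eventually_interior_image[OF \<xi>K half this] 2 show ?thesis
      by simp
  qed
qed

end

section \<open>Arc length and traces\<close>

lemma sets_arclength: "sets arclength = sets borel"
  and space_arclength: "space arclength = UNIV"
  unfolding arclength_def by (auto simp: sets_measure_of_conv space_measure_of_conv
      sets.sigma_sets_eq[of borel, simplified])

lemma hausdorff1_outer_singleton: "hausdorff1_outer {x} = 0"
proof -
  have "(INF U\<in>{U :: nat \<Rightarrow> vec2 set. {x} \<subseteq> (\<Union>i. U i) \<and> (\<forall>i. bounded (U i) \<and> diameter (U i) \<le> \<delta>)}.
      \<Sum>i. ennreal (diameter (U i))) \<le> (\<Sum>i::nat. ennreal (diameter {x}))" if "\<delta> > 0" for \<delta>
    using that by (intro INF_lower2[of "\<lambda>_. {x}"]) auto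
  then show ?thesis
    unfolding hausdorff1_outer_def by (intro antisym SUP_least) auto
qed

text \<open>\<open>measure_of\<close> falls back to the zero measure if the set function is not a
  measure. A point has measure zero in either case, so the proof does not depend on countable
  additivity.\<close>

lemma emeasure_arclength_singleton: "emeasure arclength {x} = 0"
  unfolding arclength_def emeasure_measure_of_conv by (simp add: hausdorff1_outer_singleton)

text \<open>Finite sets are null for arc length; they absorb corners and endpoints, where the normal
  is unconstrained.\<close>

definition almost_continuous :: "'a::topological_space set \<Rightarrow> ('a \<Rightarrow> 'b::topological_space) \<Rightarrow> bool" where
  "almost_continuous e f \<longleftrightarrow>
     (\<exists>\<psi> N. continuous_on e \<psi> \<and> finite N \<and> (\<forall>x\<in>e - N. f x = \<psi> x))"

lemma almost_continuous_combine:
  fixes h :: "'b::topological_space \<Rightarrow> 'c::topological_space \<Rightarrow> 'd::topological_space"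
  assumes "almost_continuous e f" "almost_continuous e g"
    and cont: "\<And>\<phi> \<psi>. continuous_on e \<phi> \<Longrightarrow> continuous_on e \<psi> \<Longrightarrow> continuous_on e (\<lambda>x. h (\<phi> x) (\<psi> x))"
  shows "almost_continuous e (\<lambda>x. h (f x) (g x))"
proof -
  obtain \<phi> N where \<phi>: "continuous_on e \<phi>" "finite N" "\<forall>x\<in>e - N. f x = \<phi> x"
    using assms(1) unfolding almost_continuous_def by blast
  obtain \<psi> N' where \<psi>: "continuous_on e \<psi>" "finite N'" "\<forall>x\<in>e - N'. g x = \<psi> x"
    using assms(2) unfolding almost_continuous_def by blast
  show ?thesis
    unfolding almost_continuous_def using \<phi> \<psi>
    by (intro exI[of _ "\<lambda>x. h (\<phi> x) (\<psi> x)"] exI[of _ "N \<union> N'"]) (auto intro: cont)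
qed

lemma almost_continuous_cong:
  assumes "almost_continuous e f" "finite N" "\<And>x. x \<in> e - N \<Longrightarrow> g x = f x"
  shows "almost_continuous e g"
proof -
  obtain \<phi> N' where \<phi>: "continuous_on e \<phi>" "finite N'" "\<forall>x\<in>e - N'. f x = \<phi> x"
    using assms(1) unfolding almost_continuous_def by blast
  then show ?thesis
    unfolding almost_continuous_def using assms(2,3)
    by (intro exI[of _ \<phi>] exI[of _ "N \<union> N'"]) auto
qed

lemma AE_arclength_finite:
  assumes "e \<in> sets borel" "finite N" "\<And>x. x \<in> e - N \<Longrightarrow> P x"
  shows "AE x in restrict_space arclength e. P x"
proof -
  have N: "N \<in> null_sets arclength"
  proof -
    have "(\<Union>x\<in>N. {x}) \<in> null_sets arclength"
      using assms(2) by (intro null_sets_UN' countable_finite)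
        (auto simp: null_sets_def sets_arclength emeasure_arclength_singleton)
    then show ?thesis by simp
  qed
  have "AE x in arclength. x \<in> e \<longrightarrow> P x"
    by (rule AE_I'[OF N]) (use assms(3) in auto)
  then show ?thesis
    using assms(1) by (subst AE_restrict_space_iff) (auto simp: sets_arclength space_arclength)
qed

lemma square_integrable_almost_continuous:
  fixes f :: "vec2 \<Rightarrow> 'a::euclidean_space"
  assumes e: "compact e" "emeasure arclength e < \<infinity>" and f: "almost_continuous e f"
  shows "square_integrable (restrict_space arclength e) f"
proof -
  obtain \<psi> N where \<psi>: "continuous_on e \<psi>" "finite N" "\<And>x. x \<in> e - N \<Longrightarrow> f x = \<psi> x"
    using f unfolding almost_continuous_def by blast
  have e_borel: "e \<in> sets borel"
    using e(1) by (intro borel_closed compact_imp_closed)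
  have sets_eq: "sets (restrict_space arclength e) = sets (restrict_space borel e)"
    by (intro sets_restrict_space_cong sets_arclength)
  have "\<psi> \<in> borel_measurable (restrict_space borel e)"
    by (rule borel_measurable_continuous_on_restrict[OF \<psi>(1)])
  then have "\<psi> \<in> borel_measurable (restrict_space arclength e)"
    using measurable_cong_sets[OF sets_eq refl] by blast
  then have meas: "f \<in> borel_measurable (restrict_space arclength e)"
  proof (rule measurable_discrete_difference[where X = "N \<inter> e"])
    show "{x} \<in> sets (restrict_space arclength e)" if "x \<in> N \<inter> e" for x
      using that e_borel by (auto simp: sets_eq sets_restrict_space_iff)
  qed (use \<psi>(2,3) e_borel in \<open>auto simp: space_restrict_space space_arclength countable_finite\<close>)
  obtain B where B: "\<And>x. x \<in> e \<Longrightarrow> norm (\<psi> x) \<le> B"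
    using compact_imp_bounded[OF compact_continuous_image[OF \<psi>(1) e(1)]] by (force simp: bounded_iff)
  have fin: "finite_measure (restrict_space arclength e)"
    by (rule finite_measureI)
       (use e e_borel in \<open>auto simp: space_restrict_space space_arclength emeasure_restrict_space sets_arclength\<close>)
  show ?thesis
    by (rule square_integrable_bounded[OF fin meas AE_arclength_finite[OF e_borel \<psi>(2)]])
       (use \<psi>(3) B in force)
qed

section \<open>Orientation and continuity of the edge normals\<close>

context regular_mesh
begin

text \<open>The field \<open>w\<close> is continuous along the whole edge and does not refer to the
  normal chosen by the mesh. What remains open is a sign at each point, to be fixed by the position
  of the elements.\<close>

lemma side_conormal:
  assumes T: "T \<in> elems M" and s: "s \<in> ref_sides S" "closed_segment a b \<subseteq> s" "a \<noteq> b"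
    and e: "e = emap M T ` closed_segment a b"
  shows "\<exists>N w. finite N \<and> continuous_on e w \<and> (\<forall>x\<in>e - N. \<forall>m. norm m = 1 \<longrightarrow>
     ((\<lambda>z. ((z - x) \<bullet> m) / norm (z - x)) \<longlongrightarrow> 0) (at x within e) \<longrightarrow>
     m = w x \<and> (\<forall>\<^sub>F s in at_right 0. x - s *\<^sub>R m \<in> interior T) \<or>
     m = - w x \<and> (\<forall>\<^sub>F s in at_right 0. x + s *\<^sub>R m \<in> interior T))"
proof -
  interpret curved_element "emap M T" "ref_elem S"
    by (rule element[OF T])
  note image = image_ref_elem[OF T]
  obtain \<nu> where \<nu>: "\<nu> \<noteq> 0" "\<And>a b. a \<in> s \<Longrightarrow> b \<in> s \<Longrightarrow> (b - a) \<bullet> \<nu> = 0"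
    "\<And>\<xi>. \<xi> \<in> s - ref_vertices S \<Longrightarrow> local_half_plane (ref_elem S) \<xi> \<nu>"
    using ref_side_normal[OF s(1)] by blast
  have seg: "closed_segment a b \<subseteq> ref_elem S"
    using s ref_side_subset by blast
  define w where "w x = (1 / norm (conormal \<nu> (G x))) *\<^sub>R conormal \<nu> (G x)" for x
  have "e \<subseteq> T"
    using e seg image by blast
  have GT: "G x \<in> ref_elem S" if "x \<in> T" for x
    using that G_F image by force
  have "continuous_on T G"
    using continuous_on_G image by simp
  then have "continuous_on T (\<lambda>x. conormal \<nu> (G x))"
    by (rule continuous_on_compose2[OF continuous_on_conormal]) (use GT in auto)
  then have "continuous_on T w"
    unfolding w_def[abs_def] using conormal_nonzero[OF GT \<nu>(1)]
    by (intro continuous_on_scaleR continuous_on_divide continuous_on_norm continuous_on_const) auto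
  then have "continuous_on e w"
    using \<open>e \<subseteq> T\<close> by (rule continuous_on_subset)
  \<comment> \<open>Images of corners are removed because two constraints are active there, and the
    image of b because the tangent is computed by moving towards b.\<close>
  moreover have "m = w x \<and> (\<forall>\<^sub>F s in at_right 0. x - s *\<^sub>R m \<in> interior T) \<or>
     m = - w x \<and> (\<forall>\<^sub>F s in at_right 0. x + s *\<^sub>R m \<in> interior T)"
    if x: "x \<in> e - emap M T ` (insert b (ref_vertices S))" and m: "norm m = 1"
      "((\<lambda>z. ((z - x) \<bullet> m) / norm (z - x)) \<longlongrightarrow> 0) (at x within e)" for x m
  proof -
    obtain \<xi> where \<xi>: "\<xi> \<in> closed_segment a b" "x = emap M T \<xi>"
      using x e by blast
    have "\<xi> \<noteq> b" "\<xi> \<notin> ref_vertices S"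
      using x \<xi> by auto
    moreover have "G x = \<xi>"
      using \<xi> seg G_F by blast
    ultimately show ?thesis
      using normal_dichotomy[OF seg _ s(3) \<nu>(1) \<nu>(2) \<xi>(1) _ \<nu>(3) m(1), of e] m(2) \<xi> s(2) e
      unfolding image w_def by auto
  qed
  moreover have "finite (ref_vertices S)"
    by (cases S) auto
  ultimately show ?thesis
    by (intro exI[of _ "emap M T ` (insert b (ref_vertices S))"] exI[of _ w]) auto
qed

lemma int_edge_elements:
  assumes "e \<in> int_edges M"
  obtains T T' where "T \<in> elems M" "T' \<in> elems M" "T \<noteq> T'" "e = T \<inter> T'"
    "\<exists>s\<in>ref_sides S. \<exists>a b. a \<noteq> b \<and> closed_segment a b \<subseteq> s \<and> e = emap M T ` closed_segment a b"
    "\<exists>s\<in>ref_sides S. \<exists>a b. a \<noteq> b \<and> closed_segment a b \<subseteq> s \<and> e = emap M T' ` closed_segment a b"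
proof -
  obtain T T' where T: "T \<in> elems M" "T' \<in> elems M" "T \<noteq> T'" "e = T \<inter> T'" "infinite (T \<inter> T')"
    using assms unfolding int_edges_def by blast
  then have "T \<inter> T' \<noteq> {}" "T \<inter> T' \<noteq> {p}" for p
    by (metis finite.emptyI, metis finite.emptyI finite_insert)
  moreover have "T \<inter> T' = {} \<or> (\<exists>p. T \<inter> T' = {p}) \<or>
         (\<exists>s\<in>ref_sides S. \<exists>s'\<in>ref_sides S. \<exists>a b a' b'. a \<noteq> b \<and> a' \<noteq> b' \<and>
            closed_segment a b \<subseteq> s \<and> closed_segment a' b' \<subseteq> s' \<and>
            T \<inter> T' = emap M T ` closed_segment a b \<and>
            T \<inter> T' = emap M T' ` closed_segment a' b')"
    using T(1-3) mesh unfolding mesh_of_def by simp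
  ultimately obtain s s' a b a' b' where "s \<in> ref_sides S" "s' \<in> ref_sides S" "a \<noteq> b" "a' \<noteq> b'"
            "closed_segment a b \<subseteq> s" "closed_segment a' b' \<subseteq> s'"
            "e = emap M T ` closed_segment a b" "e = emap M T' ` closed_segment a' b'"
    unfolding T(4) by blast
  with T that[OF T(1-4)] show thesis by blast
qed

lemma bd_edge_element:
  assumes "e \<in> bd_edges S M \<Gamma>"
  obtains T s a b where "T \<in> elems M" "s \<in> ref_sides S" "a \<noteq> b" "s = closed_segment a b"
    "e = emap M T ` closed_segment a b" "emap M T ` rel_interior s \<subseteq> \<Gamma>"
proof -
  obtain T s where T: "T \<in> elems M" "s \<in> ref_sides S" "e = emap M T ` s" "emap M T ` rel_interior s \<subseteq> \<Gamma>"
    using assms unfolding bd_edges_def by blast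
  obtain a b where "s = closed_segment a b" "a \<noteq> b"
    using T(2) by (rule ref_side_segment)
  with T that show thesis by blast
qed

lemma int_edge_normal:
  "e \<in> int_edges M \<Longrightarrow> \<exists>T\<in>elems M. e \<subseteq> T \<and>
     (\<exists>N. finite N \<and> (\<forall>x\<in>e - N. outward_unit_normal T e x (normal M e x)))"
  using mesh unfolding mesh_of_def by simp

lemma bd_edge_normal:
  "e \<in> bd_edges S M \<Gamma> \<Longrightarrow>
     \<exists>N. finite N \<and> (\<forall>x\<in>e - N. outward_unit_normal (closure \<Omega>) e x (normal M e x))"
  using mesh unfolding mesh_of_def by simp

lemma edge_compact: "e \<in> edges S M \<Gamma> \<Longrightarrow> compact e"
proof -
  assume "e \<in> edges S M \<Gamma>"
  then consider "e \<in> int_edges M" | "e \<in> bd_edges S M \<Gamma>"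
    by (auto simp: edges_def)
  then show "compact e"
  proof cases
    case 1
    then show ?thesis
      using compact_element by (auto simp: int_edges_def intro!: compact_Int)
  next
    case 2
    then obtain T s a b where T: "T \<in> elems M" and e: "e = emap M T ` closed_segment a b"
      by (elim bd_edge_element)
    show ?thesis
      unfolding e using curved_element.continuous_on_F[OF element[OF T]]
      by (intro compact_continuous_image) auto
  qed
qed

text \<open>On an interior edge, the given element \<open>T\<close> lies on the inner side of the normal; any other
  element with this edge must then lie on the outer side, because interiors are disjoint.  This also
  fixes the sign of the normal, which is therefore continuous off a finite set.\<close>

lemma edge_orientation:
  assumes "e \<in> edges S M \<Gamma>"
  shows "\<exists>N w T. finite N \<and> continuous_on e w \<and> T \<in> elems M \<and> e \<subseteq> T \<and>
    (\<forall>x\<in>e - N. normal M e x = w x \<and> (\<forall>\<^sub>F s in at_right 0. x - s *\<^sub>R normal M e x \<in> interior T)) \<and>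
    (e \<in> int_edges M \<longrightarrow> (\<exists>T'\<in>elems M. e \<subseteq> T' \<and>
       (\<forall>x\<in>e - N. \<forall>\<^sub>F s in at_right 0. x + s *\<^sub>R normal M e x \<in> interior T')))"
proof (cases "e \<in> int_edges M")
  case True
  then obtain T N where T: "T \<in> elems M" "e \<subseteq> T" and N: "finite N"
    "\<And>x. x \<in> e - N \<Longrightarrow> outward_unit_normal T e x (normal M e x)"
    using int_edge_normal by blast
  obtain T1 T2 where T12: "T1 \<in> elems M" "T2 \<in> elems M" "T1 \<noteq> T2" "e = T1 \<inter> T2"
    "\<exists>s\<in>ref_sides S. \<exists>a b. a \<noteq> b \<and> closed_segment a b \<subseteq> s \<and> e = emap M T1 ` closed_segment a b"
    "\<exists>s\<in>ref_sides S. \<exists>a b. a \<noteq> b \<and> closed_segment a b \<subseteq> s \<and> e = emap M T2 ` closed_segment a b"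
    by (rule int_edge_elements[OF True])
  \<comment> \<open>The element \<open>T\<close> of the mesh condition merely contains the edge and
    may differ from both \<open>T1\<close> and \<open>T2\<close>; one of these two is certainly
    different from it.\<close>
  obtain T' where T': "T' \<in> elems M" "T' \<noteq> T" "e \<subseteq> T'"
    and side: "\<exists>s\<in>ref_sides S. \<exists>a b. a \<noteq> b \<and> closed_segment a b \<subseteq> s \<and>
      e = emap M T' ` closed_segment a b"
  proof (cases "T1 = T")
    case True
    show thesis
      by (rule that[OF T12(2) _ _ T12(6)]) (use True T12(3,4) in auto)
  next
    case False
    show thesis
      by (rule that[OF T12(1) False _ T12(5)]) (use T12(4) in auto)
  qed
  obtain s a b where s: "s \<in> ref_sides S" "closed_segment a b \<subseteq> s" "a \<noteq> b"
    "e = emap M T' ` closed_segment a b"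
    using side by (elim bexE exE conjE)
  obtain N' w where N': "finite N'" "continuous_on e w"
    and dich: "\<And>x m. x \<in> e - N' \<Longrightarrow> norm m = 1 \<Longrightarrow>
     ((\<lambda>z. ((z - x) \<bullet> m) / norm (z - x)) \<longlongrightarrow> 0) (at x within e) \<Longrightarrow>
     m = w x \<and> (\<forall>\<^sub>F s in at_right 0. x - s *\<^sub>R m \<in> interior T') \<or>
     m = - w x \<and> (\<forall>\<^sub>F s in at_right 0. x + s *\<^sub>R m \<in> interior T')"
    using side_conormal[OF T'(1) s] by blast
  have *: "\<forall>\<^sub>F s in at_right 0. x - s *\<^sub>R normal M e x \<in> interior T"
    "normal M e x = - w x" "\<forall>\<^sub>F s in at_right 0. x + s *\<^sub>R normal M e x \<in> interior T'"
    if x: "x \<in> e - (N \<union> N')" for x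
  proof -
    have out: "norm (normal M e x) = 1"
      "((\<lambda>z. ((z - x) \<bullet> normal M e x) / norm (z - x)) \<longlongrightarrow> 0) (at x within e)"
      "\<forall>\<^sub>F s in at_right 0. x - s *\<^sub>R normal M e x \<in> interior T \<and> x + s *\<^sub>R normal M e x \<notin> T"
      using N(2)[of x] x by (auto simp: outward_unit_normal_def)
    then show minus: "\<forall>\<^sub>F s in at_right 0. x - s *\<^sub>R normal M e x \<in> interior T"
      by (elim eventually_mono) auto
    have "\<not> (\<forall>\<^sub>F s in at_right 0. x - s *\<^sub>R normal M e x \<in> interior T')"
    proof
      assume "\<forall>\<^sub>F s in at_right 0. x - s *\<^sub>R normal M e x \<in> interior T'"
      with minus have "\<forall>\<^sub>F s in at_right (0::real). False"
        by eventually_elim (use interior_disjoint[OF T'(1) T(1) T'(2)] in blast)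
      then show False by simp
    qed
    with dich[OF _ out(1,2)] x show "normal M e x = - w x"
      "\<forall>\<^sub>F s in at_right 0. x + s *\<^sub>R normal M e x \<in> interior T'"
      by blast+
  qed
  show ?thesis
    by (intro exI[of _ "N \<union> N'"] exI[of _ "\<lambda>x. - w x"] exI[of _ T])
       (use * N(1) N' T T'(1,3) in \<open>auto intro!: continuous_on_minus bexI[of _ T']\<close>)
next
  case False
  then have bd: "e \<in> bd_edges S M \<Gamma>"
    using assms by (simp add: edges_def)
  obtain T s a b where T: "T \<in> elems M" and s: "s \<in> ref_sides S" "a \<noteq> b" "s = closed_segment a b"
    "e = emap M T ` closed_segment a b"
    by (rule bd_edge_element[OF bd]) (rule that)
  obtain N where N: "finite N" "\<And>x. x \<in> e - N \<Longrightarrow> outward_unit_normal (closure \<Omega>) e x (normal M e x)"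
    using bd_edge_normal[OF bd] by blast
  obtain N' w where N': "finite N'" "continuous_on e w"
    and dich: "\<And>x m. x \<in> e - N' \<Longrightarrow> norm m = 1 \<Longrightarrow>
     ((\<lambda>z. ((z - x) \<bullet> m) / norm (z - x)) \<longlongrightarrow> 0) (at x within e) \<Longrightarrow>
     m = w x \<and> (\<forall>\<^sub>F s in at_right 0. x - s *\<^sub>R m \<in> interior T) \<or>
     m = - w x \<and> (\<forall>\<^sub>F s in at_right 0. x + s *\<^sub>R m \<in> interior T)"
    using side_conormal[OF T s(1) _ s(2) s(4)] s(3) by blast
  have *: "\<forall>\<^sub>F s in at_right 0. x - s *\<^sub>R normal M e x \<in> interior T" "normal M e x = w x"
    if x: "x \<in> e - (N \<union> N')" for x
  proof -
    have out: "norm (normal M e x) = 1"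
      "((\<lambda>z. ((z - x) \<bullet> normal M e x) / norm (z - x)) \<longlongrightarrow> 0) (at x within e)"
      "\<forall>\<^sub>F s in at_right 0. x - s *\<^sub>R normal M e x \<in> interior (closure \<Omega>) \<and>
         x + s *\<^sub>R normal M e x \<notin> closure \<Omega>"
      using N(2)[of x] x by (auto simp: outward_unit_normal_def)
    \<comment> \<open>The outward ray leaves the closed domain and so cannot run inside an element.
      This fixes the sign on a boundary edge.\<close>
    have "\<not> (\<forall>\<^sub>F s in at_right 0. x + s *\<^sub>R normal M e x \<in> interior T)"
    proof
      assume "\<forall>\<^sub>F s in at_right 0. x + s *\<^sub>R normal M e x \<in> interior T"
      with out(3) have "\<forall>\<^sub>F s in at_right (0::real). False"
        by eventually_elim (use interior_subset[of T] T Union_elems in blast)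
      then show False by simp
    qed
    with dich[OF _ out(1,2)] x show "normal M e x = w x"
      "\<forall>\<^sub>F s in at_right 0. x - s *\<^sub>R normal M e x \<in> interior T"
      by blast+
  qed
  have "e \<subseteq> T"
    using s ref_side_subset[OF s(1)] image_ref_elem[OF T] by blast
  then show ?thesis
    using * N(1) N' T False by (intro exI[of _ "N \<union> N'"] exI[of _ w] exI[of _ T]) auto
qed

end

section \<open>One-sided traces on edges\<close>

context regular_mesh
begin

text \<open>Points from which some required side is not seen through the interior of one element. No
  function enters, so the same finite set serves all traces simultaneously.\<close>

definition exceptional :: "vec2 set \<Rightarrow> vec2 set" where
  "exceptional e = {x \<in> e.
     \<not> (\<exists>T\<in>elems M. x \<in> T \<and> (\<forall>\<^sub>F s in at_right 0. x - s *\<^sub>R normal M e x \<in> interior T)) \<or>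
     (e \<in> int_edges M \<and>
      \<not> (\<exists>T\<in>elems M. x \<in> T \<and> (\<forall>\<^sub>F s in at_right 0. x + s *\<^sub>R normal M e x \<in> interior T)))}"

lemma finite_exceptional:
  assumes "e \<in> edges S M \<Gamma>"
  shows "finite (exceptional e)"
proof -
  obtain N w T where N: "finite N" and T: "T \<in> elems M" "e \<subseteq> T"
    and minus: "\<forall>x\<in>e - N. normal M e x = w x \<and> (\<forall>\<^sub>F s in at_right 0. x - s *\<^sub>R normal M e x \<in> interior T)"
    and plus: "e \<in> int_edges M \<longrightarrow> (\<exists>T'\<in>elems M. e \<subseteq> T' \<and>
       (\<forall>x\<in>e - N. \<forall>\<^sub>F s in at_right 0. x + s *\<^sub>R normal M e x \<in> interior T'))"
    using edge_orientation[OF assms] by (elim exE conjE)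
  have "exceptional e \<subseteq> N"
  proof
    fix x assume x: "x \<in> exceptional e"
    show "x \<in> N"
    proof (rule ccontr)
      assume "x \<notin> N"
      with x have "x \<in> e - N" by (simp add: exceptional_def)
      then have "\<exists>T\<in>elems M. x \<in> T \<and> (\<forall>\<^sub>F s in at_right 0. x - s *\<^sub>R normal M e x \<in> interior T)"
        using minus[THEN bspec, THEN conjunct2] T by (intro bexI[of _ T] conjI) auto
      moreover have "\<exists>T\<in>elems M. x \<in> T \<and> (\<forall>\<^sub>F s in at_right 0. x + s *\<^sub>R normal M e x \<in> interior T)"
        if "e \<in> int_edges M"
        using plus[rule_format, OF that] \<open>x \<in> e - N\<close> by (elim bexE) (auto intro: bexI)
      ultimately show False
        using x unfolding exceptional_def by blast
    qed
  qed
  then show ?thesis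
    using N by (rule finite_subset)
qed

lemma tendsto_broken:
  fixes u :: "vec2 \<Rightarrow> 'a::topological_space"
  assumes u: "extends_continuously T u" and x: "x \<in> T"
    and ev: "\<forall>\<^sub>F s in at_right 0. x + s *\<^sub>R m \<in> interior T"
  shows "\<exists>\<psi>. continuous_on T \<psi> \<and> (\<forall>z\<in>interior T. u z = \<psi> z) \<and>
     ((\<lambda>s::real. u (x + s *\<^sub>R m)) \<longlongrightarrow> \<psi> x) (at_right 0)"
proof -
  obtain \<psi> where \<psi>: "continuous_on T \<psi>" "\<forall>z\<in>interior T. u z = \<psi> z"
    using u unfolding extends_continuously_def by blast
  have "((\<lambda>s. x + s *\<^sub>R m) \<longlongrightarrow> x) (at_right 0)"
    by (rule tendsto_eq_intros | simp)+
  moreover have "\<forall>\<^sub>F s in at_right 0. x + s *\<^sub>R m \<in> T"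
    using ev by eventually_elim (use interior_subset in blast)
  ultimately have "((\<lambda>s. \<psi> (x + s *\<^sub>R m)) \<longlongrightarrow> \<psi> x) (at_right 0)"
    using continuous_on_tendsto_compose[OF \<psi>(1) _ x] by blast
  moreover have "\<forall>\<^sub>F s in at_right 0. \<psi> (x + s *\<^sub>R m) = u (x + s *\<^sub>R m)"
    using ev by eventually_elim (use \<psi>(2) in simp)
  ultimately have "((\<lambda>s. u (x + s *\<^sub>R m)) \<longlongrightarrow> \<psi> x) (at_right 0)"
    by (rule Lim_transform_eventually)
  with \<psi> show ?thesis by blast
qed

lemma exceptional_minus:
  "x \<in> e - exceptional e \<Longrightarrow>
     \<exists>T\<in>elems M. x \<in> T \<and> (\<forall>\<^sub>F s in at_right 0. x + s *\<^sub>R (- normal M e x) \<in> interior T)"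
  by (simp add: exceptional_def)

lemma exceptional_plus:
  "x \<in> e - exceptional e \<Longrightarrow> e \<in> int_edges M \<Longrightarrow>
     \<exists>T\<in>elems M. x \<in> T \<and> (\<forall>\<^sub>F s in at_right 0. x + s *\<^sub>R normal M e x \<in> interior T)"
  by (simp add: exceptional_def)

lemma trace_eq_Lim:
  "trace_minus M e u x = Lim (at_right 0) (\<lambda>s. u (x + s *\<^sub>R (- normal M e x)))"
  "trace_plus M e u x = Lim (at_right 0) (\<lambda>s. u (x + s *\<^sub>R normal M e x))"
  by (simp_all add: trace_minus_def trace_plus_def)

text \<open>\<open>Lim\<close> obeys algebraic rules only where the limits exist; approach through
  the interior of one element guarantees that. The general \<open>h\<close> covers both linear
  combinations and, with its second argument ignored, linear maps.\<close>

lemma Lim_combine: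
  fixes u :: "vec2 \<Rightarrow> 'a::euclidean_space" and v :: "vec2 \<Rightarrow> 'b::euclidean_space"
    and U :: "vec2 \<Rightarrow> 'c::euclidean_space"
  assumes T: "\<exists>T\<in>elems M. x \<in> T \<and> (\<forall>\<^sub>F s in at_right 0. x + s *\<^sub>R m \<in> interior T)"
    and u: "broken_continuous u" and v: "broken_continuous v"
    and U: "\<And>T z. T \<in> elems M \<Longrightarrow> z \<in> interior T \<Longrightarrow> U z = h (u z) (v z)"
    and h: "\<And>f g l l'. (f \<longlongrightarrow> l) (at_right (0::real)) \<Longrightarrow> (g \<longlongrightarrow> l') (at_right 0) \<Longrightarrow>
      ((\<lambda>s. h (f s) (g s)) \<longlongrightarrow> h l l') (at_right 0)"
  shows "Lim (at_right 0) (\<lambda>s. U (x + s *\<^sub>R m)) =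
     h (Lim (at_right 0) (\<lambda>s. u (x + s *\<^sub>R m))) (Lim (at_right 0) (\<lambda>s. v (x + s *\<^sub>R m)))"
proof -
  obtain T where T: "T \<in> elems M" "x \<in> T" "\<forall>\<^sub>F s in at_right 0. x + s *\<^sub>R m \<in> interior T"
    using T by blast
  obtain l where l: "((\<lambda>s. u (x + s *\<^sub>R m)) \<longlongrightarrow> l) (at_right 0)"
    using tendsto_broken[OF _ T(2,3)] u T(1) unfolding broken_continuous_def by blast
  obtain l' where l': "((\<lambda>s. v (x + s *\<^sub>R m)) \<longlongrightarrow> l') (at_right 0)"
    using tendsto_broken[OF _ T(2,3)] v T(1) unfolding broken_continuous_def by blast
  have "\<forall>\<^sub>F s in at_right 0. h (u (x + s *\<^sub>R m)) (v (x + s *\<^sub>R m)) = U (x + s *\<^sub>R m)"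
    using T(3) by eventually_elim (use U[OF T(1)] in simp)
  with h[OF l l'] have "((\<lambda>s. U (x + s *\<^sub>R m)) \<longlongrightarrow> h l l') (at_right 0)"
    by (rule Lim_transform_eventually)
  then show ?thesis
    using tendsto_Lim[OF trivial_limit_at_right_real] l l' by metis
qed

lemma trace_minus_combine:
  fixes u :: "vec2 \<Rightarrow> 'a::euclidean_space" and v :: "vec2 \<Rightarrow> 'b::euclidean_space"
    and U :: "vec2 \<Rightarrow> 'c::euclidean_space"
  assumes "x \<in> e - exceptional e" "broken_continuous u" "broken_continuous v"
    and "\<And>T z. T \<in> elems M \<Longrightarrow> z \<in> interior T \<Longrightarrow> U z = h (u z) (v z)"
    and "\<And>f g l l'. (f \<longlongrightarrow> l) (at_right (0::real)) \<Longrightarrow> (g \<longlongrightarrow> l') (at_right 0) \<Longrightarrow>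
      ((\<lambda>s. h (f s) (g s)) \<longlongrightarrow> h l l') (at_right 0)"
  shows "trace_minus M e U x = h (trace_minus M e u x) (trace_minus M e v x)"
  unfolding trace_eq_Lim using assms by (intro Lim_combine exceptional_minus)

lemma trace_plus_combine:
  fixes u :: "vec2 \<Rightarrow> 'a::euclidean_space" and v :: "vec2 \<Rightarrow> 'b::euclidean_space"
    and U :: "vec2 \<Rightarrow> 'c::euclidean_space"
  assumes "x \<in> e - exceptional e" "e \<in> int_edges M" "broken_continuous u" "broken_continuous v"
    and "\<And>T z. T \<in> elems M \<Longrightarrow> z \<in> interior T \<Longrightarrow> U z = h (u z) (v z)"
    and "\<And>f g l l'. (f \<longlongrightarrow> l) (at_right (0::real)) \<Longrightarrow> (g \<longlongrightarrow> l') (at_right 0) \<Longrightarrow>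
      ((\<lambda>s. h (f s) (g s)) \<longlongrightarrow> h l l') (at_right 0)"
  shows "trace_plus M e U x = h (trace_plus M e u x) (trace_plus M e v x)"
  unfolding trace_eq_Lim using assms by (intro Lim_combine exceptional_plus)

lemma
  fixes u v U :: "vec2 \<Rightarrow> 'a::euclidean_space"
  assumes x: "x \<in> e - exceptional e" and u: "broken_continuous u" and v: "broken_continuous v"
    and U: "\<And>T z. T \<in> elems M \<Longrightarrow> z \<in> interior T \<Longrightarrow> U z = u z + c *\<^sub>R v z"
  shows jump_add_scaleR: "jump M b U e x = jump M b u e x + c *\<^sub>R jump M (\<lambda>_. 0) v e x"
    and average_add_scaleR: "average M U e x = average M u e x + c *\<^sub>R average M v e x"
proof -
  have lim: "((\<lambda>s. f s + c *\<^sub>R g s) \<longlongrightarrow> l + c *\<^sub>R l') (at_right (0::real))"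
    if "(f \<longlongrightarrow> l) (at_right 0)" "(g \<longlongrightarrow> l') (at_right 0)" for f g and l l' :: 'a
    using that by (intro tendsto_intros)
  have minus: "trace_minus M e U x = trace_minus M e u x + c *\<^sub>R trace_minus M e v x"
    by (rule trace_minus_combine[where h = "\<lambda>a b. a + c *\<^sub>R b", OF x u v U lim])
  have plus: "trace_plus M e U x = trace_plus M e u x + c *\<^sub>R trace_plus M e v x"
    if "e \<in> int_edges M"
    by (rule trace_plus_combine[where h = "\<lambda>a b. a + c *\<^sub>R b", OF x that u v U lim])
  show "jump M b U e x = jump M b u e x + c *\<^sub>R jump M (\<lambda>_. 0) v e x"
    using minus plus by (simp add: jump_def algebra_simps)
  show "average M U e x = average M u e x + c *\<^sub>R average M v e x"
    using minus plus by (simp add: average_def algebra_simps)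
qed

lemma average_linear:
  fixes u :: "vec2 \<Rightarrow> 'a::euclidean_space" and f :: "'a \<Rightarrow> 'c::euclidean_space"
  assumes x: "x \<in> e - exceptional e" and u: "broken_continuous u" and f: "linear f"
  shows "average M (\<lambda>z. f (u z)) e x = f (average M u e x)"
proof -
  have lim: "((\<lambda>s. f (g s)) \<longlongrightarrow> f l) (at_right (0::real))"
    if "(g \<longlongrightarrow> l) (at_right 0)" for g l
    using f that by (simp add: bounded_linear.tendsto linear_conv_bounded_linear)
  have "trace_minus M e (\<lambda>z. f (u z)) x = f (trace_minus M e u x)"
    using trace_minus_combine[OF x u u, of "\<lambda>z. f (u z)" "\<lambda>a _. f a"] lim by blast
  moreover have "trace_plus M e (\<lambda>z. f (u z)) x = f (trace_plus M e u x)" if "e \<in> int_edges M"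
    using trace_plus_combine[OF x that u u, of "\<lambda>z. f (u z)" "\<lambda>a _. f a"] lim by blast
  ultimately show ?thesis
    by (simp add: average_def linear_add[OF f] linear_scale[OF f])
qed

text \<open>Off a finite set the same element lies on a given side all along the edge, so the trace
  there is the restriction of one continuous extension.\<close>

lemma
  fixes u :: "vec2 \<Rightarrow> 'a::euclidean_space"
  assumes e: "e \<in> edges S M \<Gamma>" and u: "broken_continuous u"
  shows almost_continuous_trace_minus: "almost_continuous e (trace_minus M e u)"
    and almost_continuous_trace_plus: "e \<in> int_edges M \<Longrightarrow> almost_continuous e (trace_plus M e u)"
    and almost_continuous_normal: "almost_continuous e (normal M e)"
proof -
  obtain N w T where N: "finite N" and w: "continuous_on e w" and T: "T \<in> elems M" "e \<subseteq> T"
    and minus: "\<forall>x\<in>e - N. normal M e x = w x \<and> (\<forall>\<^sub>F s in at_right 0. x - s *\<^sub>R normal M e x \<in> interior T)"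
    and plus: "e \<in> int_edges M \<longrightarrow> (\<exists>T'\<in>elems M. e \<subseteq> T' \<and>
       (\<forall>x\<in>e - N. \<forall>\<^sub>F s in at_right 0. x + s *\<^sub>R normal M e x \<in> interior T'))"
    using edge_orientation[OF e] by (elim exE conjE)
  have ac: "almost_continuous e (\<lambda>x. Lim (at_right 0) (\<lambda>s. u (x + s *\<^sub>R m x)))"
    if T: "T \<in> elems M" "e \<subseteq> T" and ev: "\<And>x. x \<in> e - N \<Longrightarrow> \<forall>\<^sub>F s in at_right 0. x + s *\<^sub>R m x \<in> interior T"
    for T m
  proof -
    obtain \<psi> where \<psi>: "continuous_on T \<psi>" "\<And>z. z \<in> interior T \<Longrightarrow> u z = \<psi> z"
      using u T(1) unfolding broken_continuous_def extends_continuously_def by blast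
    have "Lim (at_right 0) (\<lambda>s. u (x + s *\<^sub>R m x)) = \<psi> x" if x: "x \<in> e - N" for x
    proof -
      have lim: "((\<lambda>s. x + s *\<^sub>R m x) \<longlongrightarrow> x) (at_right 0)"
        by (rule tendsto_eq_intros | simp)+
      have "\<forall>\<^sub>F s in at_right 0. x + s *\<^sub>R m x \<in> T"
        using ev[OF x] by eventually_elim (use interior_subset in blast)
      with lim have "((\<lambda>s. \<psi> (x + s *\<^sub>R m x)) \<longlongrightarrow> \<psi> x) (at_right 0)"
        using continuous_on_tendsto_compose[OF \<psi>(1)] x T(2) by blast
      moreover have "\<forall>\<^sub>F s in at_right 0. \<psi> (x + s *\<^sub>R m x) = u (x + s *\<^sub>R m x)"
        using ev[OF x] by eventually_elim (use \<psi>(2) in simp)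
      ultimately have "((\<lambda>s. u (x + s *\<^sub>R m x)) \<longlongrightarrow> \<psi> x) (at_right 0)"
        by (rule Lim_transform_eventually)
      then show ?thesis
        by (intro tendsto_Lim trivial_limit_at_right_real)
    qed
    moreover have "continuous_on e \<psi>"
      using \<psi>(1) T(2) by (rule continuous_on_subset)
    ultimately show ?thesis
      unfolding almost_continuous_def using N by blast
  qed
  show "almost_continuous e (trace_minus M e u)"
    unfolding trace_eq_Lim[abs_def] by (rule ac[OF T]) (use minus[THEN bspec, THEN conjunct2] in simp)
  show "almost_continuous e (trace_plus M e u)" if "e \<in> int_edges M"
    unfolding trace_eq_Lim[abs_def] using plus that ac by blast
  show "almost_continuous e (normal M e)"
    unfolding almost_continuous_def using N w minus by blast
qed

lemma almost_continuous_average: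
  fixes u :: "vec2 \<Rightarrow> 'a::euclidean_space"
  assumes e: "e \<in> edges S M \<Gamma>" and u: "broken_continuous u"
  shows "almost_continuous e (average M u e)"
proof (cases "e \<in> int_edges M")
  case True
  have "almost_continuous e (\<lambda>x. (1/2) *\<^sub>R (trace_plus M e u x + trace_minus M e u x))"
    by (rule almost_continuous_combine[where h = "\<lambda>a b. (1/2) *\<^sub>R (a + b)"])
       (use True e u almost_continuous_trace_minus almost_continuous_trace_plus
         in \<open>auto intro!: continuous_intros\<close>)
  then show ?thesis
    using True by (simp add: average_def[abs_def])
qed (use almost_continuous_trace_minus[OF e u] in \<open>simp add: average_def[abs_def]\<close>)

text \<open>Since \<^const>\<open>measure\<close> is \<open>0\<close> on sets of infinite measure, the positive lower bound on the length
  of an edge already forces the length to be finite.\<close>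

lemma edge_finite_length:
  assumes "e \<in> edges S M \<Gamma>"
  shows "emeasure arclength e < \<infinity>"
proof (cases "e = {}")
  case False
  then obtain x where x: "x \<in> e" by blast
  then have "density M x \<le> C * measure arclength e"
    using density assms by (simp add: density_equivalent_def)
  then have "measure arclength e \<noteq> 0"
    using density_pos[of x] by auto
  then show ?thesis
    by (auto simp: measure_def less_top[symmetric])
qed simp

text \<open>The bound C / |e| may depend on the edge, as it is used only for integrability on a
  fixed mesh.\<close>

lemma edge_density_bound:
  assumes "e \<in> edges S M \<Gamma>"
  shows "\<exists>B. \<forall>x\<in>e. inverse (density M x) \<le> B"
proof (intro exI ballI)
  fix x assume x: "x \<in> e"
  have le: "density M x \<le> C * measure arclength e" "measure arclength e \<le> C * density M x"
    using density assms x by (auto simp: density_equivalent_def)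
  then have "0 < C * measure arclength e"
    using density_pos[of x] by linarith
  \<comment> \<open>The sign of \<open>C\<close> is not given, but a positive product with a
    nonnegative length forces the length to be positive.\<close>
  then have "measure arclength e > 0"
    by (metis measure_nonneg mult_zero_right order_less_irrefl order_le_less)
  with le(2) density_pos[of x] show "inverse (density M x) \<le> C / measure arclength e"
    by (simp add: field_simps)
qed

end

section \<open>Integrals over the skeleton\<close>

context regular_mesh
begin

text \<open>The integrability content of \<open>is_trace\<close>; the zero field has it as well,
  which covers \<open>zero_bd\<close>.\<close>

definition boundary_field :: "(vec2 \<Rightarrow> 'a::euclidean_space) \<Rightarrow> bool" where
  "boundary_field t \<longleftrightarrow> t \<in> borel_measurable (restrict_space borel (frontier \<Omega>)) \<and>
     (\<integral>\<^sup>+x\<in>frontier \<Omega>. ennreal ((norm (t x))\<^sup>2) \<partial>arclength) < \<infinity>"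

lemma boundary_field_zero: "boundary_field (\<lambda>_. 0)"
  by (simp add: boundary_field_def)

text \<open>\<open>\<Gamma>\<close> contains the arc without its endpoints; continuity and
  closedness of the frontier add them.\<close>

lemma bd_edge_subset_frontier:
  assumes "e \<in> bd_edges S M \<Gamma>"
  shows "e \<subseteq> frontier \<Omega>"
proof -
  obtain T s a b where T: "T \<in> elems M" and s: "a \<noteq> b" "s = closed_segment a b"
    "e = emap M T ` closed_segment a b" "emap M T ` rel_interior s \<subseteq> \<Gamma>"
    by (rule bd_edge_element[OF assms]) (rule that)
  have "closed_segment a b = closure (rel_interior s)"
    using s(2) by (simp add: convex_closure_rel_interior)
  moreover have "emap M T ` closure (rel_interior s) \<subseteq> frontier \<Omega>"
    by (rule image_closure_subset[OF curved_element.continuous_on_F[OF element[OF T]]])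
       (use s(4) boundary_part in auto)
  ultimately show ?thesis
    using s(3) by simp
qed

lemma edge_borel: "e \<in> edges S M \<Gamma> \<Longrightarrow> e \<in> sets borel"
  by (intro borel_closed compact_imp_closed edge_compact)

lemma edge_measurable_iff:
  "(f \<in> borel_measurable (restrict_space arclength e)) \<longleftrightarrow> f \<in> borel_measurable (restrict_space borel e)"
  by (intro arg_cong[where f = "\<lambda>A. f \<in> A"] measurable_cong_sets sets_restrict_space_cong sets_arclength refl)

lemma square_integrable_boundary_field:
  fixes t :: "vec2 \<Rightarrow> 'a::euclidean_space"
  assumes t: "boundary_field t" and e: "e \<in> edges S M \<Gamma>" "e \<notin> int_edges M"
  shows "square_integrable (restrict_space arclength e) t"
proof -
  have sub: "e \<subseteq> frontier \<Omega>"
    using bd_edge_subset_frontier e by (auto simp: edges_def)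
  have meas: "t \<in> borel_measurable (restrict_space arclength e)"
    using t sub unfolding edge_measurable_iff boundary_field_def
    by (auto intro: measurable_restrict_mono)
  have "(\<integral>\<^sup>+x. ennreal ((norm (t x))\<^sup>2) \<partial>restrict_space arclength e) =
      (\<integral>\<^sup>+x\<in>e. ennreal ((norm (t x))\<^sup>2) \<partial>arclength)"
    using edge_borel[OF e(1)] by (intro nn_integral_restrict_space) (simp add: sets_arclength space_arclength)
  also have "\<dots> \<le> (\<integral>\<^sup>+x\<in>frontier \<Omega>. ennreal ((norm (t x))\<^sup>2) \<partial>arclength)"
    using sub by (intro nn_integral_mono) (auto simp: indicator_def)
  also have "\<dots> < \<infinity>"
    using t by (simp add: boundary_field_def)
  finally have "integrable (restrict_space arclength e) (\<lambda>x. (norm (t x))\<^sup>2)"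
    using meas by (auto simp: integrable_iff_bounded)
  with meas show ?thesis
    by (simp add: square_integrable_def)
qed

lemma square_integrable_ac:
  fixes f :: "vec2 \<Rightarrow> 'a::euclidean_space"
  shows "e \<in> edges S M \<Gamma> \<Longrightarrow> almost_continuous e f \<Longrightarrow> square_integrable (restrict_space arclength e) f"
  by (intro square_integrable_almost_continuous edge_compact edge_finite_length)

definition skeleton_field :: "(vec2 set \<Rightarrow> vec2 \<Rightarrow> 'a::euclidean_space) \<Rightarrow> bool" where
  "skeleton_field f \<longleftrightarrow> (\<forall>e\<in>edges S M \<Gamma>. square_integrable (restrict_space arclength e) (f e))"

lemma skeleton_field_jump:
  fixes u :: "vec2 \<Rightarrow> 'a::euclidean_space"
  assumes u: "broken_continuous u" and b: "boundary_field b"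
  shows "skeleton_field (jump M b u)"
  unfolding skeleton_field_def
proof
  fix e assume e: "e \<in> edges S M \<Gamma>"
  have minus: "square_integrable (restrict_space arclength e) (trace_minus M e u)"
    by (rule square_integrable_ac[OF e almost_continuous_trace_minus[OF e u]])
  show "square_integrable (restrict_space arclength e) (jump M b u e)"
  proof (cases "e \<in> int_edges M")
    case True
    have "square_integrable (restrict_space arclength e) (trace_plus M e u)"
      by (rule square_integrable_ac[OF e almost_continuous_trace_plus[OF e u True]])
    from square_integrable_add_scaleR[OF minus this, of "-1"] True show ?thesis
      by (simp add: jump_def[abs_def])
  next
    case False
    from square_integrable_add_scaleR[OF minus square_integrable_boundary_field[OF b e False], of "-1"] False
    show ?thesis
      by (simp add: jump_def[abs_def])
  qed
qed

lemma skeleton_integral_expand: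
  fixes u u' U :: "vec2 set \<Rightarrow> vec2 \<Rightarrow> 'a::euclidean_space"
  assumes fields: "skeleton_field u" "skeleton_field u'" "skeleton_field v" "skeleton_field v'"
    "skeleton_field U" "skeleton_field V"
    and w: "w \<in> borel_measurable borel" "\<And>e. e \<in> edges S M \<Gamma> \<Longrightarrow> \<exists>B. \<forall>x\<in>e. \<bar>w x\<bar> \<le> B"
    and U: "\<And>e x. e \<in> edges S M \<Gamma> \<Longrightarrow> x \<in> e - exceptional e \<Longrightarrow> U e x = u e x + c *\<^sub>R u' e x"
    and V: "\<And>e x. e \<in> edges S M \<Gamma> \<Longrightarrow> x \<in> e - exceptional e \<Longrightarrow> V e x = v e x + c *\<^sub>R v' e x"
  defines "sk \<equiv> \<lambda>f g. skeleton_integral S M \<Gamma> (\<lambda>e x. w x * (f e x \<bullet> g e x))"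
  shows "sk U V = sk u v + c * (sk u v' + sk u' v) + c\<^sup>2 * sk u' v'"
proof -
  have "(LINT x:e|arclength. w x * (U e x \<bullet> V e x)) = (LINT x:e|arclength. w x * (u e x \<bullet> v e x)) +
     c * ((LINT x:e|arclength. w x * (u e x \<bullet> v' e x)) + (LINT x:e|arclength. w x * (u' e x \<bullet> v e x))) +
     c\<^sup>2 * (LINT x:e|arclength. w x * (u' e x \<bullet> v' e x))" if e: "e \<in> edges S M \<Gamma>" for e
  proof -
    have restrict: "(LINT x:e|arclength. f x) = (\<integral>x. f x \<partial>restrict_space arclength e)" for f :: "vec2 \<Rightarrow> real"
      using edge_borel[OF e]
      by (simp add: set_lebesgue_integral_def integral_restrict_space sets_arclength space_arclength)
    obtain B where "\<forall>x\<in>e. \<bar>w x\<bar> \<le> B"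
      using w(2)[OF e] by blast
    then have B: "AE x in restrict_space arclength e. \<bar>w x\<bar> \<le> B"
      by (intro AE_I2) (simp add: space_restrict_space)
    have w_meas: "w \<in> borel_measurable (restrict_space arclength e)"
      unfolding edge_measurable_iff by (rule measurable_restrict_space1[OF w(1)])
    note si = fields[unfolded skeleton_field_def, THEN bspec, OF e]
    note AE = AE_arclength_finite[OF edge_borel[OF e] finite_exceptional[OF e]]
    show ?thesis
      unfolding restrict
      by (rule integral_weighted_inner_expand[OF si(1-4) si(5,6)[THEN square_integrable_measurable]
            w_meas B AE[OF U[OF e]] AE[OF V[OF e]]])
  qed
  then show ?thesis
    unfolding sk_def skeleton_integral_def by (simp add: sum.distrib sum_distrib_left distrib_left)
qed

lemma skeleton_weights:
  "(\<lambda>x. inverse (density M x)) \<in> borel_measurable borel"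
  "(\<lambda>x. inverse (density M x ^ 3)) \<in> borel_measurable borel"
  "e \<in> edges S M \<Gamma> \<Longrightarrow> \<exists>B. \<forall>x\<in>e. \<bar>inverse (density M x)\<bar> \<le> B"
  "e \<in> edges S M \<Gamma> \<Longrightarrow> \<exists>B. \<forall>x\<in>e. \<bar>inverse (density M x ^ 3)\<bar> \<le> B"
proof -
  note density_measurable[measurable]
  show "(\<lambda>x. inverse (density M x)) \<in> borel_measurable borel"
    "(\<lambda>x. inverse (density M x ^ 3)) \<in> borel_measurable borel"
    by measurable
  assume "e \<in> edges S M \<Gamma>"
  then obtain B where B: "\<And>x. x \<in> e \<Longrightarrow> inverse (density M x) \<le> B"
    using edge_density_bound by blast
  have pos: "inverse (density M x) > 0" for x
    using density_pos by simp
  have "\<bar>inverse (density M x)\<bar> \<le> B" "\<bar>inverse (density M x ^ 3)\<bar> \<le> B ^ 3" if "x \<in> e" for x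
    using B[OF that] pos[of x] power_mono[of "inverse (density M x)" B 3]
    by (simp_all add: power_inverse)
  then show "\<exists>B. \<forall>x\<in>e. \<bar>inverse (density M x)\<bar> \<le> B"
    "\<exists>B. \<forall>x\<in>e. \<bar>inverse (density M x ^ 3)\<bar> \<le> B"
    by blast+
qed

lemma Vh3_broken_continuous:
  assumes "v \<in> Vh3 S k \<Omega> M"
  shows "broken_continuous v" "broken_continuous (grad v)" "broken_continuous (hess v)"
    "broken_continuous (grad (laplacian v))"
  using Vh3_regularity[OF assms] by (auto simp: broken_continuous_def)

text \<open>Inside the average the normal is frozen at x while the trace variable moves, so
  contraction with it is a fixed linear map and commutes with the limits.\<close>

lemma avg_dn_grad_eq:
  assumes "v \<in> Vh3 S k \<Omega> M" "x \<in> e - exceptional e"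
  shows "avg_dn_grad M v e x = (\<chi> i. average M (hess v) e x $ i *v normal M e x)"
  unfolding avg_dn_grad_def
  by (rule average_linear[OF assms(2) Vh3_broken_continuous(3)[OF assms(1)]])
     (auto intro!: linearI simp: vec_eq_iff matrix_vector_mult_add_rdistrib scaleR_matrix_vector_assoc)

lemma avg_dn_lap_eq:
  assumes "v \<in> Vh3 S k \<Omega> M" "x \<in> e - exceptional e"
  shows "avg_dn_lap M v e x = average M (grad (laplacian v)) e x *v normal M e x"
  unfolding avg_dn_lap_def
  by (rule average_linear[OF assms(2) Vh3_broken_continuous(4)[OF assms(1)]])
     (auto intro!: linearI simp: matrix_vector_mult_add_rdistrib scaleR_matrix_vector_assoc)

lemma skeleton_field_averages:
  assumes v: "v \<in> Vh3 S k \<Omega> M"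
  shows "skeleton_field (avg_dn_grad M v)" "skeleton_field (avg_dn_lap M v)"
proof -
  have cont: "continuous_on e (\<lambda>x. A x *v n x)"
    if A: "continuous_on e A" and n: "continuous_on e n" for e and A :: "vec2 \<Rightarrow> real^2^'m" and n
    unfolding matrix_vector_mult_def using A n
    by (intro continuous_on_vec_lambda continuous_on_sum continuous_on_mult continuous_on_component)
  have "square_integrable (restrict_space arclength e) (avg_dn_grad M v e) \<and>
      square_integrable (restrict_space arclength e) (avg_dn_lap M v e)" if e: "e \<in> edges S M \<Gamma>" for e
  proof
    note normal = almost_continuous_normal[OF e Vh3_broken_continuous(1)[OF v]]
    have "almost_continuous e (\<lambda>x. \<chi> i. average M (hess v) e x $ i *v normal M e x)"
      by (rule almost_continuous_combine[where h = "\<lambda>A n. \<chi> i. A $ i *v n",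
            OF almost_continuous_average[OF e Vh3_broken_continuous(3)[OF v]] normal])
         (intro continuous_on_vec_lambda cont continuous_on_component)
    then have "almost_continuous e (avg_dn_grad M v e)"
      by (rule almost_continuous_cong[OF _ finite_exceptional[OF e]]) (simp add: avg_dn_grad_eq[OF v])
    then show "square_integrable (restrict_space arclength e) (avg_dn_grad M v e)"
      by (rule square_integrable_ac[OF e])
    have "almost_continuous e (\<lambda>x. average M (grad (laplacian v)) e x *v normal M e x)"
      by (rule almost_continuous_combine[where h = "(*v)",
            OF almost_continuous_average[OF e Vh3_broken_continuous(4)[OF v]] normal])
         (rule cont)
    then have "almost_continuous e (avg_dn_lap M v e)"
      by (rule almost_continuous_cong[OF _ finite_exceptional[OF e]]) (simp add: avg_dn_lap_eq[OF v])
    then show "square_integrable (restrict_space arclength e) (avg_dn_lap M v e)"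
      by (rule square_integrable_ac[OF e])
  qed
  then show "skeleton_field (avg_dn_grad M v)" "skeleton_field (avg_dn_lap M v)"
    by (auto simp: skeleton_field_def)
qed

section \<open>Linear structure of the discrete space\<close>

lemma L2_space_add_scaleR:
  assumes "u \<in> L2_space \<Omega>" "v \<in> L2_space \<Omega>"
  shows "(\<lambda>x. u x + c *\<^sub>R v x) \<in> L2_space \<Omega>"
  using assms square_integrable_add_scaleR open_domain
  by (simp add: L2_space_iff borel_open)

lemma Vh3_add_scaleR:
  assumes v: "v \<in> Vh3 S k \<Omega> M" and w: "w \<in> Vh3 S k \<Omega> M"
  shows "(\<lambda>x. v x + c *\<^sub>R w x) \<in> Vh3 S k \<Omega> M"
proof -
  have poly: "(\<lambda>x. p x + c * q x) \<in> ref_poly S k" if p: "p \<in> ref_poly S k" and q: "q \<in> ref_poly S k" for p q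
  proof (cases S)
    case Triangle
    obtain a a' where "\<And>x. p x = (\<Sum>i\<le>k. \<Sum>j\<le>k - i. a i j * (x $ 1) ^ i * (x $ 2) ^ j)"
      "\<And>x. q x = (\<Sum>i\<le>k. \<Sum>j\<le>k - i. a' i j * (x $ 1) ^ i * (x $ 2) ^ j)"
      using p q Triangle by auto
    then show ?thesis
      unfolding Triangle ref_poly.simps
      by (auto intro!: exI[of _ "\<lambda>i j. a i j + c * a' i j"]
          simp: algebra_simps sum.distrib sum_distrib_left)
  next
    case Square
    obtain a a' where "\<And>x. p x = (\<Sum>i\<le>k. \<Sum>j\<le>k. a i j * (x $ 1) ^ i * (x $ 2) ^ j)"
      "\<And>x. q x = (\<Sum>i\<le>k. \<Sum>j\<le>k. a' i j * (x $ 1) ^ i * (x $ 2) ^ j)"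
      using p q Square by auto
    then show ?thesis
      unfolding Square ref_poly.simps
      by (auto intro!: exI[of _ "\<lambda>i j. a i j + c * a' i j"]
          simp: algebra_simps sum.distrib sum_distrib_left)
  qed
  have "(\<lambda>x. v x $ i + c * w x $ i) \<in> Vh S k \<Omega> M" for i
  proof -
    have vi: "(\<lambda>x. v x $ i) \<in> Vh S k \<Omega> M" and wi: "(\<lambda>x. w x $ i) \<in> Vh S k \<Omega> M"
      using v w by (auto simp: Vh3_def)
    have "\<exists>p\<in>ref_poly S k. \<forall>x\<in>interior (ref_elem S). v (emap M T x) $ i + c * w (emap M T x) $ i = p x"
      if T: "T \<in> elems M" for T
    proof -
      obtain p q where p: "p \<in> ref_poly S k" "\<forall>x\<in>interior (ref_elem S). v (emap M T x) $ i = p x"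
        and q: "q \<in> ref_poly S k" "\<forall>x\<in>interior (ref_elem S). w (emap M T x) $ i = q x"
        using vi wi T unfolding Vh_def by blast
      show ?thesis
        by (rule bexI[OF _ poly[OF p(1) q(1)]]) (use p(2) q(2) in simp)
    qed
    with vi wi L2_space_add_scaleR[of "\<lambda>x. v x $ i" "\<lambda>x. w x $ i" c] show ?thesis
      by (simp add: Vh_def)
  qed
  then show ?thesis
    by (simp add: Vh3_def)
qed

end

section \<open>Quadratic expansions\<close>

lemma norm_vec_power2: "(norm (A :: ('a::real_normed_vector)^'n))\<^sup>2 = (\<Sum>i\<in>UNIV. (norm (A $ i))\<^sup>2)"
  by (simp add: norm_vec_def L2_set_def sum_nonneg)

lemma norm_matrix_power2: "(norm (A :: real^'n^'m))\<^sup>2 = (\<Sum>j\<in>UNIV. (norm (column j A))\<^sup>2)"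
proof -
  have "(norm A)\<^sup>2 = (\<Sum>i\<in>UNIV. \<Sum>j\<in>UNIV. (A $ i $ j)\<^sup>2)"
    by (simp add: norm_vec_power2)
  also have "\<dots> = (\<Sum>j\<in>UNIV. \<Sum>i\<in>UNIV. (A $ i $ j)\<^sup>2)"
    by (rule sum.swap)
  finally show ?thesis
    by (simp add: norm_vec_power2 column_def)
qed

text \<open>Entries of the product are inner products of columns, so Cauchy-Schwarz applies
  entrywise. The constant 1 keeps the defect estimate free of extra factors.\<close>

lemma norm_transpose_matrix_mult:
  fixes A :: "real^'n^'m" and B :: "real^'l^'m"
  shows "norm (transpose A ** B) \<le> norm A * norm B"
proof (rule power2_le_imp_le)
  have entry: "((transpose A ** B) $ i $ j)\<^sup>2 \<le> (norm (column i A))\<^sup>2 * (norm (column j B))\<^sup>2" for i j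
  proof -
    have "(transpose A ** B) $ i $ j = column i A \<bullet> column j B"
      by (simp add: matrix_matrix_mult_def transpose_def column_def inner_vec_def)
    then have "\<bar>(transpose A ** B) $ i $ j\<bar> \<le> norm (column i A) * norm (column j B)"
      by (simp add: Cauchy_Schwarz_ineq2)
    then have "\<bar>(transpose A ** B) $ i $ j\<bar>\<^sup>2 \<le> (norm (column i A) * norm (column j B))\<^sup>2"
      by (intro power_mono) auto
    then show ?thesis
      by (simp add: power_mult_distrib)
  qed
  have "(norm (transpose A ** B))\<^sup>2 = (\<Sum>i\<in>UNIV. \<Sum>j\<in>UNIV. ((transpose A ** B) $ i $ j)\<^sup>2)"
    by (simp add: norm_vec_power2)
  also have "\<dots> \<le> (\<Sum>i\<in>UNIV. \<Sum>j\<in>UNIV. (norm (column i A))\<^sup>2 * (norm (column j B))\<^sup>2)"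
    by (intro sum_mono entry)
  also have "\<dots> = (norm A * norm B)\<^sup>2"
    by (simp add: norm_matrix_power2 power_mult_distrib sum_product)
  finally show "(norm (transpose A ** B))\<^sup>2 \<le> (norm A * norm B)\<^sup>2" .
qed simp

lemma integrable_transpose_matrix_mult:
  fixes A :: "'a \<Rightarrow> real^'n^'m" and B :: "'a \<Rightarrow> real^'l^'m"
  assumes A: "square_integrable N A" and B: "square_integrable N B"
  shows "integrable N (\<lambda>x. transpose (A x) ** B x)"
proof (rule square_integrable_dominated[OF A B])
  have "continuous_on UNIV (\<lambda>x :: (real^'n^'m) \<times> (real^'l^'m). transpose (fst x) ** snd x)"
    unfolding matrix_matrix_mult_def transpose_def
    by (simp, intro continuous_on_vec_lambda continuous_on_sum continuous_on_mult continuous_on_component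
        continuous_on_fst continuous_on_snd continuous_on_id)
  then show "(\<lambda>x. transpose (A x) ** B x) \<in> borel_measurable N"
    using borel_measurable_continuous_Pair[OF square_integrable_measurable[OF A]
        square_integrable_measurable[OF B], of "\<lambda>X Y. transpose X ** Y"] by simp
qed (rule norm_transpose_matrix_mult)

section \<open>Leading terms of quadratic inequalities\<close>

text \<open>Dividing by the square of s and setting t = 1/s turns the behaviour at infinity into a
  limit at 0 from the right.\<close>

lemma leading_coefficient_nonneg:
  fixes p q r :: real
  assumes "\<And>s. s > 0 \<Longrightarrow> p + q * s + r * s\<^sup>2 \<ge> 0"
  shows "r \<ge> 0"
proof -
  have "((\<lambda>t. p * t\<^sup>2 + q * t + r) \<longlongrightarrow> p * 0\<^sup>2 + q * 0 + r) (at_right 0)"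
    by (intro tendsto_intros)
  moreover have "\<forall>\<^sub>F t in at_right 0. 0 \<le> p * t\<^sup>2 + q * t + r"
    using eventually_at_right_less[of 0]
  proof eventually_elim
    case (elim t)
    have "0 \<le> t\<^sup>2 * (p + q * (1 / t) + r * (1 / t)\<^sup>2)"
      using assms[of "1 / t"] elim by simp
    also have "\<dots> = p * t\<^sup>2 + q * t + r"
      using elim by (simp add: field_simps power2_eq_square)
    finally show ?case .
  qed
  ultimately show ?thesis
    using tendsto_lowerbound[OF _ _ trivial_limit_at_right_real] by fastforce
qed

text \<open>After scaling by t = 1/s the constant contributes t K and vanishes. The real
  \<open>sqrt\<close> is continuous and multiplicative on all reals, so the coefficients carry no
  sign conditions.\<close>

lemma sqrt_quadratic_asymptotic:
  fixes a0 a1 a2 b0 b1 b2 A B K :: real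
  assumes "\<And>s. s > 0 \<Longrightarrow>
    sqrt (a0 + s * a1 + s\<^sup>2 * a2) \<le> A * (sqrt (b0 + s * b1 + s\<^sup>2 * b2) + K)"
  shows "sqrt a2 \<le> A * sqrt b2"
proof -
  have scale: "t * sqrt (x0 + (1 / t) * x1 + (1 / t)\<^sup>2 * x2) = sqrt (t\<^sup>2 * x0 + t * x1 + x2)"
    if "t > 0" for t x0 x1 x2 :: real
  proof -
    have "t\<^sup>2 * x0 + t * x1 + x2 = t\<^sup>2 * (x0 + (1 / t) * x1 + (1 / t)\<^sup>2 * x2)"
      using that by (simp add: field_simps power2_eq_square)
    then show ?thesis
      using that by (simp add: real_sqrt_mult)
  qed
  have "((\<lambda>t. A * (sqrt (t\<^sup>2 * b0 + t * b1 + b2) + t * K) - sqrt (t\<^sup>2 * a0 + t * a1 + a2)) \<longlongrightarrow>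
      A * (sqrt (0\<^sup>2 * b0 + 0 * b1 + b2) + 0 * K) - sqrt (0\<^sup>2 * a0 + 0 * a1 + a2)) (at_right 0)"
    by (intro tendsto_intros)
  moreover have "\<forall>\<^sub>F t in at_right 0.
      0 \<le> A * (sqrt (t\<^sup>2 * b0 + t * b1 + b2) + t * K) - sqrt (t\<^sup>2 * a0 + t * a1 + a2)"
    using eventually_at_right_less[of 0]
  proof eventually_elim
    case (elim t)
    have "t * sqrt (a0 + (1 / t) * a1 + (1 / t)\<^sup>2 * a2) \<le>
        t * (A * (sqrt (b0 + (1 / t) * b1 + (1 / t)\<^sup>2 * b2) + K))"
      using assms[of "1 / t"] elim by (intro mult_left_mono) auto
    also have "\<dots> = A * (t * sqrt (b0 + (1 / t) * b1 + (1 / t)\<^sup>2 * b2) + t * K)"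
      by (simp only: algebra_simps)
    finally show ?case
      unfolding scale[OF elim] by simp
  qed
  ultimately show ?thesis
    using tendsto_lowerbound[OF _ _ trivial_limit_at_right_real] by fastforce
qed

context regular_mesh
begin

lemma domain_lmeasurable: "\<Omega> \<in> lmeasurable"
  using bounded_domain open_domain by (rule lmeasurable_open)

lemma AE_domain_interior:
  assumes "A \<in> sets lebesgue" "A \<subseteq> closure \<Omega>" "\<And>T x. T \<in> elems M \<Longrightarrow> x \<in> interior T \<Longrightarrow> P x"
  shows "AE x in lebesgue_on A. P x"
proof -
  have "AE x in lebesgue. x \<in> A \<longrightarrow> P x"
    using AE_interior_element
  proof eventually_elim
    case (elim x)
    show ?case
    proof
      assume "x \<in> A"
      then obtain T where "T \<in> elems M" "x \<in> T"
        using assms(2) Union_elems by blast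
      then show "P x"
        using elim assms(3)[of T x] by simp
    qed
  qed
  then show ?thesis
    using assms(1) by (subst AE_restrict_space_iff) auto
qed

lemma L2_inner_expand:
  fixes u v U :: "vec2 \<Rightarrow> 'a::euclidean_space"
  assumes bc: "broken_continuous u" "broken_continuous v" "broken_continuous U"
    and U: "\<And>T x. T \<in> elems M \<Longrightarrow> x \<in> interior T \<Longrightarrow> U x = u x + c *\<^sub>R v x"
  shows "L2_inner \<Omega> U U = L2_inner \<Omega> u u + 2 * c * L2_inner \<Omega> u v + c\<^sup>2 * L2_inner \<Omega> v v"
proof -
  have si: "square_integrable (lebesgue_on \<Omega>) f" if "broken_continuous f" for f :: "vec2 \<Rightarrow> 'a"
    by (rule square_integrable_broken[OF that domain_lmeasurable closure_subset])
  have AE: "AE x in lebesgue_on \<Omega>. U x = u x + c *\<^sub>R v x"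
    using domain_lmeasurable closure_subset U by (intro AE_domain_interior) auto
  have "(\<integral>x. 1 * (U x \<bullet> U x) \<partial>lebesgue_on \<Omega>) = (\<integral>x. 1 * (u x \<bullet> u x) \<partial>lebesgue_on \<Omega>) +
     c * ((\<integral>x. 1 * (u x \<bullet> v x) \<partial>lebesgue_on \<Omega>) + (\<integral>x. 1 * (v x \<bullet> u x) \<partial>lebesgue_on \<Omega>)) +
     c\<^sup>2 * (\<integral>x. 1 * (v x \<bullet> v x) \<partial>lebesgue_on \<Omega>)"
    by (rule integral_weighted_inner_expand[where B = 1])
       (use si[OF bc(1)] si[OF bc(2)] si[OF bc(3), THEN square_integrable_measurable] AE in auto)
  then show ?thesis
    using domain_lmeasurable by (simp add: L2_inner_eq inner_commute fmeasurableD algebra_simps)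
qed

section \<open>Expansion of the forms along y + c v\<close>

context
  fixes y v :: "vec2 \<Rightarrow> vec3" and c :: real
  assumes y: "y \<in> Vh3 S k \<Omega> M" and v: "v \<in> Vh3 S k \<Omega> M"
begin

private abbreviation (input) "z \<equiv> \<lambda>x. y x + c *\<^sub>R v x"

lemma combination_in_Vh3: "z \<in> Vh3 S k \<Omega> M"
  by (rule Vh3_add_scaleR[OF y v])

lemma L2_hess_expand:
  "L2_inner \<Omega> (hess z) (hess z) =
     L2_inner \<Omega> (hess y) (hess y) + 2 * c * L2_inner \<Omega> (hess y) (hess v) + c\<^sup>2 * L2_inner \<Omega> (hess v) (hess v)"
  by (intro L2_inner_expand Vh3_broken_continuous y v combination_in_Vh3 hess_add_scaleR)

lemma L2_grad_expand:
  "L2_inner \<Omega> (grad z) (grad z) =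
     L2_inner \<Omega> (grad y) (grad y) + 2 * c * L2_inner \<Omega> (grad y) (grad v) + c\<^sup>2 * L2_inner \<Omega> (grad v) (grad v)"
  by (intro L2_inner_expand Vh3_broken_continuous y v combination_in_Vh3 grad_add_scaleR)

text \<open>The boundary data are subtracted once, in the jump of y, so the increment v enters with
  homogeneous data.\<close>

lemma jump_expand: "x \<in> e - exceptional e \<Longrightarrow>
    jump M b z e x = jump M b y e x + c *\<^sub>R jump M (\<lambda>_. 0) v e x"
  by (rule jump_add_scaleR) (intro Vh3_broken_continuous y v refl | assumption)+

lemma jump_grad_expand: "x \<in> e - exceptional e \<Longrightarrow>
    jump M b (grad z) e x = jump M b (grad y) e x + c *\<^sub>R jump M (\<lambda>_. 0) (grad v) e x"
  by (rule jump_add_scaleR) (intro Vh3_broken_continuous grad_add_scaleR y v | assumption)+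

lemma avg_dn_grad_expand: "x \<in> e - exceptional e \<Longrightarrow>
    avg_dn_grad M z e x = avg_dn_grad M y e x + c *\<^sub>R avg_dn_grad M v e x"
proof -
  assume x: "x \<in> e - exceptional e"
  have "average M (hess z) e x = average M (hess y) e x + c *\<^sub>R average M (hess v) e x"
    by (rule average_add_scaleR[OF x]) (intro Vh3_broken_continuous hess_add_scaleR y v | assumption)+
  then have "avg_dn_grad M z e x $ i = (avg_dn_grad M y e x + c *\<^sub>R avg_dn_grad M v e x) $ i" for i
    by (simp add: avg_dn_grad_eq[OF y x] avg_dn_grad_eq[OF v x] avg_dn_grad_eq[OF combination_in_Vh3 x]
        matrix_vector_mult_add_rdistrib scaleR_matrix_vector_assoc)
  then show ?thesis
    by (subst vec_eq_iff) blast
qed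

lemma avg_dn_lap_expand: "x \<in> e - exceptional e \<Longrightarrow>
    avg_dn_lap M z e x = avg_dn_lap M y e x + c *\<^sub>R avg_dn_lap M v e x"
proof -
  assume x: "x \<in> e - exceptional e"
  have "average M (grad (laplacian z)) e x =
      average M (grad (laplacian y)) e x + c *\<^sub>R average M (grad (laplacian v)) e x"
    by (rule average_add_scaleR[OF x]) (intro Vh3_broken_continuous grad_laplacian_add_scaleR y v | assumption)+
  then show ?thesis
    using avg_dn_lap_eq[OF y x] avg_dn_lap_eq[OF v x] avg_dn_lap_eq[OF combination_in_Vh3 x]
    by (simp add: matrix_vector_mult_add_rdistrib scaleR_matrix_vector_assoc)
qed

lemma skeleton_jump_expand:
  fixes w
  assumes b: "boundary_field (fst b)" "boundary_field (snd b)"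
    and w: "w \<in> borel_measurable borel" "\<And>e. e \<in> edges S M \<Gamma> \<Longrightarrow> \<exists>B. \<forall>x\<in>e. \<bar>w x\<bar> \<le> B"
  shows "skeleton_integral S M \<Gamma> (\<lambda>e x. w x * (jump M (fst b) z e x \<bullet> jump M (fst b) z e x)) =
      skeleton_integral S M \<Gamma> (\<lambda>e x. w x * (jump M (fst b) y e x \<bullet> jump M (fst b) y e x)) +
      2 * c * skeleton_integral S M \<Gamma> (\<lambda>e x. w x * (jump M (fst b) y e x \<bullet> jump M (\<lambda>_. 0) v e x)) +
      c\<^sup>2 * skeleton_integral S M \<Gamma> (\<lambda>e x. w x * (jump M (\<lambda>_. 0) v e x \<bullet> jump M (\<lambda>_. 0) v e x))"
    and "skeleton_integral S M \<Gamma> (\<lambda>e x. w x * (jump M (snd b) (grad z) e x \<bullet> jump M (snd b) (grad z) e x)) =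
      skeleton_integral S M \<Gamma> (\<lambda>e x. w x * (jump M (snd b) (grad y) e x \<bullet> jump M (snd b) (grad y) e x)) +
      2 * c * skeleton_integral S M \<Gamma> (\<lambda>e x. w x * (jump M (snd b) (grad y) e x \<bullet> jump M (\<lambda>_. 0) (grad v) e x)) +
      c\<^sup>2 * skeleton_integral S M \<Gamma> (\<lambda>e x. w x * (jump M (\<lambda>_. 0) (grad v) e x \<bullet> jump M (\<lambda>_. 0) (grad v) e x))"
  using skeleton_integral_expand[OF
      skeleton_field_jump[OF Vh3_broken_continuous(1)[OF y] b(1)]
      skeleton_field_jump[OF Vh3_broken_continuous(1)[OF v] boundary_field_zero]
      skeleton_field_jump[OF Vh3_broken_continuous(1)[OF y] b(1)]
      skeleton_field_jump[OF Vh3_broken_continuous(1)[OF v] boundary_field_zero]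
      skeleton_field_jump[OF Vh3_broken_continuous(1)[OF combination_in_Vh3] b(1)]
      skeleton_field_jump[OF Vh3_broken_continuous(1)[OF combination_in_Vh3] b(1)]
      w jump_expand jump_expand]
    skeleton_integral_expand[OF
      skeleton_field_jump[OF Vh3_broken_continuous(2)[OF y] b(2)]
      skeleton_field_jump[OF Vh3_broken_continuous(2)[OF v] boundary_field_zero]
      skeleton_field_jump[OF Vh3_broken_continuous(2)[OF y] b(2)]
      skeleton_field_jump[OF Vh3_broken_continuous(2)[OF v] boundary_field_zero]
      skeleton_field_jump[OF Vh3_broken_continuous(2)[OF combination_in_Vh3] b(2)]
      skeleton_field_jump[OF Vh3_broken_continuous(2)[OF combination_in_Vh3] b(2)]
      w jump_grad_expand jump_grad_expand]
  by (simp_all add: inner_commute)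

lemma skeleton_average_expand:
  assumes b: "boundary_field (fst b)" "boundary_field (snd b)"
  defines "sk \<equiv> skeleton_integral S M \<Gamma>"
  shows "sk (\<lambda>e x. avg_dn_grad M z e x \<bullet> jump M (snd b) (grad z) e x) =
      sk (\<lambda>e x. avg_dn_grad M y e x \<bullet> jump M (snd b) (grad y) e x) +
      c * (sk (\<lambda>e x. avg_dn_grad M y e x \<bullet> jump M (\<lambda>_. 0) (grad v) e x) +
           sk (\<lambda>e x. avg_dn_grad M v e x \<bullet> jump M (snd b) (grad y) e x)) +
      c\<^sup>2 * sk (\<lambda>e x. avg_dn_grad M v e x \<bullet> jump M (\<lambda>_. 0) (grad v) e x)"
    and "sk (\<lambda>e x. avg_dn_lap M z e x \<bullet> jump M (fst b) z e x) =
      sk (\<lambda>e x. avg_dn_lap M y e x \<bullet> jump M (fst b) y e x) +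
      c * (sk (\<lambda>e x. avg_dn_lap M y e x \<bullet> jump M (\<lambda>_. 0) v e x) +
           sk (\<lambda>e x. avg_dn_lap M v e x \<bullet> jump M (fst b) y e x)) +
      c\<^sup>2 * sk (\<lambda>e x. avg_dn_lap M v e x \<bullet> jump M (\<lambda>_. 0) v e x)"
proof -
  have w: "(\<lambda>_. 1) \<in> borel_measurable borel" "\<And>e. \<exists>B. \<forall>x\<in>e. \<bar>1::real\<bar> \<le> B"
    by auto
  show "sk (\<lambda>e x. avg_dn_grad M z e x \<bullet> jump M (snd b) (grad z) e x) =
      sk (\<lambda>e x. avg_dn_grad M y e x \<bullet> jump M (snd b) (grad y) e x) +
      c * (sk (\<lambda>e x. avg_dn_grad M y e x \<bullet> jump M (\<lambda>_. 0) (grad v) e x) +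
           sk (\<lambda>e x. avg_dn_grad M v e x \<bullet> jump M (snd b) (grad y) e x)) +
      c\<^sup>2 * sk (\<lambda>e x. avg_dn_grad M v e x \<bullet> jump M (\<lambda>_. 0) (grad v) e x)"
    using skeleton_integral_expand[OF
      skeleton_field_averages(1)[OF y] skeleton_field_averages(1)[OF v]
      skeleton_field_jump[OF Vh3_broken_continuous(2)[OF y] b(2)]
      skeleton_field_jump[OF Vh3_broken_continuous(2)[OF v] boundary_field_zero]
      skeleton_field_averages(1)[OF combination_in_Vh3]
      skeleton_field_jump[OF Vh3_broken_continuous(2)[OF combination_in_Vh3] b(2)]
      w avg_dn_grad_expand jump_grad_expand]
    by (simp add: sk_def)
  show "sk (\<lambda>e x. avg_dn_lap M z e x \<bullet> jump M (fst b) z e x) =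
      sk (\<lambda>e x. avg_dn_lap M y e x \<bullet> jump M (fst b) y e x) +
      c * (sk (\<lambda>e x. avg_dn_lap M y e x \<bullet> jump M (\<lambda>_. 0) v e x) +
           sk (\<lambda>e x. avg_dn_lap M v e x \<bullet> jump M (fst b) y e x)) +
      c\<^sup>2 * sk (\<lambda>e x. avg_dn_lap M v e x \<bullet> jump M (\<lambda>_. 0) v e x)"
    using skeleton_integral_expand[OF
      skeleton_field_averages(2)[OF y] skeleton_field_averages(2)[OF v]
      skeleton_field_jump[OF Vh3_broken_continuous(1)[OF y] b(1)]
      skeleton_field_jump[OF Vh3_broken_continuous(1)[OF v] boundary_field_zero]
      skeleton_field_averages(2)[OF combination_in_Vh3]
      skeleton_field_jump[OF Vh3_broken_continuous(1)[OF combination_in_Vh3] b(1)]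
      w avg_dn_lap_expand jump_expand]
    by (simp add: sk_def)
qed

lemma H2h_inner_expand:
  assumes b: "boundary_field (fst b)" "boundary_field (snd b)"
  shows "H2h_inner S \<Omega> \<Gamma> M b z b z = H2h_inner S \<Omega> \<Gamma> M b y b y +
    2 * c * H2h_inner S \<Omega> \<Gamma> M b y zero_bd v + c\<^sup>2 * H2h_inner S \<Omega> \<Gamma> M zero_bd v zero_bd v"
  using skeleton_jump_expand(2)[OF b skeleton_weights(1,3)] skeleton_jump_expand(1)[OF b skeleton_weights(2,4)]
  unfolding H2h_inner_def L2_hess_expand
  by (simp add: zero_bd_def algebra_simps)

text \<open>An average paired with a jump is not symmetric by itself, but \<open>a_h\<close>
  contains each such term with its mirror image, so the mixed terms add up to twice one value of
  \<open>a_h\<close>.\<close>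

lemma a_h_expand:
  assumes b: "boundary_field (fst b)" "boundary_field (snd b)"
  shows "a_h S \<Omega> \<Gamma> M \<gamma>0 \<gamma>1 b z b z = a_h S \<Omega> \<Gamma> M \<gamma>0 \<gamma>1 b y b y +
    2 * c * a_h S \<Omega> \<Gamma> M \<gamma>0 \<gamma>1 b y zero_bd v + c\<^sup>2 * a_h S \<Omega> \<Gamma> M \<gamma>0 \<gamma>1 zero_bd v zero_bd v"
  using skeleton_jump_expand(2)[OF b skeleton_weights(1,3)] skeleton_jump_expand(1)[OF b skeleton_weights(2,4)]
  unfolding a_h_def L2_hess_expand skeleton_average_expand[OF b]
  by (simp add: zero_bd_def algebra_simps)

lemma E_h_expand:
  assumes b: "boundary_field (fst b)" "boundary_field (snd b)" and f: "f \<in> L2_space \<Omega>"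
  shows "E_h S \<Omega> \<Gamma> M \<gamma>0 \<gamma>1 f b z = E_h S \<Omega> \<Gamma> M \<gamma>0 \<gamma>1 f b y +
    c * (a_h S \<Omega> \<Gamma> M \<gamma>0 \<gamma>1 b y zero_bd v - L2_inner \<Omega> f v) +
    c\<^sup>2 / 2 * a_h S \<Omega> \<Gamma> M \<gamma>0 \<gamma>1 zero_bd v zero_bd v"
proof -
  have \<Omega>: "\<Omega> \<in> sets lebesgue"
    using domain_lmeasurable by auto
  have si: "square_integrable (lebesgue_on \<Omega>) f" "square_integrable (lebesgue_on \<Omega>) y"
    "square_integrable (lebesgue_on \<Omega>) v"
    using f L2_space_iff[OF \<Omega>] square_integrable_broken[OF Vh3_broken_continuous(1) domain_lmeasurable closure_subset]
      y v by auto
  have "L2_inner \<Omega> f z = L2_inner \<Omega> f y + c * L2_inner \<Omega> f v"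
    using integrable_inner[OF si(1,2)] integrable_inner[OF si(1,3)]
    by (simp add: L2_inner_eq[OF \<Omega>] inner_add_right)
  then show ?thesis
    unfolding E_h_def a_h_expand[OF b] by (simp add: algebra_simps)
qed

end

end

section \<open>The gradient flow\<close>

text \<open>A non-integrable integrand has integral 0, so the sign is right in that case
  too.\<close>

lemma set_lebesgue_integral_nonneg:
  fixes f :: "'a \<Rightarrow> real"
  shows "(\<And>x. f x \<ge> 0) \<Longrightarrow> (LINT x:A|N. f x) \<ge> 0"
  unfolding set_lebesgue_integral_def by (intro Bochner_Integration.integral_nonneg) simp

lemma L2_inner_nonneg: "L2_inner \<Omega> u u \<ge> 0"
  unfolding L2_inner_def by (rule set_lebesgue_integral_nonneg) simp

context regular_mesh
begin

lemma H2h_inner_nonneg: "H2h_inner S \<Omega> \<Gamma> M b v b v \<ge> 0"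
  unfolding H2h_inner_def skeleton_integral_def
  by (intro add_nonneg_nonneg L2_inner_nonneg sum_nonneg set_lebesgue_integral_nonneg)
     (simp_all add: density_pos less_imp_le)

lemma boundary_field_trace: "is_trace \<Omega> u t \<Longrightarrow> boundary_field t"
  by (simp add: is_trace_def boundary_field_def)

text \<open>Almost every point lies in at most one element, and then in its interior, which is
  contained in \<Omega>.\<close>

lemma sum_element_integrals:
  fixes g :: "vec2 \<Rightarrow> 'a::euclidean_space"
  assumes g: "broken_continuous g"
  shows "(\<Sum>T\<in>elems M. \<integral>x. (norm (g x))\<^sup>2 \<partial>lebesgue_on T) \<le> L2_inner \<Omega> g g"
proof -
  have \<Omega>: "\<Omega> \<in> sets lebesgue"
    using domain_lmeasurable by auto
  have T_sets: "T \<in> sets lebesgue" "T \<in> lmeasurable" "T \<subseteq> closure \<Omega>" if "T \<in> elems M" for T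
    using lmeasurable_compact[OF compact_element[OF that]] Union_elems that by auto
  have int_T: "integrable lebesgue (\<lambda>x. indicator T x *\<^sub>R (norm (g x))\<^sup>2)" if "T \<in> elems M" for T
    using square_integrable_broken[OF g T_sets(2,3)[OF that]] T_sets(1)[OF that]
    by (simp add: square_integrable_def integrable_restrict_space)
  have int_\<Omega>: "integrable lebesgue (\<lambda>x. indicator \<Omega> x *\<^sub>R (norm (g x))\<^sup>2)"
    using square_integrable_broken[OF g domain_lmeasurable closure_subset] \<Omega>
    by (simp add: square_integrable_def integrable_restrict_space)
  have "(\<Sum>T\<in>elems M. \<integral>x. (norm (g x))\<^sup>2 \<partial>lebesgue_on T) =
      (\<Sum>T\<in>elems M. \<integral>x. indicator T x *\<^sub>R (norm (g x))\<^sup>2 \<partial>lebesgue)"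
    by (intro sum.cong refl) (simp add: T_sets(1) integral_restrict_space)
  also have "\<dots> = (\<integral>x. (\<Sum>T\<in>elems M. indicator T x *\<^sub>R (norm (g x))\<^sup>2) \<partial>lebesgue)"
    using int_T by (intro Bochner_Integration.integral_sum[symmetric])
  also have "\<dots> \<le> (\<integral>x. indicator \<Omega> x *\<^sub>R (norm (g x))\<^sup>2 \<partial>lebesgue)"
  proof (rule integral_mono_AE)
    show "AE x in lebesgue. (\<Sum>T\<in>elems M. indicator T x *\<^sub>R (norm (g x))\<^sup>2) \<le>
        indicator \<Omega> x *\<^sub>R (norm (g x))\<^sup>2"
      using AE_interior_element
    proof eventually_elim
      case (elim x)
      show ?case
      proof (cases "\<exists>T\<in>elems M. x \<in> T")
        case True
        then obtain T where T: "T \<in> elems M" "x \<in> interior T"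
          using elim by blast
        have "x \<notin> T'" if "T' \<in> elems M" "T' \<noteq> T" for T'
          using elim that T interior_disjoint[OF that(1) T(1) that(2)] by blast
        then have "(\<Sum>T\<in>elems M. indicator T x *\<^sub>R (norm (g x))\<^sup>2) =
            (\<Sum>T'\<in>elems M. if T' = T then (norm (g x))\<^sup>2 else 0)"
          using T interior_subset by (intro sum.cong) (auto simp: indicator_def)
        also have "\<dots> = (norm (g x))\<^sup>2"
          using T(1) finite_elems by simp
        finally show ?thesis
          using T interior_element_subset by (auto simp: indicator_def)
      next
        case False
        then have "(\<Sum>T\<in>elems M. indicator T x *\<^sub>R (norm (g x))\<^sup>2) = 0"
          by (intro sum.neutral) auto
        then show ?thesis by simp
      qed
    qed
  qed (use int_T int_\<Omega> in auto)
  also have "\<dots> = L2_inner \<Omega> g g"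
    unfolding L2_inner_def set_lebesgue_integral_def by (simp add: power2_norm_eq_inner)
  finally show ?thesis .
qed

text \<open>The mixed terms cancel only after integration over each element, not pointwise, which is
  why the defect takes the norm outside the integral.\<close>

lemma isometry_defect_step:
  assumes y: "y \<in> Vh3 S k \<Omega> M" and \<delta>: "\<delta> \<in> F_h S k \<Omega> M y"
  shows "isometry_defect M (\<lambda>x. y x + \<delta> x) \<le> isometry_defect M y + L2_inner \<Omega> (grad \<delta>) (grad \<delta>)"
proof -
  let ?P = "\<lambda>u v x. transpose (grad u x) ** grad v x"
  let ?z = "\<lambda>x. y x + \<delta> x"
  have \<delta>V: "\<delta> \<in> Vh3 S k \<Omega> M"
    using \<delta> by (simp add: F_h_def)
  have zV: "?z \<in> Vh3 S k \<Omega> M"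
    using Vh3_add_scaleR[OF y \<delta>V, of 1] by simp
  note bc = Vh3_broken_continuous(2)
  have "norm (LINT x:T|lebesgue. ?P ?z ?z x - mat 1) \<le>
      norm (LINT x:T|lebesgue. ?P y y x - mat 1) + (\<integral>x. (norm (grad \<delta> x))\<^sup>2 \<partial>lebesgue_on T)"
    if T: "T \<in> elems M" for T
  proof -
    have lT: "T \<in> sets lebesgue" "T \<in> lmeasurable" "T \<subseteq> closure \<Omega>"
      using lmeasurable_compact[OF compact_element[OF T]] Union_elems T by auto
    have si: "square_integrable (lebesgue_on T) (grad u)" if "u \<in> Vh3 S k \<Omega> M" for u
      by (rule square_integrable_broken[OF bc[OF that] lT(2,3)])
    have int: "integrable (lebesgue_on T) (?P u v)" if "u \<in> Vh3 S k \<Omega> M" "v \<in> Vh3 S k \<Omega> M" for u v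
      by (rule integrable_transpose_matrix_mult[OF si[OF that(1)] si[OF that(2)]])
    have const: "integrable (lebesgue_on T) (\<lambda>_. mat 1 :: real^2^2)"
      by (rule finite_measure.integrable_const[OF finite_measure_lebesgue_on[OF lT(2)]])
    have i1: "integrable (lebesgue_on T) (\<lambda>x. ?P y y x - mat 1)"
      and i2: "integrable (lebesgue_on T) (\<lambda>x. ?P \<delta> y x + ?P y \<delta> x)"
      and i3: "integrable (lebesgue_on T) (?P \<delta> \<delta>)"
      by (intro Bochner_Integration.integrable_add Bochner_Integration.integrable_diff int const y \<delta>V)+
    have zero: "(\<integral>x. ?P \<delta> y x + ?P y \<delta> x \<partial>lebesgue_on T) = 0"
      using \<delta> T unfolding F_h_def set_integrable_lebesgue_on(2)[OF lT(1), symmetric] by blast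
    have "AE x in lebesgue_on T. grad ?z x = grad y x + 1 *\<^sub>R grad \<delta> x"
      using grad_add_scaleR[OF y \<delta>V, of _ _ 1] by (intro AE_domain_interior lT) simp
    then have AE: "AE x in lebesgue_on T. ?P ?z ?z x - mat 1 =
        (?P y y x - mat 1) + (?P \<delta> y x + ?P y \<delta> x) + ?P \<delta> \<delta> x"
      by eventually_elim
         (simp add: vec_eq_iff matrix_matrix_mult_def transpose_def sum.distrib algebra_simps)
    have "(\<integral>x. ?P ?z ?z x - mat 1 \<partial>lebesgue_on T) =
        (\<integral>x. (?P y y x - mat 1) + (?P \<delta> y x + ?P y \<delta> x) + ?P \<delta> \<delta> x \<partial>lebesgue_on T)"
      by (rule integral_cong_AE[OF _ _ AE])
         (intro borel_measurable_integrable Bochner_Integration.integrable_add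
           Bochner_Integration.integrable_diff int const y \<delta>V zV)+
    also have "\<dots> = (\<integral>x. ?P y y x - mat 1 \<partial>lebesgue_on T) +
        (\<integral>x. ?P \<delta> y x + ?P y \<delta> x \<partial>lebesgue_on T) + (\<integral>x. ?P \<delta> \<delta> x \<partial>lebesgue_on T)"
      by (simp only: Bochner_Integration.integral_add[OF Bochner_Integration.integrable_add[OF i1 i2] i3]
          Bochner_Integration.integral_add[OF i1 i2])
    finally have eq: "(\<integral>x. ?P ?z ?z x - mat 1 \<partial>lebesgue_on T) =
        (\<integral>x. ?P y y x - mat 1 \<partial>lebesgue_on T) + (\<integral>x. ?P \<delta> \<delta> x \<partial>lebesgue_on T)"
      by (simp only: zero add_0_right)
    have "norm (\<integral>x. ?P \<delta> \<delta> x \<partial>lebesgue_on T) \<le> (\<integral>x. (norm (grad \<delta> x))\<^sup>2 \<partial>lebesgue_on T)"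
    proof (rule Bochner_Integration.integral_norm_bound_integral[OF int[OF \<delta>V \<delta>V]])
      show "integrable (lebesgue_on T) (\<lambda>x. (norm (grad \<delta> x))\<^sup>2)"
        using si[OF \<delta>V] by (simp add: square_integrable_def)
      show "norm (?P \<delta> \<delta> x) \<le> (norm (grad \<delta> x))\<^sup>2" for x
        using norm_transpose_matrix_mult[of "grad \<delta> x" "grad \<delta> x"] by (simp add: power2_eq_square)
    qed
    then show ?thesis
      unfolding set_integrable_lebesgue_on(2)[OF lT(1)] eq
      by (intro order_trans[OF norm_triangle_ineq]) simp
  qed
  then have "isometry_defect M ?z \<le> isometry_defect M y +
      (\<Sum>T\<in>elems M. \<integral>x. (norm (grad \<delta> x))\<^sup>2 \<partial>lebesgue_on T)"
    unfolding isometry_defect_def sum.distrib[symmetric] by (rule sum_mono)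
  with sum_element_integrals[OF bc[OF \<delta>V]] show ?thesis
    by linarith
qed

lemma gradient_flow_in_Vh3:
  assumes "y 0 \<in> Vh3 S k \<Omega> M" "gradient_flow S k \<Omega> \<Gamma> M \<gamma>0 \<gamma>1 f b \<tau> y"
  shows "y n \<in> Vh3 S k \<Omega> M"
proof (induction n)
  case (Suc n)
  obtain \<delta> where "\<delta> \<in> F_h S k \<Omega> M (y n)" "y (Suc n) = (\<lambda>x. y n x + \<delta> x)"
    using assms(2) unfolding gradient_flow_def by blast
  then show ?case
    using Vh3_add_scaleR[OF Suc.IH, of \<delta> 1] by (simp add: F_h_def)
qed (rule assms(1))

section \<open>Homogeneous inequalities and the telescoping sum\<close>

lemma coercivity_nonneg:
  assumes b: "boundary_field (fst b)" "boundary_field (snd b)" and f: "f \<in> L2_space \<Omega>"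
    and bounded: "\<And>y. y \<in> Vh3 S k \<Omega> M \<Longrightarrow> E_h S \<Omega> \<Gamma> M \<gamma>0 \<gamma>1 f b y \<ge> - K"
    and y: "y \<in> Vh3 S k \<Omega> M" and v: "v \<in> Vh3 S k \<Omega> M"
  shows "a_h S \<Omega> \<Gamma> M \<gamma>0 \<gamma>1 zero_bd v zero_bd v \<ge> 0"
proof -
  have "a_h S \<Omega> \<Gamma> M \<gamma>0 \<gamma>1 zero_bd v zero_bd v / 2 \<ge> 0"
  proof (rule leading_coefficient_nonneg)
    fix s :: real
    show "0 \<le> (E_h S \<Omega> \<Gamma> M \<gamma>0 \<gamma>1 f b y + K) +
        (a_h S \<Omega> \<Gamma> M \<gamma>0 \<gamma>1 b y zero_bd v - L2_inner \<Omega> f v) * s +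
        a_h S \<Omega> \<Gamma> M \<gamma>0 \<gamma>1 zero_bd v zero_bd v / 2 * s\<^sup>2"
      using bounded[OF Vh3_add_scaleR[OF y v, of s]] E_h_expand[OF y v b f, of \<gamma>0 \<gamma>1 s]
      by (simp add: algebra_simps)
  qed
  then show ?thesis by simp
qed

lemma friedrichs_homogeneous:
  assumes b: "boundary_field (fst b)" "boundary_field (snd b)"
    and bounded: "\<And>y. y \<in> Vh3 S k \<Omega> M \<Longrightarrow>
      L2_norm \<Omega> (grad y) \<le> CF * (H2h_norm S \<Omega> \<Gamma> M b y + K)"
    and y: "y \<in> Vh3 S k \<Omega> M" and v: "v \<in> Vh3 S k \<Omega> M"
  shows "L2_inner \<Omega> (grad v) (grad v) \<le> CF\<^sup>2 * H2h_inner S \<Omega> \<Gamma> M zero_bd v zero_bd v"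
proof -
  have "sqrt (L2_inner \<Omega> (grad v) (grad v)) \<le> CF * sqrt (H2h_inner S \<Omega> \<Gamma> M zero_bd v zero_bd v)"
  proof (rule sqrt_quadratic_asymptotic)
    fix s :: real
    show "sqrt (L2_inner \<Omega> (grad y) (grad y) + s * (2 * L2_inner \<Omega> (grad y) (grad v)) +
        s\<^sup>2 * L2_inner \<Omega> (grad v) (grad v)) \<le>
      CF * (sqrt (H2h_inner S \<Omega> \<Gamma> M b y b y + s * (2 * H2h_inner S \<Omega> \<Gamma> M b y zero_bd v) +
        s\<^sup>2 * H2h_inner S \<Omega> \<Gamma> M zero_bd v zero_bd v) + K)"
      using bounded[OF Vh3_add_scaleR[OF y v, of s]] H2h_inner_expand[OF y v b, of s]
        L2_grad_expand[OF y v, of s]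
      by (simp add: L2_norm_def H2h_norm_def mult_ac)
  qed
  \<comment> \<open>The left side is nonnegative, so squaring is monotone whatever the sign of
    \<open>CF\<close>.\<close>
  then have "(sqrt (L2_inner \<Omega> (grad v) (grad v)))\<^sup>2 \<le>
      (CF * sqrt (H2h_inner S \<Omega> \<Gamma> M zero_bd v zero_bd v))\<^sup>2"
    by (intro power_mono) (simp_all add: L2_inner_nonneg)
  then show ?thesis
    by (simp add: power_mult_distrib L2_inner_nonneg H2h_inner_nonneg)
qed

lemma isometry_defect_bound:
  assumes b: "boundary_field (fst b)" "boundary_field (snd b)" and f: "f \<in> L2_space \<Omega>"
    and \<tau>: "\<tau> > 0"
    and friedrichs: "\<And>y. y \<in> Vh3 S k \<Omega> M \<Longrightarrow>
      L2_norm \<Omega> (grad y) \<le> CF * (H2h_norm S \<Omega> \<Gamma> M b y + K)"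
    and energy: "\<And>y. y \<in> Vh3 S k \<Omega> M \<Longrightarrow> E_h S \<Omega> \<Gamma> M \<gamma>0 \<gamma>1 f b y \<ge> - K'"
    and y0: "y 0 \<in> Vh3 S k \<Omega> M" "isometry_defect M (y 0) \<le> \<tau>"
    and flow: "gradient_flow S k \<Omega> \<Gamma> M \<gamma>0 \<gamma>1 f b \<tau> y"
  shows "isometry_defect M (y n) \<le> (1 + CF\<^sup>2 * (E_h S \<Omega> \<Gamma> M \<gamma>0 \<gamma>1 f b (y 0) + K')) * \<tau>"
proof -
  let ?E = "\<lambda>n. E_h S \<Omega> \<Gamma> M \<gamma>0 \<gamma>1 f b (y n)"
  note yV = gradient_flow_in_Vh3[of y, OF y0(1) flow]
  \<comment> \<open>The energy difference is kept in the induction claim, so that the increments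
    telescope without any factor depending on n.\<close>
  have "isometry_defect M (y n) \<le> \<tau> + CF\<^sup>2 * \<tau> * (?E 0 - ?E n)"
  proof (induction n)
    case (Suc n)
    obtain \<delta> where \<delta>: "\<delta> \<in> F_h S k \<Omega> M (y n)" and step: "y (Suc n) = (\<lambda>x. y n x + \<delta> x)"
      and eq: "\<And>v. v \<in> F_h S k \<Omega> M (y n) \<Longrightarrow>
           inverse \<tau> * H2h_inner S \<Omega> \<Gamma> M zero_bd \<delta> zero_bd v
             + a_h S \<Omega> \<Gamma> M \<gamma>0 \<gamma>1 zero_bd \<delta> zero_bd v
           = - a_h S \<Omega> \<Gamma> M \<gamma>0 \<gamma>1 b (y n) zero_bd v + L2_inner \<Omega> f v"
      using flow unfolding gradient_flow_def by blast
    have \<delta>V: "\<delta> \<in> Vh3 S k \<Omega> M"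
      using \<delta> by (simp add: F_h_def)
    define D where "D = H2h_inner S \<Omega> \<Gamma> M zero_bd \<delta> zero_bd \<delta>"
    have "a_h S \<Omega> \<Gamma> M \<gamma>0 \<gamma>1 zero_bd \<delta> zero_bd \<delta> \<ge> 0"
      by (rule coercivity_nonneg[OF b f energy yV \<delta>V])
    \<comment> \<open>The tested equation contributes \<open>a_h\<close> of the step once and the
      expansion gives back half of it; the remaining nonnegative half is discarded.\<close>
    then have "inverse \<tau> * D \<le> ?E n - ?E (Suc n)"
      using eq[OF \<delta>] E_h_expand[OF yV \<delta>V b f, of \<gamma>0 \<gamma>1 n 1] unfolding step D_def by simp
    then have "D \<le> \<tau> * (?E n - ?E (Suc n))"
      using \<tau> by (simp add: field_simps)
    then have "CF\<^sup>2 * D \<le> CF\<^sup>2 * (\<tau> * (?E n - ?E (Suc n)))"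
      by (rule mult_left_mono) simp
    moreover have "L2_inner \<Omega> (grad \<delta>) (grad \<delta>) \<le> CF\<^sup>2 * D"
      unfolding D_def by (rule friedrichs_homogeneous[OF b friedrichs yV \<delta>V])
    ultimately show ?case
      using Suc.IH isometry_defect_step[OF yV \<delta>] unfolding step by (simp add: algebra_simps)
  qed (use y0(2) in simp)
  \<comment> \<open>The lower energy bound removes the last iterate, leaving a bound uniform in
    n.\<close>
  also have "\<dots> \<le> \<tau> + CF\<^sup>2 * \<tau> * (?E 0 + K')"
    using energy[OF yV, of n] \<tau> by (intro add_left_mono mult_left_mono) auto
  also have "\<dots> = (1 + CF\<^sup>2 * (?E 0 + K')) * \<tau>"
    by (simp add: algebra_simps)
  finally show ?thesis .
qed

end

theorem lemma3p4:
  fixes S :: ref_shape and k :: nat and \<Omega> \<Gamma> :: "(real^2) set"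
    and H :: "real set" and \<T> :: "real \<Rightarrow> mesh"
  assumes "k \<ge> 2"
    and "bounded_lipschitz_domain \<Omega>"
    and "\<Gamma> \<noteq> {}" and "openin (top_of_set (frontier \<Omega>)) \<Gamma>"
    and "mesh_family S k \<Omega> \<Gamma> H \<T>"
  shows "\<exists>\<gamma>>0. \<forall>\<gamma>0\<ge>\<gamma>. \<forall>\<gamma>1\<ge>\<gamma>. \<forall>CF CFs.
    friedrichs_constant S k \<Omega> \<Gamma> H \<T> CF \<longrightarrow>
    coercivity_constant S k \<Omega> \<Gamma> H \<T> \<gamma>0 \<gamma>1 CFs \<longrightarrow>
    (\<forall>h\<in>H. \<forall>g \<Phi> b f \<tau> y.
       admissible_data \<Omega> g \<Phi> b \<longrightarrow> f \<in> L2_space \<Omega> \<longrightarrow> \<tau> > 0 \<longrightarrow>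
       y 0 \<in> Vh3 S k \<Omega> (\<T> h) \<longrightarrow>
       isometry_defect (\<T> h) (y 0) \<le> \<tau> \<longrightarrow>
       gradient_flow S k \<Omega> \<Gamma> (\<T> h) \<gamma>0 \<gamma>1 f b \<tau> y \<longrightarrow>
       (\<forall>\<epsilon> \<ge> (1 + CF\<^sup>2 * (E_h S \<Omega> \<Gamma> (\<T> h) \<gamma>0 \<gamma>1 f b (y 0) + CFs * R_data \<Omega> g \<Phi> f)) * \<tau>.
          \<forall>n\<ge>1. isometry_defect (\<T> h) (y n) \<le> \<epsilon>))"
proof (intro exI[of _ 1] conjI allI impI ballI)
  \<comment> \<open>The threshold 1 is a convenient positive number: the effect of large penalties
    is carried by the constant \<open>CFs\<close> in the coercivity estimate, which is tied to the
    given penalties.\<close>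
  fix \<gamma>0 \<gamma>1 CF CFs h g \<Phi> b f \<tau> y \<epsilon> n
  assume CF: "friedrichs_constant S k \<Omega> \<Gamma> H \<T> CF"
    and CFs: "coercivity_constant S k \<Omega> \<Gamma> H \<T> \<gamma>0 \<gamma>1 CFs"
    and h: "h \<in> H" and data: "admissible_data \<Omega> g \<Phi> b" "f \<in> L2_space \<Omega>" "\<tau> > 0"
    and y: "y 0 \<in> Vh3 S k \<Omega> (\<T> h)" "isometry_defect (\<T> h) (y 0) \<le> \<tau>"
      "gradient_flow S k \<Omega> \<Gamma> (\<T> h) \<gamma>0 \<gamma>1 f b \<tau> y"
    and \<epsilon>: "(1 + CF\<^sup>2 * (E_h S \<Omega> \<Gamma> (\<T> h) \<gamma>0 \<gamma>1 f b (y 0) + CFs * R_data \<Omega> g \<Phi> f)) * \<tau> \<le> \<epsilon>"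
  obtain C where "mesh_of S k \<Omega> \<Gamma> (\<T> h)" "shape_regular S C (\<T> h)" "density_equivalent S \<Gamma> C (\<T> h)"
    using assms(5) h unfolding mesh_family_def by auto
  then interpret regular_mesh S k \<Omega> \<Gamma> "\<T> h" C
    using assms(2) openin_imp_subset[OF assms(4)] by unfold_locales
  have b: "boundary_field (fst b)" "boundary_field (snd b)"
    using data(1) boundary_field_trace by (auto simp: admissible_data_def)
  have friedrichs: "L2_norm \<Omega> (grad v) \<le>
      CF * (H2h_norm S \<Omega> \<Gamma> (\<T> h) b v + (H1_norm \<Omega> g + H1_norm \<Omega> \<Phi>))"
    if "v \<in> Vh3 S k \<Omega> (\<T> h)" for v
  proof -
    have "0 \<le> L2_norm \<Omega> v"
      by (simp add: L2_norm_def L2_inner_nonneg)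
    moreover have "L2_norm \<Omega> v + L2_norm \<Omega> (grad v) \<le>
        CF * (H2h_norm S \<Omega> \<Gamma> (\<T> h) b v + H1_norm \<Omega> g + H1_norm \<Omega> \<Phi>)"
      using CF h data(1) that unfolding friedrichs_constant_def by blast
    ultimately show ?thesis
      by (simp add: add.assoc)
  qed
  obtain A where A: "A > 0" "\<And>v. v \<in> Vh3 S k \<Omega> (\<T> h) \<Longrightarrow>
      (H2h_norm S \<Omega> \<Gamma> (\<T> h) b v)\<^sup>2 \<le> A * (E_h S \<Omega> \<Gamma> (\<T> h) \<gamma>0 \<gamma>1 f b v + CFs * R_data \<Omega> g \<Phi> f)"
    using CFs h data(1,2) unfolding coercivity_constant_def by blast
  have energy: "E_h S \<Omega> \<Gamma> (\<T> h) \<gamma>0 \<gamma>1 f b v \<ge> - (CFs * R_data \<Omega> g \<Phi> f)"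
    if "v \<in> Vh3 S k \<Omega> (\<T> h)" for v
  proof -
    have "0 \<le> A * (E_h S \<Omega> \<Gamma> (\<T> h) \<gamma>0 \<gamma>1 f b v + CFs * R_data \<Omega> g \<Phi> f)"
      by (rule order_trans[OF zero_le_power2 A(2)[OF that]])
    with A(1) show ?thesis
      by (simp add: zero_le_mult_iff)
  qed
  show "isometry_defect (\<T> h) (y n) \<le> \<epsilon>"
    using isometry_defect_bound[OF b data(2,3) friedrichs energy y] \<epsilon> by (rule order_trans)
qed simp

end
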